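(* Let $p<q<r$ be odd primes. Suppose that $\min\{\overline{q_{p}},\, p-\overline{q_{p}},\, \overline{r_{p}},\, p-\overline{r_{p}}\}>\frac{p-1}{3}$. Then $A(pqr)\leqslant \frac{p+\beta^{*}}{2}$.
   Context: For a positive integer $n$, $\Phi_n(x)=\sum_{i=0}^{\phi(n)}c_i x^i$ denotes the $n$th cyclotomic polynomial ($\phi$ is Euler's totient function), and $A(n)=\max\{|c_i| : 0\leqslant i\leqslant \phi(n)\}$ is the largest absolute value of its coefficients. For odd primes $p<q<r$: $\overline{q_{p}}$ is the unique integer with $0<\overline{q_{p}}<p$ and $q\equiv\overline{q_{p}}\pmod p$, and $\overline{r_{p}}$ is the unique integer with $0<\overline{r_{p}}<p$ and $r\equiv\overline{r_{p}}\pmod p$. Also $q_{p}^{*}$ is the unique integer with $0<q_{p}^{*}<p$ and $q\,q_{p}^{*}\equiv 1\pmod p$, and $r_{p}^{*}$ is the unique integer with $0<r_{p}^{*}<p$ and $r\,r_{p}^{*}\equiv 1\pmod p$. Set $\alpha=\min\{q_{p}^{*},\, r_{p}^{*},\, p-q_{p}^{*},\, p-r_{p}^{*}\}$, let $\beta$ be the unique integer with $0<\beta<p$ and $\alpha\beta qr\equiv 1\pmod p$, and put $\beta^{*}=\min\{\beta,\, p-\beta\}$. *)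

theory Defs
  imports
    Complex_Main
    "HOL-Computational_Algebra.Polynomial"
    "HOL-Number_Theory.Totient"
    "HOL-Number_Theory.Modular_Inverse"
begin

definition cyclotomic_poly :: "nat \<Rightarrow> complex poly" where
  "cyclotomic_poly n = (\<Prod>k\<in>totatives n. [:- cis (2 * pi * real k / real n), 1:])"

(* The coefficients are rational integers, so the complex norm is their usual absolute value. *)
definition cyclotomic_height :: "nat \<Rightarrow> real" where
  "cyclotomic_height n = Max ((\<lambda>i. norm (coeff (cyclotomic_poly n) i)) ` {0..totient n})"

(* For distinct primes p, q, r, all the modular inverses taken below have arguments coprime to p,
   and so are the unique inverses modulo p lying strictly between 0 and p. *)

definition alpha :: "nat \<Rightarrow> nat \<Rightarrow> nat \<Rightarrow> int" where
  "alpha p q r =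
     (let q' = modular_inverse (int p) (int q); r' = modular_inverse (int p) (int r)
      in Min {q', r', int p - q', int p - r'})"

definition beta :: "nat \<Rightarrow> nat \<Rightarrow> nat \<Rightarrow> int" where
  "beta p q r = modular_inverse (int p) (alpha p q r * int q * int r)"

definition beta_star :: "nat \<Rightarrow> nat \<Rightarrow> nat \<Rightarrow> int" where
  "beta_star p q r = min (beta p q r) (int p - beta p q r)"

end

theory Submission
  imports Defs "HOL-Computational_Algebra.Fundamental_Theorem_Algebra" "HOL-Number_Theory.Cong"
begin

text \<open>
  Let \<open>N m\<close> be the number of representations \<open>m = A q r + B p r + C p q\<close> with \<open>A, B, C \<ge> 0\<close>.  The
  factorisation of \<open>x\<^sup>m - 1\<close> into cyclotomic polynomials expresses the \<open>n\<close>-th coefficient of the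
  cyclotomic polynomial of order \<open>p q r\<close> as the sum of \<open>N m - N (m - q) - N (m - r) + N (m - q - r)\<close>
  over the \<open>p\<close> consecutive integers \<open>m \<le> n\<close> (\<open>coeff_cyclotomic_three_primes\<close>).

  Let \<open>\<alpha>\<close> and \<open>\<beta>\<close> be the distances from the inverses of \<open>q\<close> and \<open>r\<close> modulo \<open>p\<close> to the nearest multiple
  of \<open>p\<close>, named so that \<open>\<alpha> \<le> \<beta>\<close>; then \<open>\<beta>\<close> is \<open>\<beta>\<^sup>*\<close>.  Since \<open>\<alpha> q = p a \<plusminus> 1\<close> and \<open>\<beta> r = p b \<plusminus> 1\<close>, both \<open>\<plusminus>r\<close>
  and \<open>\<plusminus>q\<close> are values of the form itself, at \<open>(\<alpha>, -a, 0)\<close> and \<open>(\<beta>, 0, -b)\<close>.  The four counts therefore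
  count the points of four translated octants, and the alternating sum of the indicator functions
  collapses: it is \<open>1\<close> on the points of type \<open>T\<close> (\<open>0 \<le> A < \<alpha>\<close> and \<open>B, C \<ge> 0\<close>) and of type \<open>K\<close>
  (\<open>A \<ge> \<alpha> + \<beta>\<close>, \<open>-a \<le> B < 0\<close>, \<open>-b \<le> C < 0\<close>), it is \<open>0\<close> or \<open>-1\<close> for \<open>\<alpha> \<le> A < \<alpha> + \<beta>\<close>, and \<open>0\<close> elsewhere.
  As the polynomial is reciprocal, \<open>n\<close> may be taken below half the degree; then every integer is the
  value of at most one point of type \<open>T\<close> or \<open>K\<close>, and the values of \<open>A\<close> on the points counted negatively
  are distinct.  So, up to sign, the coefficient is at least \<open>-\<beta>\<close>, and it remains to show that in a
  window of \<open>p\<close> consecutive values the number \<open>P\<close> (\<open>num\<close> below) of points of type \<open>T\<close> or \<open>K\<close> satisfies \<open>2 P \<le> p + \<beta>\<close>.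

  The residues of \<open>A\<close> modulo \<open>p\<close> are distinct.  For \<open>3 \<beta> \<ge> p\<close> they miss \<open>\<beta>\<close> classes, and for
  \<open>4 \<alpha> + \<beta> \<le> p\<close> there are at most \<open>\<alpha>\<close> points of type \<open>T\<close> and \<open>\<alpha> + \<beta>\<close> of type \<open>K\<close>; both give the bound.
  In the remaining range the hypothesis on the residues of \<open>q\<close> and \<open>r\<close> gives \<open>q r \<noteq> \<plusminus>1\<close> modulo \<open>p\<close>
  (\<open>not_cong_pm1\<close>).  Number the values of the window by positions.  From one position to the next, \<open>A\<close>
  drops by a constant \<open>W\<close> modulo \<open>p\<close>, and \<open>W\<close> is congruent to \<open>\<alpha> \<beta>\<close> or \<open>-\<alpha> \<beta>\<close> but not to \<open>0\<close> or \<open>\<plusminus>1\<close>.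
  Suppose \<open>2 P > p + \<beta>\<close>.  Three tools carry the argument.
  \<^item> If the values of \<open>A\<close> on \<open>T\<close>, translated by some \<open>E\<close>, avoid those on \<open>K\<close>, then \<open>P\<close> is small
    (\<open>translate_bound\<close>); so for suitable distances \<open>\<sigma>\<close> some point of \<open>T\<close> has a point of \<open>K\<close> exactly \<open>\<sigma>\<close>
    positions away.
  \<^item> Two pairs of positions with the same distance differ by a relation \<open>(p X, q Y, r Z)\<close> with
    \<open>X + Y + Z = 0\<close> (\<open>parallel\<close>).  Comparing signs, such passages between \<open>T\<close> and \<open>K\<close> in both directions
    at the same distance force large differences of \<open>A\<close> (\<open>opposite_passages\<close>).
  \<^item> A translation of positions that maps nearly all of \<open>T\<close> into itself moves the interval \<open>{0..<\<alpha>}\<close> of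
    values of \<open>A\<close> by \<open>1\<close> or \<open>-1\<close> (\<open>T_translation\<close>).

  If two points of type \<open>K\<close> are adjacent, the first two tools, applied at distances \<open>\<sigma>\<close> with \<open>\<sigma> W\<close> near
  \<open>p/2\<close> or with small \<open>\<sigma>\<close>, give a contradiction (\<open>monotone_neighbours_False\<close>, \<open>opposite_neighbours_False\<close>).
  Otherwise, up to reversing the window, no point of type \<open>K\<close> immediately precedes a point of either
  type.  Counting positions then leaves no slack at all: \<open>\<alpha> = \<beta>\<close>, there are exactly \<open>\<alpha>\<close> points of type
  \<open>T\<close>, and no two adjacent positions are empty.  The pattern of positions is forced to be periodic with
  period 1, 3 or 5, and the third tool yields an arithmetic relation that contradicts the congruence for
  \<open>W\<close>, apart from \<open>p = 7\<close>, which is excluded directly (\<open>tight_configuration_False\<close>).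
\<close>

section \<open>Cyclotomic polynomials\<close>

text \<open>
  The derivative vanishes only at \<open>0\<close>, so \<open>x\<^sup>n - 1\<close> is square-free and equals the product over its roots.
  The exponents are taken from \<open>{0<..n}\<close>, the range of \<^const>\<open>totatives\<close>.
\<close>

lemma unity_poly_decompose:
  assumes "n > 0"
  shows "(\<Prod>k\<in>{0<..n}. [:- cis (2 * pi * real k / real n), 1:]) = monom 1 n - 1"
proof -
  let ?P = "monom 1 n - 1 :: complex poly" and ?f = "\<lambda>k. cis (2 * pi * real k / real n)"
  have deg: "degree (1 :: complex poly) < degree (monom (1::complex) n)" using assms by (simp add: degree_monom_eq)
  have lead: "lead_coeff ?P = 1"
  proof -
    have "lead_coeff (- 1 + monom 1 n :: complex poly) = lead_coeff (monom (1::complex) n)"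
      by (rule lead_coeff_add_le) (use deg in simp)
    moreover have "- 1 + monom 1 n = ?P" by simp
    ultimately show ?thesis using assms by (simp only: lead_coeff_monom)
  qed
  have "rsquarefree ?P"
  proof (subst rsquarefree_roots, intro allI notI, elim conjE)
    fix a assume "poly ?P a = 0" "poly (pderiv ?P) a = 0"
    hence "a ^ n = 1" "of_nat n * a ^ (n - 1) = 0" by (simp_all add: poly_monom pderiv_diff pderiv_monom)
    thus False using assms by (auto simp: power_0_left split: if_splits)
  qed
  from complex_poly_decompose_rsquarefree[OF this]
  have "?P = (\<Prod>z | z ^ n = 1. [:- z, 1:])" using lead by (simp add: poly_monom)
  also have "\<dots> = (\<Prod>k<n. [:- ?f k, 1:])"
    using prod.reindex_bij_betw[OF bij_betw_roots_unity[OF assms], of "\<lambda>z. [:- z, 1:]"] by simp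
  also have "\<dots> = (\<Prod>k\<in>{0<..n}. [:- ?f k, 1:])"
  proof -
    have "{..<n} = insert 0 {0<..<n}" "{0<..n} = insert n {0<..<n}" using assms by auto
    thus ?thesis using assms by simp
  qed
  finally show ?thesis ..
qed

text \<open>
  The exponents \<open>k \<le> n\<close> with \<open>gcd k n = d\<close> are the multiples by \<open>d\<close> of the totatives of \<open>n div d\<close>.
\<close>

lemma prod_cyclotomic_poly:
  assumes "n > 0"
  shows "(\<Prod>d | d dvd n. cyclotomic_poly d) = monom 1 n - 1"
proof -
  let ?f = "\<lambda>k. [:- cis (2 * pi * real k / real n), 1:]"
  define A where "A = (\<lambda>d. {k\<in>{0<..n}. gcd k n = d})"
  have "{0<..n} = (\<Union>d\<in>{d. d dvd n}. A d)" by (auto simp: A_def)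
  hence "monom 1 n - 1 = prod ?f (\<Union>d\<in>{d. d dvd n}. A d)" using unity_poly_decompose[OF assms] by simp
  also have "\<dots> = (\<Prod>d | d dvd n. prod ?f (A d))"
    using assms by (intro prod.UNION_disjoint) (auto simp: A_def)
  also have "\<dots> = (\<Prod>d | d dvd n. cyclotomic_poly (n div d))"
  proof (intro prod.cong refl)
    fix d assume "d \<in> {d. d dvd n}"
    hence d: "d dvd n" by simp
    hence "real k / real (n div d) = real (k * d) / real n" for k
      using assms by (auto simp: real_of_nat_div)
    hence "cyclotomic_poly (n div d) = (\<Prod>k\<in>totatives (n div d). ?f (k * d))"
      unfolding cyclotomic_poly_def by (metis (no_types, lifting) times_divide_eq_right)
    also have "\<dots> = prod ?f (A d)"
      using prod.reindex_bij_betw[OF bij_betw_totatives_gcd_eq[OF d assms], of ?f] unfolding A_def .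
    finally show "prod ?f (A d) = cyclotomic_poly (n div d)" ..
  qed
  also have "\<dots> = (\<Prod>d | d dvd n. cyclotomic_poly d)"
    using assms by (intro prod.reindex_bij_witness[of _ "(div) n" "(div) n"]) (auto elim: dvdE)
  finally show ?thesis ..
qed

text \<open>
  Peeling off one prime at a time lists the divisors of a square-free number without having to compare
  them with each other.
\<close>

lemma prod_divisors_prime_mult:
  fixes F :: "nat \<Rightarrow> 'a :: comm_monoid_mult"
  assumes "prime p" "\<not> p dvd m" "m > 0"
  shows "(\<Prod>d | d dvd p * m. F d) = (\<Prod>d | d dvd m. F d) * (\<Prod>d | d dvd m. F (p * d))"
proof -
  have eq: "{d. d dvd p * m} = {d. d dvd m} \<union> (\<lambda>d. p * d) ` {d. d dvd m}"
  proof (intro equalityI subsetI)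
    fix d assume "d \<in> {d. d dvd p * m}"
    hence d: "d dvd p * m" by simp
    show "d \<in> {d. d dvd m} \<union> (\<lambda>d. p * d) ` {d. d dvd m}"
    proof (cases "p dvd d")
      case True
      then obtain e where "d = p * e" by blast
      thus ?thesis using d assms(1) by (auto simp: prime_gt_0_nat)
    next
      case False
      hence "coprime d p" using assms(1) by (metis coprime_commute prime_imp_coprime)
      thus ?thesis using d by (simp add: coprime_dvd_mult_right_iff)
    qed
  qed auto
  have "p > 0" using assms(1) by (rule prime_gt_0_nat)
  show ?thesis unfolding eq using assms \<open>p > 0\<close>
    by (subst prod.union_disjoint) (auto simp: prod.reindex inj_on_def dest: dvd_mult_left)
qed

text \<open>
  Both sides are products of polynomials \<open>cyclotomic_poly d\<close>, because the geometric sum is the one of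
  order \<open>p\<close>.
\<close>

lemma cyclotomic_three_primes:
  assumes "prime p" "prime q" "prime r" "p \<noteq> q" "p \<noteq> r" "q \<noteq> r"
  shows "(monom 1 (p * q * r) - 1) * (monom 1 q - 1) * (monom 1 r - 1) * (\<Sum>k<p. monom 1 k)
    = cyclotomic_poly (p * q * r) * (monom 1 (p * q) - 1) * (monom 1 (p * r) - 1) * (monom 1 (q * r) - 1)"
proof -
  have nd: "\<not> p dvd q" "\<not> p dvd r" "\<not> q dvd r" "\<not> p dvd q * r"
    using assms by (auto simp: primes_dvd_imp_eq prime_dvd_mult_iff dest: primes_dvd_imp_eq)
  have not1: "\<not> p dvd 1" "\<not> q dvd 1" "\<not> r dvd 1" using assms by (auto simp: not_prime_1)
  have pos: "p > 0" "q > 0" "r > 0" using assms by (auto simp: prime_gt_0_nat)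
  let ?c = cyclotomic_poly
  have E1: "monom 1 1 - 1 = ?c 1" using prod_cyclotomic_poly[of 1] by simp
  have div: "(\<Prod>d | d dvd u. F d) = F 1 * F u" if "prime u" for u and F :: "nat \<Rightarrow> complex poly"
    using prod_divisors_prime_mult[of u 1 F] prime_gt_1_nat[OF that] that by simp
  have E: "monom 1 u - 1 = ?c 1 * ?c u" if "prime u" for u
    using prod_cyclotomic_poly[of u] div[OF that, of ?c] that by (simp add: prime_gt_0_nat)
  have E2: "monom 1 (u * v) - 1 = ?c 1 * ?c v * (?c u * ?c (u * v))" if "prime u" "prime v" "\<not> u dvd v" for u v
    using prod_cyclotomic_poly[of "u * v"] prod_divisors_prime_mult[of u v ?c] div[OF that(2)] that
    by (simp add: prime_gt_0_nat)
  have "monom 1 (p * (q * r)) - 1 = (\<Prod>d | d dvd q * r. ?c d) * (\<Prod>d | d dvd q * r. ?c (p * d))"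
    using prod_cyclotomic_poly[of "p * (q * r)"] prod_divisors_prime_mult[of p "q * r" ?c] nd assms pos by simp
  also have "\<dots> = (?c 1 * ?c r * (?c q * ?c (q * r))) * (?c p * ?c (p * r) * (?c (p * q) * ?c (p * (q * r))))"
    using prod_divisors_prime_mult[of q r ?c] prod_divisors_prime_mult[of q r "\<lambda>d. ?c (p * d)"]
      div[OF assms(3)] nd assms pos by simp
  finally have E3: "monom 1 (p * (q * r)) - 1
    = (?c 1 * ?c r * (?c q * ?c (q * r))) * (?c p * ?c (p * r) * (?c (p * q) * ?c (p * (q * r))))" .
  have S: "monom 1 p - 1 = (monom 1 1 - 1) * (\<Sum>k<p. monom (1::complex) k)"
    using power_diff_1_eq[of "monom (1::complex) 1" p] by (simp add: monom_power)
  have ne: "?c 1 \<noteq> 0"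
  proof
    assume "?c 1 = 0"
    hence "coeff (monom (1::complex) 1 - 1) 1 = 0" using E1 by simp
    thus False by simp
  qed
  have "?c 1 * (\<Sum>k<p. monom (1::complex) k) = ?c 1 * ?c p" using S E1 E[OF assms(1)] by metis
  hence "(\<Sum>k<p. monom (1::complex) k) = ?c p" using ne by (simp only: mult_cancel_left) simp
  thus ?thesis
    using E[OF assms(2)] E[OF assms(3)] E2[of p q] E2[of p r] E2[of q r] E3 nd assms
    by (simp add: mult_ac)
qed

lemma degree_cyclotomic_poly: "degree (cyclotomic_poly n) = totient n"
  unfolding cyclotomic_poly_def totient_def by (simp add: degree_prod_sum_eq)

text \<open>
  Inversion permutes the roots, so reversing the coefficients multiplies the polynomial by the constant
  \<open>\<Prod>(-\<zeta>)\<close>, which has modulus 1.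
\<close>

lemma norm_coeff_cyclotomic_poly_reflect:
  assumes "n > 1" "i \<le> totient n"
  shows "norm (coeff (cyclotomic_poly n) (totient n - i)) = norm (coeff (cyclotomic_poly n) i)"
proof -
  let ?z = "\<lambda>k. cis (2 * pi * real k / real n)"
  have "reflect_poly (cyclotomic_poly n) = (\<Prod>k\<in>totatives n. reflect_poly [:- ?z k, 1:])"
    unfolding cyclotomic_poly_def by (rule reflect_poly_prod)
  also have "\<dots> = (\<Prod>k\<in>totatives n. smult (- ?z k) [:- ?z (n - k), 1:])"
  proof (intro prod.cong refl)
    fix k assume k: "k \<in> totatives n"
    hence "k \<le> n" by (simp add: in_totatives_iff)
    hence "2 * pi * real (n - k) / real n = 2 * pi - 2 * pi * real k / real n"
      using assms(1) by (simp add: field_simps of_nat_diff)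
    hence "?z k * ?z (n - k) = 1" by (simp add: cis_mult)
    moreover have "reflect_poly [:- ?z k, 1:] = [:1, - ?z k:]"
      by (simp add: reflect_poly_def)
    ultimately show "reflect_poly [:- ?z k, 1:] = smult (- ?z k) [:- ?z (n - k), 1:]" by simp
  qed
  also have "\<dots> = smult (\<Prod>k\<in>totatives n. - ?z k) (\<Prod>k\<in>totatives n. [:- ?z (n - k), 1:])"
    by (rule prod_smult)
  also have "(\<Prod>k\<in>totatives n. [:- ?z (n - k), 1:]) = (\<Prod>k\<in>totatives n. [:- ?z k, 1:])"
  proof (rule prod.reindex_bij_witness[of _ "\<lambda>k. n - k" "\<lambda>k. n - k"])
    fix k assume k: "k \<in> totatives n"
    have "k < n" using k assms(1) by (simp add: totatives_less)
    thus "n - k \<in> totatives n" "n - (n - k) = k"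
      using k gcd_diff2_nat[of k n] by (auto simp: in_totatives_iff coprime_iff_gcd_eq_1)
    show "n - k \<in> totatives n" "n - (n - k) = k" by fact+
  qed auto
  finally have "reflect_poly (cyclotomic_poly n) = smult (\<Prod>k\<in>totatives n. - ?z k) (cyclotomic_poly n)"
    unfolding cyclotomic_poly_def .
  hence "coeff (cyclotomic_poly n) (totient n - i) = (\<Prod>k\<in>totatives n. - ?z k) * coeff (cyclotomic_poly n) i"
    using assms(2) coeff_reflect_poly[of "cyclotomic_poly n" i] by (simp add: degree_cyclotomic_poly)
  thus ?thesis by (simp add: norm_mult prod_norm[symmetric])
qed

section \<open>Coefficients as alternating counts of lattice points\<close>

text \<open>
  Coefficient sequences are indexed by all integers, and multiplication by \<open>x\<^sup>d - 1\<close> becomes a difference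
  operator.  On sequences that vanish at negative indices this operator is injective, which replaces
  division of power series.
\<close>

definition coeff_int :: "'a :: comm_ring_1 poly \<Rightarrow> int \<Rightarrow> 'a" where
  "coeff_int P m = (if m < 0 then 0 else coeff P (nat m))"

definition back_diff :: "int \<Rightarrow> (int \<Rightarrow> 'a :: comm_ring_1) \<Rightarrow> int \<Rightarrow> 'a" where
  "back_diff d f m = f (m - d) - f m"

lemma coeff_int_mult_unity: "coeff_int ((monom 1 d - 1) * P) = back_diff (int d) (coeff_int P)"
  by (rule ext) (auto simp: coeff_int_def back_diff_def left_diff_distrib coeff_monom_mult nat_diff_distrib
      not_less nat_less_iff)

lemma back_diff_commute: "back_diff d (back_diff e f) = back_diff e (back_diff d f)"
  by (rule ext) (simp add: back_diff_def algebra_simps)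

lemma back_diff_inject:
  assumes "d > 0" "\<And>m. m < 0 \<Longrightarrow> f m = 0" "\<And>m. m < 0 \<Longrightarrow> g m = 0" and eq: "back_diff d f = back_diff d g"
  shows "f = g"
proof
  fix m
  have per: "f (m - d) - g (m - d) = f m - g m" for m
    using fun_cong[OF eq, of m] by (simp add: back_diff_def algebra_simps)
  have "f (m - int j * d) - g (m - int j * d) = f m - g m" for j
  proof (induction j)
    case (Suc j)
    have "m - int (Suc j) * d = m - int j * d - d" by (simp add: algebra_simps)
    thus ?case using per[of "m - int j * d"] Suc by metis
  qed simp
  from this[of "nat (\<bar>m\<bar> + 1)"] have "f (m - (\<bar>m\<bar> + 1) * d) - g (m - (\<bar>m\<bar> + 1) * d) = f m - g m" by simp
  moreover have "(\<bar>m\<bar> + 1) * 1 \<le> (\<bar>m\<bar> + 1) * d" using assms(1) by (intro mult_left_mono) auto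
  hence "m - (\<bar>m\<bar> + 1) * d < 0" by (simp only: mult_1_right)
  ultimately show "f m = g m" using assms(2,3)[of "m - (\<bar>m\<bar> + 1) * d"] by simp
qed

lemma back_diff_neg: "(\<And>m. m < 0 \<Longrightarrow> f m = 0) \<Longrightarrow> d \<ge> 0 \<Longrightarrow> m < 0 \<Longrightarrow> back_diff d f m = 0"
  by (simp add: back_diff_def)

definition orthant :: "int \<Rightarrow> int \<Rightarrow> int \<Rightarrow> (int \<times> int \<times> int) set" where
  "orthant x y z = {x..} \<times> {y..} \<times> {z..}"

fun shift :: "int \<times> int \<times> int \<Rightarrow> int \<times> int \<times> int \<Rightarrow> int \<times> int \<times> int" where
  "shift (x, y, z) (A, B, C) = (A + x, B + y, C + z)"

locale moduli =
  fixes p q r :: int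
  assumes moduli_pos: "p > 0" "q > 0" "r > 0"
begin

fun val :: "int \<times> int \<times> int \<Rightarrow> int" where
  "val (A, B, C) = A * (q * r) + B * (p * r) + C * (p * q)"

definition fibre :: "(int \<times> int \<times> int) set \<Rightarrow> int \<Rightarrow> (int \<times> int \<times> int) set" where
  "fibre S m = {t\<in>S. val t = m}"

definition N :: "int \<Rightarrow> int" where "N m = int (card (fibre (orthant 0 0 0) m))"

lemma val_shift: "val (shift v t) = val t + val v"
  by (cases v; cases t) (simp add: algebra_simps)

lemma inj_shift: "inj (shift v)"
  by (cases v) (auto simp: inj_on_def)

lemma finite_fibre_orthant: "finite (fibre (orthant x y z) m)"
proof -
  define D where "D = m - val (x, y, z)"
  have "fibre (orthant x y z) m \<subseteq> {x..x + D} \<times> {y..y + D} \<times> {z..z + D}"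
  proof
    fix t assume t: "t \<in> fibre (orthant x y z) m"
    obtain A B C where ABC: "t = (A, B, C)" by (cases t)
    have ge: "x \<le> A" "y \<le> B" "z \<le> C" and m: "A * (q * r) + B * (p * r) + C * (p * q) = m"
      using t unfolding ABC fibre_def orthant_def by auto
    have D: "(A - x) * (q * r) + (B - y) * (p * r) + (C - z) * (p * q) = D"
      using m unfolding D_def by (simp add: algebra_simps)
    have grow: "0 \<le> u \<Longrightarrow> 0 < v \<Longrightarrow> u \<le> u * v \<and> 0 \<le> u * v" for u v :: int
      using mult_left_mono[of 1 v u] by simp
    have "0 < q * r" "0 < p * r" "0 < p * q" using moduli_pos by auto
    hence "A - x \<le> D" "B - y \<le> D" "C - z \<le> D"
      using grow[of "A - x" "q * r"] grow[of "B - y" "p * r"] grow[of "C - z" "p * q"] ge D by linarith+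
    thus "t \<in> {x..x + D} \<times> {y..y + D} \<times> {z..z + D}" using ge unfolding ABC by simp
  qed
  thus ?thesis by (rule finite_subset) simp
qed

lemma card_fibre_orthant: "int (card (fibre (orthant x y z) m)) = N (m - val (x, y, z))"
proof -
  have "fibre (orthant x y z) m = shift (x, y, z) ` fibre (orthant 0 0 0) (m - val (x, y, z))"
  proof (intro equalityI subsetI)
    fix t assume t: "t \<in> fibre (orthant x y z) m"
    obtain A B C where ABC: "t = (A, B, C)" by (cases t)
    have "t = shift (x, y, z) (A - x, B - y, C - z)" using ABC by simp
    moreover from this have "val (A - x, B - y, C - z) = m - val (x, y, z)"
      using t val_shift[of "(x, y, z)" "(A - x, B - y, C - z)"] unfolding fibre_def by simp
    hence "(A - x, B - y, C - z) \<in> fibre (orthant 0 0 0) (m - val (x, y, z))"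
      using t unfolding fibre_def orthant_def ABC by simp
    ultimately show "t \<in> shift (x, y, z) ` fibre (orthant 0 0 0) (m - val (x, y, z))" by (rule image_eqI)
  next
    fix t assume "t \<in> shift (x, y, z) ` fibre (orthant 0 0 0) (m - val (x, y, z))"
    then obtain u where u: "t = shift (x, y, z) u" "u \<in> fibre (orthant 0 0 0) (m - val (x, y, z))" by blast
    have "val t = m" using u val_shift[of "(x, y, z)" u] unfolding fibre_def by simp
    thus "t \<in> fibre (orthant x y z) m" using u unfolding fibre_def orthant_def by (cases u) auto
  qed
  thus ?thesis unfolding N_def by (simp add: card_image inj_on_subset[OF inj_shift])
qed

text \<open>
  If a region is the disjoint union of a face and of its own translate by \<open>v\<close>, the difference operator of
  width \<open>val v\<close> cuts the counting function down to the face, up to sign.  Applied to the octant in the three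
  coordinate directions, this leaves the origin only.
\<close>

lemma card_fibre_rec:
  assumes S: "S = S' \<union> shift v ` S" "S' \<inter> shift v ` S = {}" and fin: "\<And>m. finite (fibre S m)"
  shows "int (card (fibre S (m - val v))) - int (card (fibre S m)) = - int (card (fibre S' m))"
proof -
  have "fibre S m = fibre S' m \<union> shift v ` fibre S (m - val v)"
  proof (intro equalityI subsetI)
    fix t assume t: "t \<in> fibre S m"
    hence "t \<in> S' \<union> shift v ` S" using S(1) unfolding fibre_def by blast
    thus "t \<in> fibre S' m \<union> shift v ` fibre S (m - val v)"
      using t unfolding fibre_def by (auto simp: val_shift)
  next
    fix t assume "t \<in> fibre S' m \<union> shift v ` fibre S (m - val v)"
    hence "t \<in> S' \<union> shift v ` S" "val t = m" unfolding fibre_def by (auto simp: val_shift)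
    thus "t \<in> fibre S m" using S(1) unfolding fibre_def by blast
  qed
  moreover have "fibre S' m \<inter> shift v ` fibre S (m - val v) = {}" using S(2) unfolding fibre_def by blast
  moreover have "fibre S' m \<subseteq> fibre S m" using S(1) unfolding fibre_def by blast
  hence "finite (fibre S' m)" using fin finite_subset by blast
  ultimately have "card (fibre S m) = card (fibre S' m) + card (shift v ` fibre S (m - val v))"
    using fin by (simp add: card_Un_disjoint)
  thus ?thesis by (simp add: card_image inj_on_subset[OF inj_shift])
qed

lemma N_neg: "m < 0 \<Longrightarrow> N m = 0"
proof -
  assume m: "m < 0"
  have "fibre (orthant 0 0 0) m = {}"
  proof (rule equals0I)
    fix t assume t: "t \<in> fibre (orthant 0 0 0) m"
    obtain A B C where ABC: "t = (A, B, C)" by (cases t)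
    have "0 \<le> A * (q * r) + B * (p * r) + C * (p * q)"
      using t moduli_pos unfolding ABC fibre_def orthant_def by (intro add_nonneg_nonneg mult_nonneg_nonneg) auto
    thus False using t m unfolding ABC fibre_def by simp
  qed
  thus "N m = 0" unfolding N_def by simp
qed

lemma back_diff_N:
  "back_diff (p * q) (back_diff (p * r) (back_diff (q * r) N)) = (\<lambda>m. if m = 0 then -1 else 0)"
proof -
  let ?c = "\<lambda>S m. int (card (fibre S m))"
  let ?O = "orthant 0 0 0" let ?S = "{0} \<times> {0..} \<times> {0..}" let ?R = "{0} \<times> {0} \<times> {0..}"
  have sub: "finite (fibre S m)" if "S \<subseteq> ?O" for S m
    by (rule finite_subset[OF _ finite_fibre_orthant[of 0 0 0 m]]) (use that in \<open>auto simp: fibre_def\<close>)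
  have finS: "finite (fibre ?S m)" and finR: "finite (fibre ?R m)" for m
    by (auto intro!: sub simp: orthant_def)
  have 1: "back_diff (q * r) N m = - ?c ?S m" for m
  proof -
    have "?O = ?S \<union> shift (1, 0, 0) ` ?O"
    proof (intro equalityI subsetI)
      fix t assume t: "t \<in> ?O"
      obtain A B C where "t = (A, B, C)" by (cases t)
      thus "t \<in> ?S \<union> shift (1, 0, 0) ` ?O" using t unfolding orthant_def
        by (cases "A = 0") (auto intro!: image_eqI[of _ _ "(A - 1, B, C)"])
    qed (auto simp: orthant_def)
    moreover have "?S \<inter> shift (1, 0, 0) ` ?O = {}" by (auto simp: orthant_def)
    ultimately show ?thesis unfolding back_diff_def N_def using card_fibre_rec[of ?O ?S "(1, 0, 0)" m] sub[of ?O] by simp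
  qed
  have 2: "back_diff (p * r) (\<lambda>m. - ?c ?S m) m = ?c ?R m" for m
  proof -
    have "?S = ?R \<union> shift (0, 1, 0) ` ?S"
    proof (intro equalityI subsetI)
      fix t :: "int \<times> int \<times> int" assume t: "t \<in> ?S"
      obtain A B C where "t = (A, B, C)" by (cases t)
      thus "t \<in> ?R \<union> shift (0, 1, 0) ` ?S" using t
        by (cases "B = 0") (auto intro!: image_eqI[of _ _ "(A, B - 1, C)"])
    qed auto
    moreover have "?R \<inter> shift (0, 1, 0) ` ?S = {}" by auto
    ultimately show ?thesis unfolding back_diff_def using card_fibre_rec[of ?S ?R "(0, 1, 0)" m] finS by simp
  qed
  have 3: "back_diff (p * q) (\<lambda>m. ?c ?R m) m = - ?c {(0, 0, 0)} m" for m
  proof -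
    have "?R = {(0, 0, 0)} \<union> shift (0, 0, 1) ` ?R"
    proof (intro equalityI subsetI)
      fix t :: "int \<times> int \<times> int" assume t: "t \<in> ?R"
      obtain A B C where "t = (A, B, C)" by (cases t)
      thus "t \<in> {(0, 0, 0)} \<union> shift (0, 0, 1) ` ?R" using t
        by (cases "C = 0") (auto intro!: image_eqI[of _ _ "(A, B, C - 1)"])
    qed auto
    moreover have "{(0, 0, 0)} \<inter> shift (0, 0, 1) ` ?R = {}" by auto
    ultimately show ?thesis unfolding back_diff_def using card_fibre_rec[of ?R "{(0, 0, 0)}" "(0, 0, 1)" m] finR by simp
  qed
  have "fibre {(0, 0, 0)} m = (if m = 0 then {(0, 0, 0)} else {})" for m unfolding fibre_def by auto
  thus ?thesis unfolding ext[OF 1] ext[OF 2] ext[OF 3] by (auto simp: fun_eq_iff)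
qed

end

text \<open>
  The three difference operators of widths \<open>p q\<close>, \<open>p r\<close>, \<open>q r\<close> turn \<open>N\<close> into minus the unit impulse, so up to
  sign it is the series by which one divides in \<open>cyclotomic_three_primes\<close>.  Below \<open>p q r\<close> the factor
  \<open>x\<^bsup>pqr\<^esup> - 1\<close> acts as \<open>-1\<close>.
\<close>

lemma coeff_cyclotomic_three_primes:
  fixes p q r n :: nat
  assumes primes: "prime p" "prime q" "prime r" "p \<noteq> q" "p \<noteq> r" "q \<noteq> r" and n: "n < p * q * r"
  defines "cnt \<equiv> moduli.N (int p) (int q) (int r)"
  shows "coeff (cyclotomic_poly (p * q * r)) n = of_int (\<Sum>k<p. cnt (int n - int k) - cnt (int n - int k - int q)
    - cnt (int n - int k - int r) + cnt (int n - int k - int q - int r))"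
proof -
  have pos: "p > 0" "q > 0" "r > 0" using primes by (auto simp: prime_gt_0_nat)
  interpret moduli "int p" "int q" "int r" by unfold_locales (use pos in auto)
  define M :: "int \<Rightarrow> complex" where "M = (\<lambda>m. - of_int (\<Sum>k<p. N (m - int k)))"
  let ?S = "\<Sum>k<p. monom (1::complex) k"
  have M_neg: "M m = 0" if "m < 0" for m using that N_neg unfolding M_def by simp
  let ?pq = "int (p * q)" and ?pr = "int (p * r)" and ?qr = "int (q * r)" and ?pqr = "int (p * q * r)"
  have S: "back_diff ?pq (back_diff ?pr (back_diff ?qr M)) = coeff_int ?S"
  proof
    fix m
    have "back_diff ?pq (back_diff ?pr (back_diff ?qr M)) m =
      - of_int (\<Sum>k<p. back_diff ?pq (back_diff ?pr (back_diff ?qr N)) (m - int k))"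
      unfolding M_def back_diff_def by (simp add: sum_subtractf sum.distrib algebra_simps)
    also have "\<dots> = - of_int (\<Sum>k<p. if m = int k then -1 else 0)"
      using back_diff_N by simp
    also have "\<dots> = (\<Sum>k<p. if m = int k then 1 else 0)"
      unfolding of_int_sum sum_negf[symmetric] by (intro sum.cong) auto
    also have "\<dots> = coeff_int ?S m" by (cases m rule: int_cases3) (auto simp: coeff_int_def coeff_sum)
    finally show "back_diff ?pq (back_diff ?pr (back_diff ?qr M)) m = coeff_int ?S m" .
  qed
  let ?\<Phi> = "cyclotomic_poly (p * q * r)"
  have "back_diff ?pqr (back_diff q (back_diff r (coeff_int ?S)))
      = back_diff ?pq (back_diff ?pr (back_diff ?qr (coeff_int ?\<Phi>)))"
    using arg_cong[OF cyclotomic_three_primes[OF primes], of coeff_int]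
    unfolding coeff_int_mult_unity[symmetric] by (simp only: mult_ac)
  hence "back_diff ?pq (back_diff ?pr (back_diff ?qr (coeff_int ?\<Phi>)))
    = back_diff ?pq (back_diff ?pr (back_diff ?qr (back_diff ?pqr (back_diff q (back_diff r M)))))"
    unfolding S[symmetric] by (simp only: back_diff_commute)
  hence "coeff_int ?\<Phi> = back_diff ?pqr (back_diff q (back_diff r M))"
    using pos M_neg by (auto dest!: back_diff_inject[rotated -1] simp: back_diff_neg coeff_int_def)
  hence "coeff_int ?\<Phi> n = back_diff ?pqr (back_diff q (back_diff r M)) n" by simp
  also have "\<dots> = - back_diff q (back_diff r M) n"
    using n M_neg by (simp add: back_diff_def[of ?pqr] back_diff_neg del: of_nat_mult)
  finally show ?thesis
    unfolding coeff_int_def back_diff_def M_def cnt_def by (simp add: sum_subtractf sum.distrib algebra_simps)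
qed

section \<open>Relations and disjoint translates\<close>

text \<open>
  Any two points of equal value differ by such a relation.  Short ranges for some of the coordinates
  determine \<open>X\<close>, \<open>Y\<close>, \<open>Z\<close>; nearly every comparison of points below rests on this.
\<close>

lemma relation_lattice:
  fixes p q r x y z :: int
  assumes cop: "coprime p q" "coprime p r" "coprime q r" and pos: "p > 0" "q > 0" "r > 0"
    and eq: "x * (q * r) + y * (p * r) + z * (p * q) = 0"
  obtains X Y Z where "x = p * X" "y = q * Y" "z = r * Z" "X + Y + Z = 0"
proof -
  have "p dvd x * (q * r)"
  proof -
    have "x * (q * r) = p * (- y * r - z * q)" using eq by (simp add: algebra_simps)
    thus ?thesis by simp
  qed
  hence "p dvd x" using cop by (simp add: coprime_dvd_mult_left_iff coprime_mult_right_iff)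
  moreover have "q dvd y * (p * r)"
  proof -
    have "y * (p * r) = q * (- x * r - z * p)" using eq by (simp add: algebra_simps)
    thus ?thesis by simp
  qed
  hence "q dvd y" using cop by (simp add: coprime_dvd_mult_left_iff coprime_mult_right_iff coprime_commute)
  moreover have "r dvd z * (p * q)"
  proof -
    have "z * (p * q) = r * (- x * q - y * p)" using eq by (simp add: algebra_simps)
    thus ?thesis by simp
  qed
  hence "r dvd z" using cop by (simp add: coprime_dvd_mult_left_iff coprime_mult_right_iff coprime_commute)
  ultimately obtain X Y Z where XYZ: "x = p * X" "y = q * Y" "z = r * Z" by (auto elim!: dvdE)
  have "(p * q * r) * (X + Y + Z) = 0" using eq unfolding XYZ by (simp add: algebra_simps)
  hence "X + Y + Z = 0" using pos by auto
  thus ?thesis using that XYZ by blast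
qed

lemma card_int_subset_atLeastLessThan:
  fixes S :: "int set" assumes "S \<subseteq> {l..<u}" "l \<le> u" shows "int (card S) \<le> u - l"
  using card_mono[of "{l..<u}" S] assms by simp

text \<open>
  Distinct integers spread over at least their number minus one, and \<open>g\<close> magnifies the spread by \<open>W\<close>.
\<close>

lemma card_affine_le:
  fixes f g :: "int \<Rightarrow> int" and W :: int
  assumes "finite S" "S \<noteq> {}" "inj_on f S" "W \<ge> 0"
    and "\<And>k l. k \<in> S \<Longrightarrow> l \<in> S \<Longrightarrow> g k - g l = W * (f l - f k)"
    and "\<And>k. k \<in> S \<Longrightarrow> lo \<le> g k \<and> g k \<le> hi"
  shows "W * (int (card S) - 1) \<le> hi - lo"
proof -
  let ?F = "f ` S"
  have fin: "finite ?F" "?F \<noteq> {}" using assms by auto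
  obtain k where k: "k \<in> S" "f k = Min ?F" using Min_in[OF fin] by auto
  obtain l where l: "l \<in> S" "f l = Max ?F" using Max_in[OF fin] by auto
  have "?F \<subseteq> {f k..<f l + 1}" using k l fin by auto
  moreover have "f k \<le> f l" using k l fin by simp
  ultimately have "int (card ?F) \<le> f l + 1 - f k" using card_int_subset_atLeastLessThan by force
  hence "int (card S) - 1 \<le> f l - f k" using assms(3) by (simp add: card_image)
  hence "W * (int (card S) - 1) \<le> W * (f l - f k)" using assms(4) mult_left_mono by blast
  also have "\<dots> = g k - g l" using assms(5) k l by metis
  also have "\<dots> \<le> hi - lo" using assms(6) k l by (smt (verit))
  finally show ?thesis .
qed

text \<open>
  The sets \<open>TA\<close> and \<open>KA\<close> are the values of \<open>A\<close> on the two types of points, and \<open>XA\<close> collects exceptional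
  values.  If \<open>KA\<close> stays below \<open>p\<close>, then \<open>KA\<close> and the translate of \<open>TA\<close> are disjoint subsets of an
  interval, whose possible lengths give the alternatives.  If \<open>KA\<close> passes \<open>p\<close>, the values
  between \<open>\<alpha> + \<beta>\<close> and \<open>p\<close> are counted in this way, and the others are counted near \<open>0\<close> after reducing the
  large elements of \<open>KA\<close> by \<open>p\<close>.
\<close>

lemma disjoint_translate_bound:
  fixes TA KA XA :: "int set" and p \<alpha> \<beta> E :: int
  assumes fin: "finite KA" and odd: "odd p" and ab: "1 \<le> \<alpha>" "\<alpha> \<le> \<beta>" "3 * \<beta> < p"
    and TA: "TA \<subseteq> {0..<\<alpha>}" and KA: "\<And>y. y \<in> KA \<Longrightarrow> \<alpha> + \<beta> \<le> y \<and> 2 * y < p - 1 + 2 * \<alpha> + 2 * \<beta>"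
    and diam: "\<And>x y. x \<in> KA \<Longrightarrow> y \<in> KA \<Longrightarrow> y - x < \<alpha> + \<beta>"
    and disj: "\<And>y. y \<in> KA \<Longrightarrow> y - p \<notin> TA"
    and XA: "XA \<subseteq> TA" and E: "0 < E" "E < p"
    and avoid: "\<And>x. x \<in> TA - XA \<Longrightarrow> x + E \<notin> KA"
  defines "n \<equiv> int (card TA) + int (card KA)" and "X \<equiv> int (card XA)"
  shows "2 * n \<le> p - 1 + 2 * X \<or> n \<le> p - E + X \<or> n \<le> E - \<beta> + X \<or> 2 * n \<le> p - 1 + 2 * (\<alpha> + E - p) + 2 * X"
proof -
  obtain h where h: "p = 2 * h + 1" using odd by (auto elim: oddE)
  have finT: "finite TA" using TA finite_subset by blast
  let ?T = "TA - XA"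
  have cT: "int (card TA) = int (card ?T) + X"
    using finT XA unfolding X_def by (metis card_Diff_subset finite_subset card_mono of_nat_diff of_nat_add le_add_diff_inverse2)
  show ?thesis
  proof (cases "KA = {}")
    case True
    have "int (card TA) \<le> \<alpha>" using card_int_subset_atLeastLessThan[OF TA] ab by simp
    thus ?thesis using True ab h unfolding n_def X_def by auto
  next
    case ne: False
    show ?thesis
    proof (cases "\<exists>y\<in>KA. y \<ge> p")
      case False
      define lo hi where "lo = Min KA" and "hi = Max KA + 1"
      have lohi: "\<alpha> + \<beta> \<le> lo" "hi \<le> p" "hi - lo \<le> \<alpha> + \<beta>" "lo < hi"
        using KA[OF Min_in[OF fin ne]] False Max_in[OF fin ne] diam[OF Min_in[OF fin ne] Max_in[OF fin ne]]
           Min_le[OF fin Max_in[OF fin ne]]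
        unfolding lo_def hi_def by force+
      let ?U = "(\<lambda>x. x + E) ` ?T \<union> KA"
      have "?U \<subseteq> {min lo E..<max hi (E + \<alpha>)}"
        using TA Min_le[OF fin] Max_ge[OF fin] unfolding lo_def hi_def by fastforce
      hence "int (card ?U) \<le> max hi (E + \<alpha>) - min lo E"
        using lohi ab by (intro card_int_subset_atLeastLessThan) auto
      moreover have "card ?U = card ((\<lambda>x. x + E) ` ?T) + card KA"
        using avoid fin finT by (intro card_Un_disjoint) auto
      moreover have "card ((\<lambda>x. x + E) ` ?T) = card ?T" by (intro card_image) (auto simp: inj_on_def)
      ultimately have "n - X \<le> max hi (E + \<alpha>) - min lo E" using cT unfolding n_def by linarith
      hence "n - X \<le> hi - lo \<or> n - X \<le> hi - E \<or> n - X \<le> E + \<alpha> - lo \<or> n - X \<le> \<alpha>" by linarith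
      moreover have "hi - lo \<le> h" using lohi(1,2,3) h by linarith
      ultimately show ?thesis using lohi ab h by linarith
    next
      case True
      then obtain y0 where y0: "y0 \<in> KA" "y0 \<ge> p" by blast
      let ?TJ = "{x\<in>?T. \<alpha> + \<beta> \<le> x + E \<and> x + E < p}" and ?KJ = "{y\<in>KA. y < p}"
      let ?TR = "{x\<in>?T. \<not> (\<alpha> + \<beta> \<le> x + E \<and> x + E < p)}" and ?KR = "{y\<in>KA. \<not> y < p}"
      have c1: "int (card ?TJ) + int (card ?KJ) \<le> p - \<alpha> - \<beta>"
      proof -
        have "(\<lambda>x. x + E) ` ?TJ \<union> ?KJ \<subseteq> {\<alpha> + \<beta>..<p}" using KA by auto
        hence "int (card ((\<lambda>x. x + E) ` ?TJ \<union> ?KJ)) \<le> p - (\<alpha> + \<beta>)"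
          using ab by (intro card_int_subset_atLeastLessThan) auto
        moreover have "card ((\<lambda>x. x + E) ` ?TJ \<union> ?KJ) = card ((\<lambda>x. x + E) ` ?TJ) + card ?KJ"
          using avoid fin finT by (intro card_Un_disjoint) auto
        moreover have "card ((\<lambda>x. x + E) ` ?TJ) = card ?TJ" by (intro card_image) (auto simp: inj_on_def)
        ultimately show ?thesis by linarith
      qed
      have c2: "int (card ?TR) + int (card ?KR) \<le> max (\<alpha> + \<beta> - E) (\<alpha> + \<beta> - h - 1) + max 0 (\<alpha> - p + E)"
      proof -
        have "2 * y0 < p - 1 + 2 * \<alpha> + 2 * \<beta>" using KA y0 by blast
        hence nn: "0 \<le> \<alpha> + \<beta> - h - 1" using y0 h by linarith
        let ?m = "max (\<alpha> + \<beta> - E) (\<alpha> + \<beta> - h - 1)"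
        have "?TR \<union> (\<lambda>y. y - p) ` ?KR \<subseteq> {0..<?m} \<union> {p - E..<max \<alpha> (p - E)}"
        proof
          fix z assume "z \<in> ?TR \<union> (\<lambda>y. y - p) ` ?KR"
          thus "z \<in> {0..<?m} \<union> {p - E..<max \<alpha> (p - E)}"
          proof
            assume "z \<in> ?TR" thus ?thesis using TA by auto
          next
            assume "z \<in> (\<lambda>y. y - p) ` ?KR"
            then obtain y where "y \<in> KA" "y \<ge> p" "z = y - p" by auto
            thus ?thesis using KA[of y] h by auto
          qed
        qed
        hence "card (?TR \<union> (\<lambda>y. y - p) ` ?KR) \<le> card ({0..<?m} \<union> {p - E..<max \<alpha> (p - E)})"
          by (intro card_mono) auto
        also have "\<dots> \<le> card {0..<?m} + card {p - E..<max \<alpha> (p - E)}" by (rule card_Un_le)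
        finally have "int (card (?TR \<union> (\<lambda>y. y - p) ` ?KR)) \<le> ?m + max 0 (\<alpha> - p + E)"
          using nn by auto
        moreover have "card (?TR \<union> (\<lambda>y. y - p) ` ?KR) = card ?TR + card ((\<lambda>y. y - p) ` ?KR)"
          using disj fin finT by (intro card_Un_disjoint) auto
        moreover have "card ((\<lambda>y. y - p) ` ?KR) = card ?KR" by (intro card_image) (auto simp: inj_on_def)
        ultimately show ?thesis by linarith
      qed
      have "card ?T = card ?TJ + card ?TR"
        using card_Un_disjoint[of ?TJ ?TR] finT by (simp add: disjoint_iff) (smt (verit) Collect_cong Un_def mem_Collect_eq Diff_iff set_diff_eq)
      moreover have "card KA = card ?KJ + card ?KR"
      proof -
        have "KA = ?KJ \<union> ?KR" by blast
        thus ?thesis using card_Un_disjoint[of ?KJ ?KR] fin by auto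
      qed
      ultimately have "n - X \<le> p - \<alpha> - \<beta> + max (\<alpha> + \<beta> - E) (\<alpha> + \<beta> - h - 1) + max 0 (\<alpha> - p + E)"
        using c1 c2 cT unfolding n_def by linarith
      hence nX: "n - X \<le> max (p - E) (p - h - 1) + max 0 (\<alpha> - p + E)" by linarith
      show ?thesis
      proof (cases "\<alpha> - p + E > 0")
        case True
        hence "p - E < h" using ab h by linarith
        hence "n - X \<le> h + (\<alpha> - p + E)" using nX True h by simp
        hence "2 * n \<le> p - 1 + 2 * (\<alpha> + E - p) + 2 * X" using h by simp
        thus ?thesis by blast
      next
        case False
        hence "n - X \<le> p - E \<or> n - X \<le> h" using nX h by auto
        hence "n \<le> p - E + X \<or> 2 * n \<le> p - 1 + 2 * X" using h by auto
        thus ?thesis by blast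
      qed
    qed
  qed
qed

section \<open>Arrangements of points in a window\<close>

text \<open>
  A window of \<open>p\<close> consecutive values, numbered by positions \<open>0 \<le> k < p\<close>; the value at position \<open>k\<close> is
  \<open>c - s k\<close>.  The sets \<open>T\<close> and \<open>K\<close> hold the positions whose value is attained by a point of the
  respective type, and \<open>(A k, B k, C k)\<close> is that point.  The sign \<open>s\<close> makes the notion invariant under
  reading the window backwards, which is used for reductions by symmetry.
\<close>

locale arrangement =
  fixes p q r \<alpha> \<beta> a\<^sub>1 b\<^sub>1 s c :: int and T K :: "int set" and A B C :: "int \<Rightarrow> int"
  assumes odd_p: "odd p" and q_gt: "q > 4" and r_gt: "r > 4"
    and cop: "coprime p q" "coprime p r" "coprime q r"
    and sign: "s = 1 \<or> s = -1"
    and \<alpha>\<beta>_base: "1 \<le> \<alpha>" "\<alpha> \<le> \<beta>" "2 * \<beta> < p"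
    and a1: "p * a\<^sub>1 \<le> \<alpha> * q + 1" and b1: "p * b\<^sub>1 \<le> \<beta> * r + 1"
    and inv: "[\<alpha> * \<beta> * q * r = 1] (mod p) \<or> [\<alpha> * \<beta> * q * r = -1] (mod p)"
    and T_sub: "T \<subseteq> {0..<p}" and K_sub: "K \<subseteq> {0..<p}"
    and rel: "\<And>k. k \<in> T \<union> K \<Longrightarrow> A k * (q * r) + B k * (p * r) + C k * (p * q) = c - s * k"
    and T_A: "\<And>k. k \<in> T \<Longrightarrow> 0 \<le> A k" "\<And>k. k \<in> T \<Longrightarrow> A k < \<alpha>"
    and T_B: "\<And>k. k \<in> T \<Longrightarrow> 0 \<le> B k" "\<And>k. k \<in> T \<Longrightarrow> 2 * B k < q"
    and T_C: "\<And>k. k \<in> T \<Longrightarrow> 0 \<le> C k" "\<And>k. k \<in> T \<Longrightarrow> 2 * C k < r"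
    and K_A: "\<And>k. k \<in> K \<Longrightarrow> \<alpha> + \<beta> \<le> A k" "\<And>k. k \<in> K \<Longrightarrow> 2 * A k < p - 1 + 2 * \<alpha> + 2 * \<beta>"
    and K_B: "\<And>k. k \<in> K \<Longrightarrow> - a\<^sub>1 \<le> B k" "\<And>k. k \<in> K \<Longrightarrow> B k < 0"
    and K_C: "\<And>k. k \<in> K \<Longrightarrow> - b\<^sub>1 \<le> C k" "\<And>k. k \<in> K \<Longrightarrow> C k < 0"
begin

lemma finT: "finite T" and finK: "finite K"
  using T_sub K_sub finite_subset by blast+

lemma T_range: "k \<in> T \<Longrightarrow> 0 \<le> k \<and> k < p" using T_sub by auto
lemma K_range: "k \<in> K \<Longrightarrow> 0 \<le> k \<and> k < p" using K_sub by auto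

lemma disjoint: "T \<inter> K = {}"
  using T_B(1) K_B(2) by (force simp: disjoint_iff)

lemma p_ge_3: "p \<ge> 3" using \<alpha>\<beta>_base by linarith

lemma pqr_pos: "p > 0" "q > 0" "r > 0" using p_ge_3 q_gt r_gt by auto

lemma lattice:
  assumes "x * (q * r) + y * (p * r) + z * (p * q) = 0"
  obtains X Y Z where "x = p * X" "y = q * Y" "z = r * Z" "X + Y + Z = 0"
  using relation_lattice[OF cop pqr_pos assms] by blast

lemma rel_diff:
  assumes "k \<in> T \<union> K" "l \<in> T \<union> K"
  shows "(A l - A k) * (q * r) + (B l - B k) * (p * r) + (C l - C k) * (p * q) = s * (k - l)"
  using rel[OF assms(1)] rel[OF assms(2)] by (simp add: algebra_simps)

text \<open>
  The vectors from \<open>k\<close> to \<open>l\<close> and from \<open>k'\<close> to \<open>l'\<close>, with multiplicities that make their lengths in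
  positions equal, have the same value and hence differ by a relation.
\<close>

lemma parallel:
  assumes "k \<in> T \<union> K" "l \<in> T \<union> K" "k' \<in> T \<union> K" "l' \<in> T \<union> K" and "m * (l - k) = m' * (l' - k')"
  obtains X Y Z where "m * (A l - A k) - m' * (A l' - A k') = p * X"
    "m * (B l - B k) - m' * (B l' - B k') = q * Y"
    "m * (C l - C k) - m' * (C l' - C k') = r * Z" "X + Y + Z = 0"
proof (rule lattice)
  have "(m * (A l - A k) - m' * (A l' - A k')) * (q * r) + (m * (B l - B k) - m' * (B l' - B k')) * (p * r)
      + (m * (C l - C k) - m' * (C l' - C k')) * (p * q) = m * (s * (k - l)) - m' * (s * (k' - l'))"
    unfolding rel_diff[OF assms(1,2), symmetric] rel_diff[OF assms(3,4), symmetric] by (simp add: algebra_simps)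
  also have "\<dots> = - s * (m * (l - k) - m' * (l' - k'))" by (simp add: algebra_simps)
  also have "\<dots> = 0" using assms(5) by simp
  finally show "(m * (A l - A k) - m' * (A l' - A k')) * (q * r) + (m * (B l - B k) - m' * (B l' - B k')) * (p * r)
      + (m * (C l - C k) - m' * (C l' - C k')) * (p * q) = 0" .
qed (use that in blast)

text \<open>
  On \<open>K\<close> the coordinates \<open>B\<close> and \<open>C\<close> vary by less than \<open>a\<^sub>1\<close> and \<open>b\<^sub>1\<close>, and the values by less than \<open>p\<close>;
  as \<open>a\<^sub>1 p r + b\<^sub>1 p q\<close> is about \<open>(\<alpha> + \<beta>) q r\<close>, this limits the variation of \<open>A\<close>.
\<close>

lemma K_diff:
  assumes "k \<in> K" "l \<in> K"
  shows "B l - B k < a\<^sub>1" "C l - C k < b\<^sub>1" "A l - A k < \<alpha> + \<beta>"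
proof -
  show B: "B l - B k < a\<^sub>1" and C: "C l - C k < b\<^sub>1"
    using K_B(1)[OF assms(1)] K_B(2)[OF assms(2)] K_C(1)[OF assms(1)] K_C(2)[OF assms(2)] by linarith+
  have B': "B k - B l \<le> a\<^sub>1 - 1" and C': "C k - C l \<le> b\<^sub>1 - 1"
    using K_B(1)[OF assms(2)] K_B(2)[OF assms(1)] K_C(1)[OF assms(2)] K_C(2)[OF assms(1)] by linarith+
  have "p * (B k - B l) \<le> p * (a\<^sub>1 - 1)" using B' pqr_pos by (intro mult_left_mono) auto
  hence "p * (B k - B l) \<le> \<alpha> * q + 1 - p" using a1 by (simp add: algebra_simps)
  hence 1: "p * (B k - B l) * r \<le> (\<alpha> * q + 1 - p) * r" using pqr_pos by (intro mult_right_mono) auto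
  have "p * (C k - C l) \<le> p * (b\<^sub>1 - 1)" using C' pqr_pos by (intro mult_left_mono) auto
  hence "p * (C k - C l) \<le> \<beta> * r + 1 - p" using b1 by (simp add: algebra_simps)
  hence 2: "p * (C k - C l) * q \<le> (\<beta> * r + 1 - p) * q" using pqr_pos by (intro mult_right_mono) auto
  have 3: "s * (k - l) \<le> p - 1" using sign K_range[OF assms(1)] K_range[OF assms(2)] by auto
  have "(A l - A k) * (q * r) = s * (k - l) + p * (B k - B l) * r + p * (C k - C l) * q"
    using rel_diff[of k l] assms by (simp add: algebra_simps)
  also have "\<dots> \<le> (p - 1) + (\<alpha> * q + 1 - p) * r + (\<beta> * r + 1 - p) * q" using 1 2 3 by linarith
  also have "\<dots> = (\<alpha> + \<beta>) * (q * r) - (p - 1) * (q + r - 1)" by (simp add: algebra_simps)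
  also have "\<dots> < (\<alpha> + \<beta>) * (q * r)" using p_ge_3 q_gt r_gt by simp
  finally show "A l - A k < \<alpha> + \<beta>" using pqr_pos by simp
qed

text \<open>
  Reducing \<open>A q r + B p r + C p q = c - s k\<close> modulo \<open>p\<close> shows that \<open>A\<close> drops by \<open>W\<close> modulo \<open>p\<close> from one
  position to the next.
\<close>

definition step :: "int \<Rightarrow> bool" where "step W \<longleftrightarrow> [W * q * r = s] (mod p)"

lemma p_prod_cop: "coprime p (q * r)" using cop by simp

lemma dvd_cancel: "p dvd x * (q * r) \<longleftrightarrow> p dvd x"
  using p_prod_cop by (simp add: coprime_dvd_mult_left_iff)

lemma step_exists: "\<exists>W. step W \<and> 0 < W \<and> W < p"
proof -
  obtain x where x: "[q * r * x = 1] (mod p)" using p_prod_cop cong_solve_coprime_int[of "q * r" p]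
    by (auto simp: coprime_commute)
  let ?W = "(s * x) mod p"
  have "[?W * q * r = s * x * q * r] (mod p)" by (intro cong_mult cong_refl) simp
  also have "s * x * q * r = s * (q * r * x)" by simp
  also have "[\<dots> = s * 1] (mod p)" using x by (intro cong_mult cong_refl)
  finally have st: "step ?W" by (simp add: step_def)
  have "?W \<noteq> 0"
  proof
    assume "?W = 0"
    hence "[0 = s] (mod p)" using st unfolding step_def by simp
    hence "[s = 0] (mod p)" by (rule cong_sym)
    hence "p dvd s" by (simp only: cong_0_iff)
    thus False using sign p_ge_3 zdvd_imp_le[of p 1] by auto
  qed
  moreover have "0 \<le> ?W" "?W < p" using p_ge_3 by auto
  ultimately show ?thesis using st by force
qed

lemma step_cong: "step W \<Longrightarrow> p dvd W - W' \<Longrightarrow> step W'"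
proof -
  assume a: "step W" "p dvd W - W'"
  have "[W = W'] (mod p)" using a(2) by (simp add: cong_iff_dvd_diff)
  hence "[W' * q * r = W * q * r] (mod p)" by (intro cong_mult cong_refl) (simp add: cong_sym)
  thus "step W'" using a(1) unfolding step_def by (metis cong_trans)
qed

lemma step_not_0: "step W \<Longrightarrow> \<not> p dvd W"
proof
  assume W: "step W" "p dvd W"
  hence "[W * q * r = 0] (mod p)" by (simp add: cong_0_iff)
  hence "[0 = s] (mod p)" using W(1) unfolding step_def by (metis cong_sym cong_trans)
  hence "[s = 0] (mod p)" by (rule cong_sym)
    hence "p dvd s" by (simp only: cong_0_iff)
  thus False using sign p_ge_3 zdvd_imp_le[of p 1] by auto
qed

lemma step_\<alpha>\<beta>: "step W \<Longrightarrow> p dvd W - \<alpha> * \<beta> \<or> p dvd W + \<alpha> * \<beta>"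
proof -
  assume W: "step W"
  have "p dvd \<alpha> * \<beta> * q * r - 1 \<or> p dvd \<alpha> * \<beta> * q * r + 1"
    using inv by (auto simp: cong_iff_dvd_diff)
  moreover have "p dvd W * q * r - s" using W by (simp add: step_def cong_iff_dvd_diff)
  moreover note dvd_diff[OF this, of "\<alpha> * \<beta> * q * r - 1"] dvd_diff[OF this, of "\<alpha> * \<beta> * q * r + 1"]
    dvd_add[OF this, of "\<alpha> * \<beta> * q * r - 1"] dvd_add[OF this, of "\<alpha> * \<beta> * q * r + 1"]
  ultimately have "p dvd W * q * r - \<alpha> * \<beta> * q * r \<or> p dvd W * q * r + \<alpha> * \<beta> * q * r"
    using sign by (elim disjE) simp_all
  hence "p dvd (W - \<alpha> * \<beta>) * (q * r) \<or> p dvd (W + \<alpha> * \<beta>) * (q * r)" by (simp add: algebra_simps)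
  thus ?thesis by (simp only: dvd_cancel)
qed

lemma residue:
  assumes W: "step W" and "k \<in> T \<union> K" "l \<in> T \<union> K"
  shows "p dvd A l - A k + (l - k) * W"
proof -
  have "p dvd W * q * r - s" using W by (simp add: step_def cong_iff_dvd_diff)
  hence 1: "p dvd (l - k) * (W * q * r - s)" by simp
  have "(A l - A k + (l - k) * W) * (q * r) = (l - k) * (W * q * r - s)
     + p * (- (B l - B k) * r - (C l - C k) * q)"
    using rel_diff[OF assms(2,3)] by (simp add: algebra_simps)
  hence "p dvd (A l - A k + (l - k) * W) * (q * r)" using 1 by (simp del: mult_minus_left)
  thus ?thesis by (simp only: dvd_cancel)
qed

lemma position_of_residue:
  assumes W: "step W" and kl: "k \<in> T \<union> K" "l \<in> T \<union> K" and m: "0 \<le> m" "m < p"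
    and d: "p dvd A l - A k + (m - k) * W"
  shows "l = m"
proof -
  have "p dvd (A l - A k + (m - k) * W) - (A l - A k + (l - k) * W)"
    using d residue[OF W kl] by (rule dvd_diff)
  hence "p dvd W * (m - l)" by (simp add: algebra_simps)
  moreover have "coprime p W"
  proof -
    have "coprime p (W * q * r)"
    proof -
      have "coprime p s" using sign by auto
      thus ?thesis using W unfolding step_def by (metis cong_imp_coprime coprime_commute cong_sym)
    qed
    thus ?thesis by simp
  qed
  ultimately have "p dvd m - l" by (simp add: coprime_dvd_mult_right_iff)
  moreover have "\<bar>m - l\<bar> < p" using m kl T_range K_range by (smt (verit) UnE)
  ultimately show ?thesis using dvd_imp_le_int[of "m - l" p] by linarith
qed

lemma inj_residue: "k \<in> T \<union> K \<Longrightarrow> l \<in> T \<union> K \<Longrightarrow> p dvd A l - A k \<Longrightarrow> l = k"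
proof -
  assume a: "k \<in> T \<union> K" "l \<in> T \<union> K" "p dvd A l - A k"
  obtain W where "step W" using step_exists by blast
  thus "l = k" using position_of_residue[of W k l k] a T_range K_range by auto
qed

lemma inj_A: "inj_on A (T \<union> K)"
  using inj_residue by (auto simp: inj_on_def)

lemma card_image_A: "S \<subseteq> T \<union> K \<Longrightarrow> card (A ` S) = card S"
  by (intro card_image inj_on_subset[OF inj_A])

abbreviation num :: int where "num \<equiv> int (card T) + int (card K)"

end

text \<open>
  The range of parameters that crude counting does not cover.
\<close>

locale configuration = arrangement +
  assumes regime: "3 * \<beta> < p" "p < 4 * \<alpha> + \<beta>"
    and nondeg: "\<not> [q * r = 1] (mod p)" "\<not> [q * r = -1] (mod p)"
begin

lemmas \<alpha>\<beta> = \<alpha>\<beta>_base(1,2) regime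

lemma \<alpha>_ge: "\<alpha> \<ge> 2"
proof (rule ccontr)
  assume "\<not> \<alpha> \<ge> 2"
  hence "\<alpha> = 1" "\<beta> = 1" using \<alpha>\<beta> by linarith+
  hence "p = 4" using \<alpha>\<beta> by linarith
  thus False using odd_p by simp
qed

lemma p_ge: "p \<ge> 7"
  using \<alpha>\<beta> \<alpha>_ge by linarith

text \<open>
  Since \<open>a\<^sub>1\<close> is about \<open>\<alpha> q / p\<close> and \<open>b\<^sub>1\<close> about \<open>\<beta> r / p\<close>, small multiples of them stay below \<open>q\<close> and \<open>r\<close>.
\<close>

lemma a1_small: "0 \<le> m \<Longrightarrow> m * \<alpha> < p \<Longrightarrow> m < q \<Longrightarrow> m * a\<^sub>1 < q"
  and b1_small: "0 \<le> m \<Longrightarrow> m * \<beta> < p \<Longrightarrow> m < r \<Longrightarrow> m * b\<^sub>1 < r"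
proof -
  { fix m \<gamma> a u :: int assume h: "0 \<le> m" "m * \<gamma> < p" "m < u" "p * a \<le> \<gamma> * u + 1" "u > 0"
    have "p * (m * a) = m * (p * a)" by simp
    also have "\<dots> \<le> m * (\<gamma> * u + 1)" using h by (intro mult_left_mono) auto
    also have "\<dots> = (m * \<gamma>) * u + m" by (simp add: algebra_simps)
    also have "\<dots> < (m * \<gamma>) * u + u" using h by simp
    also have "\<dots> = (m * \<gamma> + 1) * u" by (simp add: algebra_simps)
    also have "\<dots> \<le> p * u" using h by (intro mult_right_mono) auto
    finally have "m * a < u" using pqr_pos by simp }
  note * = this
  show "0 \<le> m \<Longrightarrow> m * \<alpha> < p \<Longrightarrow> m < q \<Longrightarrow> m * a\<^sub>1 < q" using * a1 pqr_pos by blast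
  show "0 \<le> m \<Longrightarrow> m * \<beta> < p \<Longrightarrow> m < r \<Longrightarrow> m * b\<^sub>1 < r" using * b1 pqr_pos by blast
qed

lemma a1_3: "3 * a\<^sub>1 < q" and b1_3: "3 * b\<^sub>1 < r"
  using a1_small[of 3] b1_small[of 3] \<alpha>\<beta> q_gt r_gt by linarith+

lemma step_not_1: "step W \<Longrightarrow> \<not> p dvd W - 1" "step W \<Longrightarrow> \<not> p dvd W + 1"
proof -
  assume W: "step W"
  show "\<not> p dvd W - 1"
  proof
    assume "p dvd W - 1"
    hence "step 1" using step_cong[OF W] by simp
    thus False using nondeg sign unfolding step_def by auto
  qed
  show "\<not> p dvd W + 1"
  proof
    assume "p dvd W + 1"
    hence "step (-1)" using step_cong[OF W, of "-1"] by simp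
    hence "[- (- 1 * q * r) = - s] (mod p)" unfolding step_def by (simp only: cong_minus_minus_iff)
    hence "[q * r = - s] (mod p)" by simp
    thus False using nondeg sign by auto
  qed
qed

end

section \<open>Passages between the two types of points\<close>

context configuration begin

text \<open>
  Applied to the values of \<open>A\<close>, \<open>disjoint_translate_bound\<close> bounds the number of points when no passage
  from \<open>T - X\<close> to \<open>K\<close> raises \<open>A\<close> by exactly \<open>E\<close>.
\<close>

lemma translate_bound:
  assumes X: "X \<subseteq> T" and E: "0 < E" "E < p"
    and avoid: "\<And>k l. k \<in> T - X \<Longrightarrow> l \<in> K \<Longrightarrow> A l \<noteq> A k + E"
  shows "2 * num \<le> p - 1 + 2 * int (card X) \<or> num \<le> p - E + int (card X)
    \<or> num \<le> E - \<beta> + int (card X) \<or> 2 * num \<le> p - 1 + 2 * (\<alpha> + E - p) + 2 * int (card X)"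
proof -
  have "2 * (int (card (A ` T)) + int (card (A ` K))) \<le> p - 1 + 2 * int (card (A ` X))
    \<or> int (card (A ` T)) + int (card (A ` K)) \<le> p - E + int (card (A ` X))
    \<or> int (card (A ` T)) + int (card (A ` K)) \<le> E - \<beta> + int (card (A ` X))
    \<or> 2 * (int (card (A ` T)) + int (card (A ` K))) \<le> p - 1 + 2 * (\<alpha> + E - p) + 2 * int (card (A ` X))"
  proof (rule disjoint_translate_bound)
    show "A ` T \<subseteq> {0..<\<alpha>}" using T_A by auto
    show "y - x < \<alpha> + \<beta>" if "x \<in> A ` K" "y \<in> A ` K" for x y
      using that K_diff(3) by blast
    show "y - p \<notin> A ` T" if yK: "y \<in> A ` K" for y
    proof
      assume "y - p \<in> A ` T"
      then obtain k where "k \<in> T" "y - p = A k" by blast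
      moreover obtain l where "l \<in> K" "y = A l" using yK by blast
      ultimately have kl: "k \<in> T" "l \<in> K" "A l - p = A k" by auto
      hence "A l - A k = p" by simp
      hence "p dvd A l - A k" by simp
      hence "l = k" using inj_residue kl by blast
      thus False using kl disjoint by blast
    qed
    show "x + E \<notin> A ` K" if xT: "x \<in> A ` T - A ` X" for x
    proof
      assume "x + E \<in> A ` K"
      then obtain l where l: "l \<in> K" "x + E = A l" by blast
      obtain k where "k \<in> T - X" "x = A k" using xT by blast
      thus False using avoid[of k l] l by simp
    qed
    show "A ` X \<subseteq> A ` T" using X by blast
  qed (use finK odd_p \<alpha>\<beta> K_A E in auto)
  moreover have "card (A ` T) = card T" "card (A ` K) = card K" "card (A ` X) = card X"
    using card_image_A X by auto
  ultimately show ?thesis by metis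
qed

text \<open>
  Let \<open>D\<close> be \<open>\<sigma> W\<close> modulo \<open>p\<close>.  If \<open>A l = A k + p - D\<close>, the residues show that \<open>l\<close> lies \<open>\<sigma>\<close> positions
  after \<open>k\<close>.  When no such pair exists, \<open>translate_bound\<close> applies; the exceptional points are those in the
  last \<open>\<sigma>\<close> positions, from which one would leave the window.
\<close>

lemma forward_bound:
  assumes W: "step W" and D: "0 < D" "D < p" "p dvd D - \<sigma> * W" and \<sigma>: "0 \<le> \<sigma>"
    and none: "\<And>k l. k \<in> T \<Longrightarrow> l \<in> K \<Longrightarrow> l = k + \<sigma> \<Longrightarrow> A l = A k + p - D \<Longrightarrow> False"
    and X: "X = int (card {k\<in>T. p - \<sigma> \<le> k})"
  shows "2 * num \<le> p - 1 + 2 * X \<or> num \<le> D + X \<or> num \<le> p - D - \<beta> + X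
    \<or> 2 * num \<le> p - 1 + 2 * (\<alpha> - D) + 2 * X"
proof -
  have "A l \<noteq> A k + (p - D)" if k: "k \<in> T - {k\<in>T. p - \<sigma> \<le> k}" and l: "l \<in> K" for k l
  proof
    assume E: "A l = A k + (p - D)"
    have "p dvd p - (D - \<sigma> * W)" using D(3) by simp
    moreover have "A l - A k + (k + \<sigma> - k) * W = p - (D - \<sigma> * W)" using E by simp
    ultimately have "p dvd A l - A k + (k + \<sigma> - k) * W" by metis
    hence "l = k + \<sigma>" using position_of_residue[OF W, of k l "k + \<sigma>"] k l \<sigma> T_range by auto
    thus False using none[of k l] k l E by simp
  qed
  from translate_bound[of "{k\<in>T. p - \<sigma> \<le> k}" "p - D", OF _ _ _ this]
  show ?thesis using D unfolding X by (auto simp: algebra_simps)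
qed

text \<open>
  As before, but \<open>A l = A k + D\<close> means that \<open>l\<close> lies \<open>\<sigma>\<close> positions before \<open>k\<close>, and the exceptional points
  are in the first \<open>\<sigma>\<close> positions.
\<close>

lemma backward_bound:
  assumes W: "step W" and D: "0 < D" "D < p" "p dvd D - \<sigma> * W" and \<sigma>: "0 \<le> \<sigma>"
    and none: "\<And>k l. k \<in> T \<Longrightarrow> l \<in> K \<Longrightarrow> k = l + \<sigma> \<Longrightarrow> A l = A k + D \<Longrightarrow> False"
    and X: "X = int (card {k\<in>T. k < \<sigma>})"
  shows "2 * num \<le> p - 1 + 2 * X \<or> num \<le> p - D + X \<or> num \<le> D - \<beta> + X
    \<or> 2 * num \<le> p - 1 + 2 * (\<alpha> + D - p) + 2 * X"
proof -
  have "A l \<noteq> A k + D" if k: "k \<in> T - {k\<in>T. k < \<sigma>}" and l: "l \<in> K" for k l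
  proof
    assume E: "A l = A k + D"
    have "p dvd A l - A k + (k - \<sigma> - k) * W" using E D(3) by (simp add: algebra_simps)
    hence "l = k - \<sigma>" using position_of_residue[OF W, of k l "k - \<sigma>"] k l \<sigma> T_range[of k] by auto
    hence "k = l + \<sigma>" by simp
    thus False using none k l E by blast
  qed
  from translate_bound[of "{k\<in>T. k < \<sigma>}" D, OF _ _ _ this]
  show ?thesis using D unfolding X by auto
qed

text \<open>
  Subtracting the passage from \<open>K\<close> to \<open>T\<close> from the one from \<open>T\<close> to \<open>K\<close> leaves a relation whose second and
  third coordinates are negative, because \<open>B\<close> and \<open>C\<close> are nonnegative on \<open>T\<close> and negative on \<open>K\<close>; so
  \<open>X \<ge> 2\<close>.
\<close>

lemma opposite_passages:
  assumes "k \<in> T" "l \<in> K" "l = k + \<sigma>" and "k' \<in> T" "l' \<in> K" "k' = l' + \<sigma>"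
  shows "2 * p \<le> (A l - A k) + (A l' - A k')"
proof -
  obtain X Y Z where XYZ: "A l - A k - (A k' - A l') = p * X"
    "B l - B k - (B k' - B l') = q * Y" "C l - C k - (C k' - C l') = r * Z" "X + Y + Z = 0"
    by (rule parallel[of k l l' k' 1 1]) (use assms in auto)
  have "q * Y < 0" using XYZ(2) T_B(1)[OF assms(1)] T_B(1)[OF assms(4)] K_B(2)[OF assms(2)] K_B(2)[OF assms(5)] by linarith
  hence "Y \<le> -1" using pqr_pos by (simp add: mult_less_0_iff)
  moreover have "r * Z < 0" using XYZ(3) T_C(1)[OF assms(1)] T_C(1)[OF assms(4)] K_C(2)[OF assms(2)] K_C(2)[OF assms(5)] by linarith
  hence "Z \<le> -1" using pqr_pos by (simp add: mult_less_0_iff)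
  ultimately have "X \<ge> 2" using XYZ(4) by linarith
  hence "p * 2 \<le> p * X" using pqr_pos by simp
  thus ?thesis using XYZ(1) by linarith
qed

text \<open>
  On a block of positions too short for \<open>A\<close> to wrap around modulo \<open>p\<close>, the values of \<open>A\<close> on \<open>T\<close> are
  affine in the position with slope \<open>-W\<close>, and they lie in \<open>{0..<\<alpha>}\<close>.
\<close>

lemma T_block:
  assumes W: "step W" "W \<ge> 1" and S: "S \<subseteq> T" "\<And>k. k \<in> S \<Longrightarrow> u \<le> k \<and> k < u + \<sigma>" and \<sigma>: "(\<sigma> - 1) * W \<le> p - \<alpha>"
  shows "W * (int (card S) - 1) \<le> \<alpha> - 1"
proof (cases "S = {}")
  case True thus ?thesis using W \<alpha>\<beta> by simp
next
  case False
  have "W * (int (card S) - 1) \<le> (\<alpha> - 1) - 0"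
  proof (rule card_affine_le[of S id W A])
    fix k l assume kl: "k \<in> S" "l \<in> S"
    have d: "p dvd A l - A k + (l - k) * W" using residue[OF W(1)] kl S by blast
    have "\<bar>l - k\<bar> \<le> \<sigma> - 1" using S(2)[OF kl(1)] S(2)[OF kl(2)] by linarith
    hence "\<bar>l - k\<bar> * W \<le> (\<sigma> - 1) * W" using W by (intro mult_right_mono) auto
    hence "\<bar>l - k\<bar> * W \<le> p - \<alpha>" using \<sigma> by linarith
    moreover have "\<bar>(l - k) * W\<bar> = \<bar>l - k\<bar> * W" using W by (simp add: abs_mult)
    ultimately have "\<bar>(l - k) * W\<bar> \<le> p - \<alpha>" by linarith
    moreover have "\<bar>A l - A k\<bar> < \<alpha>" using T_A[of k] T_A[of l] kl S(1) by (auto simp: subset_iff)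
    ultimately have "\<bar>A l - A k + (l - k) * W\<bar> < p" by linarith
    hence "A l - A k + (l - k) * W = 0" using d dvd_imp_le_int[of "A l - A k + (l - k) * W" p] by linarith
    thus "A k - A l = W * (id l - id k)" by (simp add: algebra_simps)
  qed (use False W S finT finite_subset T_A in \<open>auto intro: finite_subset\<close>)
  thus ?thesis by simp
qed

text \<open>
  Positions at the end of the window are treated as negative positions, so that both blocks together
  form one block.  It is short enough for \<open>A\<close> to wrap around at most once, and the values before and
  after the wrap fill disjoint parts of \<open>{0..<\<alpha>}\<close>.
\<close>

lemma T_two_blocks:
  assumes W: "step W" "W \<ge> 1" and S1: "S1 \<subseteq> T" "\<And>k. k \<in> S1 \<Longrightarrow> k < \<sigma>"
    and S2: "S2 \<subseteq> T" "\<And>k. k \<in> S2 \<Longrightarrow> p - \<tau> \<le> k" and disj: "0 \<le> \<sigma>" "0 \<le> \<tau>" "\<sigma> \<le> p - \<tau>" and span: "(\<sigma> + \<tau> - 1) * W \<le> p - 1"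
  shows "W * (int (card S1) + int (card S2) - 2) \<le> \<alpha> - 2"
proof -
  let ?S = "S1 \<union> S2"
  define f where "f = (\<lambda>k. if k < \<sigma> then k else k - p)"
  have fin: "finite ?S" using S1 S2 finT finite_subset by blast
  have "S1 \<inter> S2 = {}"
  proof -
    have False if "k \<in> S1" "k \<in> S2" for k using S1(2)[OF that(1)] S2(2)[OF that(2)] disj by linarith
    thus ?thesis by blast
  qed
  hence card: "card ?S = card S1 + card S2"
    using fin by (simp add: card_Un_disjoint)
  have sub: "?S \<subseteq> T" using S1 S2 by blast
  have f_range: "- \<tau> \<le> f k \<and> f k < \<sigma>" if "k \<in> ?S" for k
    using that S1(1) S1(2)[of k] S2(1) S2(2)[of k] disj T_range[of k] unfolding f_def by (auto simp: subset_iff)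
  have f_inj: "inj_on f ?S"
  proof (rule inj_onI)
    fix k l assume "k \<in> ?S" "l \<in> ?S" "f k = f l"
    thus "k = l" using T_range[of k] T_range[of l] sub unfolding f_def by (auto simp: subset_iff split: if_splits)
  qed
  have d: "p dvd A l - A k + (f l - f k) * W" if "k \<in> ?S" "l \<in> ?S" for k l
  proof -
    have "p dvd A l - A k + (l - k) * W" using residue[OF W(1)] that sub by blast
    moreover have "p dvd (f l - l) * W - (f k - k) * W" unfolding f_def by auto
    ultimately have "p dvd (A l - A k + (l - k) * W) + ((f l - l) * W - (f k - k) * W)" by (rule dvd_add)
    thus ?thesis by (simp add: algebra_simps)
  qed
  show ?thesis
  proof (cases "?S = {}")
    case True thus ?thesis using W \<alpha>_ge by auto
  next
    case False
    have finF: "finite (f ` ?S)" "f ` ?S \<noteq> {}" using fin False by auto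
    obtain k0 where k0: "k0 \<in> ?S" "f k0 = Min (f ` ?S)" using Min_in[OF finF] by (metis imageE)
    have k0_min: "f k0 \<le> f k" if "k \<in> ?S" for k using that k0 finF by simp
    have A0: "0 \<le> A k0" "A k0 < \<alpha>" using T_A k0 sub by blast+
    \<comment> \<open>The points reached from the first one before and after \<open>A\<close> wraps around.\<close>
    define G0 where "G0 = {k\<in>?S. A k = A k0 - (f k - f k0) * W}"
    define G1 where "G1 = {k\<in>?S. A k = A k0 - (f k - f k0) * W + p}"
    have dist: "0 \<le> (f k - f k0) * W \<and> (f k - f k0) * W \<le> p - 1" if "k \<in> ?S" for k
    proof -
      have "(f k - f k0) * W \<le> (\<sigma> + \<tau> - 1) * W" using f_range[OF that] f_range[OF k0(1)] W by (intro mult_right_mono) auto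
      hence "(f k - f k0) * W \<le> p - 1" using span by (rule order_trans)
      moreover have "0 \<le> (f k - f k0) * W" using k0_min[OF that] W by simp
      ultimately show ?thesis by simp
    qed
    have split: "?S = G0 \<union> G1"
    proof -
      have "k \<in> G0 \<union> G1" if k: "k \<in> ?S" for k
      proof -
        obtain m where m: "A k - A k0 + (f k - f k0) * W = p * m" using d[OF k0(1) k] by (auto elim: dvdE)
        have "0 \<le> A k" "A k < \<alpha>" using T_A k sub by blast+
        hence "- p < p * m" "p * m < p * 2" using m dist[OF k] A0 \<alpha>\<beta> by linarith+
        hence "p * (-1) < p * m" "p * m < p * 2" by simp_all
        hence "-1 < m" "m < 2" using pqr_pos by (simp_all only: mult_less_cancel_left_pos)
        hence "m = 0 \<or> m = 1" by linarith
        thus ?thesis using m k unfolding G0_def G1_def by auto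
      qed
      thus ?thesis unfolding G0_def G1_def by blast
    qed
    have cardG: "card ?S = card G0 + card G1"
      unfolding split by (rule card_Un_disjoint) (use fin pqr_pos in \<open>auto simp: G0_def G1_def\<close>)
    have G0: "W * (int (card G0) - 1) \<le> A k0 - 0"
    proof (rule card_affine_le[of G0 f W A])
      show "G0 \<noteq> {}" using k0 unfolding G0_def by auto
      show "inj_on f G0" using f_inj unfolding G0_def by (rule inj_on_subset) auto
      show "A k - A l = W * (f l - f k)" if "k \<in> G0" "l \<in> G0" for k l
        using that unfolding G0_def by (simp add: algebra_simps)
      show "0 \<le> A k \<and> A k \<le> A k0" if k: "k \<in> G0" for k
      proof -
        have "k \<in> ?S" "A k = A k0 - (f k - f k0) * W" using k unfolding G0_def by blast+
        moreover from this have "0 \<le> A k" using T_A(1) sub by blast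
        ultimately show ?thesis using dist[of k] by linarith
      qed
      show "finite G0" using fin unfolding G0_def by simp
    qed (use W in auto)
    have G1: "W * (int (card G1) - 1) \<le> (\<alpha> - 1) - (A k0 + 1)" if ne: "G1 \<noteq> {}"
    proof (rule card_affine_le[of G1 f W A])
      show "inj_on f G1" using f_inj unfolding G1_def by (rule inj_on_subset) auto
      show "A k - A l = W * (f l - f k)" if "k \<in> G1" "l \<in> G1" for k l
        using that unfolding G1_def by (simp add: algebra_simps)
      show "A k0 + 1 \<le> A k \<and> A k \<le> \<alpha> - 1" if k: "k \<in> G1" for k
      proof -
        have "k \<in> ?S" "A k = A k0 - (f k - f k0) * W + p" using k unfolding G1_def by blast+
        moreover from this have "A k < \<alpha>" using T_A(2) sub by blast
        ultimately show ?thesis using dist[of k] by linarith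
      qed
      show "finite G1" using fin unfolding G1_def by simp
    qed (use W ne in auto)
    have "W * (int (card ?S) - 2) \<le> \<alpha> - 2"
    proof (cases "G1 = {}")
      case True
      hence "W * (int (card ?S) - 2) = W * (int (card G0) - 1) - W" using cardG by (simp add: algebra_simps)
      thus ?thesis using G0 W A0 by linarith
    next
      case False
      have "W * (int (card ?S) - 2) = W * (int (card G0) - 1) + W * (int (card G1) - 1)"
        using cardG by (simp add: algebra_simps)
      thus ?thesis using G0 G1[OF False] by linarith
    qed
    thus ?thesis using card by simp
  qed
qed

text \<open>
  Let \<open>D = \<sigma> W\<close> be the largest multiple of \<open>W\<close> up to \<open>p/2\<close>.  By \<open>forward_bound\<close> there is a passage from
  \<open>T\<close> to \<open>K\<close> over \<open>\<sigma>\<close> positions, so \<open>opposite_passages\<close> excludes the return over the same distance and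
  \<open>backward_bound\<close> gives \<open>P \<le> p - D\<close> up to points of \<open>T\<close> in the first \<open>\<sigma>\<close> positions.  With the directions
  exchanged, \<open>\<sigma> + 1\<close> positions give \<open>P \<le> D + W\<close> up to points in the last \<open>\<sigma> + 1\<close> positions.  Adding both,
  and limiting these points of \<open>T\<close> by \<open>T_two_blocks\<close>, yields \<open>W (\<beta> - 1 - W) \<le> \<beta> - 2\<close>.
\<close>

lemma slow_step:
  assumes big: "p + \<beta> + 1 \<le> 2 * num" and W: "step W" "2 \<le> W" "W \<le> \<beta>" "2 * W \<le> p + 1 - 2 * \<alpha>"
  shows "\<beta> - 2 \<le> W"
proof -
  obtain h where h: "p = 2 * h + 1" using odd_p by (auto elim: oddE)
  define \<sigma> where "\<sigma> = h div W"
  define D where "D = \<sigma> * W"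
  have "D = h - h mod W" by (simp add: D_def \<sigma>_def minus_mod_eq_div_mult)
  moreover have "0 \<le> h mod W" "h mod W < W" using W by simp_all
  ultimately have D: "D \<le> h" "h - W < D" by linarith+
  have D_pos: "\<alpha> \<le> D" using D W h by linarith
  have \<sigma>: "\<sigma> \<ge> 1"
  proof (rule ccontr)
    assume "\<not> \<sigma> \<ge> 1"
    hence "D \<le> 0" using W unfolding D_def by (intro mult_nonpos_nonneg) auto
    thus False using D_pos \<alpha>\<beta> by linarith
  qed
  have \<sigma>h: "2 * \<sigma> \<le> h"
  proof -
    have "\<sigma> * 2 \<le> \<sigma> * W" using \<sigma> W by (intro mult_left_mono) auto
    thus ?thesis using D unfolding D_def by linarith
  qed
  have few: "2 * int (card S) \<le> \<alpha> + 1" if "W * (int (card S) - 1) \<le> \<alpha> - 1" for S :: "int set"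
  proof (cases "card S = 0")
    case False
    hence "2 * (int (card S) - 1) \<le> W * (int (card S) - 1)" using W by (intro mult_right_mono) auto
    hence "2 * (int (card S) - 1) \<le> \<alpha> - 1" using that by (rule order_trans)
    thus ?thesis by simp
  qed (use \<alpha>\<beta> in auto)
  let ?L = "\<lambda>\<sigma>. {k\<in>T. p - \<sigma> \<le> k}" and ?F = "\<lambda>\<sigma>. {k\<in>T. k < \<sigma>}"
  have D': "(\<sigma> + 1) * W = D + W" unfolding D_def by (simp add: algebra_simps)
  have "\<exists>k l. k \<in> T \<and> l \<in> K \<and> l = k + \<sigma> \<and> A l = A k + p - D"
  proof (rule ccontr)
    assume "\<not> ?thesis"
    hence "2 * num \<le> p - 1 + 2 * int (card (?L \<sigma>)) \<or> num \<le> D + int (card (?L \<sigma>)) \<or> num \<le> p - D - \<beta> + int (card (?L \<sigma>))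
      \<or> 2 * num \<le> p - 1 + 2 * (\<alpha> - D) + 2 * int (card (?L \<sigma>))"
      using \<sigma> D D_pos \<alpha>\<beta> h by (intro forward_bound[OF W(1), where \<sigma> = \<sigma> and D = D]) (auto simp: D_def)
    moreover have "W * (int (card (?L \<sigma>)) - 1) \<le> \<alpha> - 1"
      by (rule T_block[OF W(1), of _ "p - \<sigma>" \<sigma>]) (use W T_range D D_pos h \<alpha>\<beta> in \<open>auto simp: D_def algebra_simps\<close>)
    hence "2 * int (card (?L \<sigma>)) \<le> \<alpha> + 1" by (rule few)
    ultimately show False using big D D_pos h W(2-) \<alpha>\<beta> by (smt (verit))
  qed
  then obtain k l where kl: "k \<in> T" "l \<in> K" "l = k + \<sigma>" "A l = A k + p - D" by blast
  have "2 * num \<le> p - 1 + 2 * int (card (?F \<sigma>)) \<or> num \<le> p - D + int (card (?F \<sigma>)) \<or> num \<le> D - \<beta> + int (card (?F \<sigma>))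
    \<or> 2 * num \<le> p - 1 + 2 * (\<alpha> + D - p) + 2 * int (card (?F \<sigma>))"
  proof (rule backward_bound[OF W(1), where \<sigma> = \<sigma> and D = D])
    fix k' l' assume "k' \<in> T" "l' \<in> K" "k' = l' + \<sigma>" "A l' = A k' + D"
    thus False using opposite_passages[of k l \<sigma> k' l'] kl pqr_pos by simp
  qed (use \<sigma> D D_pos \<alpha>\<beta> h in \<open>auto simp: D_def\<close>)
  hence 1: "num \<le> p - D + int (card (?F \<sigma>))" using D h \<alpha>\<beta> D_pos by (smt (verit))
  have "\<exists>k l. k \<in> T \<and> l \<in> K \<and> k = l + (\<sigma> + 1) \<and> A l = A k + (D + W)"
  proof (rule ccontr)
    assume "\<not> ?thesis"
    hence "2 * num \<le> p - 1 + 2 * int (card (?F (\<sigma> + 1))) \<or> num \<le> p - (D + W) + int (card (?F (\<sigma> + 1)))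
      \<or> num \<le> (D + W) - \<beta> + int (card (?F (\<sigma> + 1)))
      \<or> 2 * num \<le> p - 1 + 2 * (\<alpha> + (D + W) - p) + 2 * int (card (?F (\<sigma> + 1)))"
      using \<sigma> D D_pos \<alpha>\<beta> h W(2-) D'
      by (intro backward_bound[OF W(1), where \<sigma> = "\<sigma> + 1" and D = "D + W"]) auto
    moreover have "W * (int (card (?F (\<sigma> + 1))) - 1) \<le> \<alpha> - 1"
      by (rule T_block[OF W(1), of _ "0" "\<sigma> + 1"]) (use W T_range D D_pos h \<alpha>\<beta> in \<open>auto simp: D_def algebra_simps\<close>)
    hence "2 * int (card (?F (\<sigma> + 1))) \<le> \<alpha> + 1" by (rule few)
    ultimately show False using big D D_pos h W(2-) \<alpha>\<beta> by (smt (verit))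
  qed
  then obtain k' l' where kl': "k' \<in> T" "l' \<in> K" "k' = l' + (\<sigma> + 1)" "A l' = A k' + (D + W)" by blast
  have "2 * num \<le> p - 1 + 2 * int (card (?L (\<sigma> + 1))) \<or> num \<le> (D + W) + int (card (?L (\<sigma> + 1)))
    \<or> num \<le> p - (D + W) - \<beta> + int (card (?L (\<sigma> + 1)))
    \<or> 2 * num \<le> p - 1 + 2 * (\<alpha> - (D + W)) + 2 * int (card (?L (\<sigma> + 1)))"
  proof (rule forward_bound[OF W(1), where \<sigma> = "\<sigma> + 1" and D = "D + W"])
    fix k l assume "k \<in> T" "l \<in> K" "l = k + (\<sigma> + 1)" "A l = A k + p - (D + W)"
    thus False using opposite_passages[of k l "\<sigma> + 1" k' l'] kl' pqr_pos by simp
  qed (use \<sigma> D D_pos \<alpha>\<beta> h W(2-) D' in auto)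
  hence 2: "num \<le> D + W + int (card (?L (\<sigma> + 1)))" using D h \<alpha>\<beta> D_pos W(2-) by (smt (verit))
  have "W * (int (card (?F \<sigma>)) + int (card (?L (\<sigma> + 1))) - 2) \<le> \<alpha> - 2"
    by (rule T_two_blocks[OF W(1), of _ \<sigma> _ "\<sigma> + 1"]) (use W D h \<sigma>h \<sigma> in \<open>auto simp: D_def algebra_simps\<close>)
  moreover have "\<beta> - 1 - W \<le> int (card (?F \<sigma>)) + int (card (?L (\<sigma> + 1))) - 2"
    using 1 2 big by (smt (verit))
  hence "W * (\<beta> - 1 - W) \<le> W * (int (card (?F \<sigma>)) + int (card (?L (\<sigma> + 1))) - 2)"
    using W by (intro mult_left_mono) auto
  ultimately have ineq: "W * (\<beta> - 1 - W) \<le> \<beta> - 2" using \<alpha>\<beta> by linarith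
  show ?thesis
  proof (rule ccontr)
    assume "\<not> ?thesis"
    hence "2 \<le> \<beta> - 1 - W" by linarith
    hence "1 \<le> (W - 1) * (\<beta> - 2 - W)" using W by (simp add: int_one_le_iff_zero_less)
    thus False using ineq by (simp add: algebra_simps)
  qed
qed

end

section \<open>Adjacent points of type K\<close>

text \<open>
  The inequalities of \<open>opposite_neighbours_False\<close> leave finitely many parameters, of which the
  congruence \<open>W \<equiv> \<plusminus>\<alpha> \<beta>\<close> modulo \<open>p\<close> admits a single one.
\<close>

lemma exceptional_parameters:
  "\<forall>\<beta>\<in>set [3..7]. \<forall>\<alpha>\<in>set [1..\<beta>]. \<forall>p\<in>set [3 * \<beta> + 1..4 * \<alpha> + \<beta> - 1]. \<forall>W\<in>set [max 2 (\<beta> - 2)..\<beta> - 1].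
     odd p \<longrightarrow> 6 * W \<le> p - \<beta> + 3 \<longrightarrow> p dvd W - \<alpha> * \<beta> \<or> p dvd W + \<alpha> * \<beta> \<longrightarrow>
     p = (19::int) \<and> \<alpha> = 4 \<and> \<beta> = 4 \<and> W = 3"
  by code_simp

context configuration begin

lemma T_block_half: "step W \<Longrightarrow> 2 \<le> W \<Longrightarrow> S \<subseteq> T \<Longrightarrow> (\<And>k. k \<in> S \<Longrightarrow> u \<le> k \<and> k < u + \<sigma>)
    \<Longrightarrow> (\<sigma> - 1) * W \<le> p - \<alpha> \<Longrightarrow> 2 * int (card S) \<le> \<alpha> + 1"
proof (cases "card S = 0")
  case False
  assume a: "step W" "2 \<le> W" "S \<subseteq> T" "\<And>k. k \<in> S \<Longrightarrow> u \<le> k \<and> k < u + \<sigma>" "(\<sigma> - 1) * W \<le> p - \<alpha>"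
  have "W * (int (card S) - 1) \<le> \<alpha> - 1" by (rule T_block[OF a(1) _ a(3,4,5)]) (use a in auto)
  moreover have "2 * (int (card S) - 1) \<le> W * (int (card S) - 1)" using False a(2) by (intro mult_right_mono) auto
  ultimately show ?thesis by (smt (verit))
qed (use \<alpha>\<beta> in auto)

lemma card_last: "0 \<le> \<sigma> \<Longrightarrow> int (card {k\<in>T. p - \<sigma> \<le> k}) \<le> \<sigma>"
proof -
  assume "0 \<le> \<sigma>"
  hence "int (card {k\<in>T. p - \<sigma> \<le> k}) \<le> p - (p - \<sigma>)"
    using T_range by (intro card_int_subset_atLeastLessThan) auto
  thus ?thesis by simp
qed

lemma card_first: "0 \<le> \<sigma> \<Longrightarrow> int (card {k\<in>T. k < \<sigma>}) \<le> \<sigma>"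
proof -
  assume "0 \<le> \<sigma>"
  hence "int (card {k\<in>T. k < \<sigma>}) \<le> \<sigma> - 0"
    using T_range by (intro card_int_subset_atLeastLessThan) auto
  thus ?thesis by simp
qed

lemma step_of_neighbours:
  assumes "k \<in> K" "l \<in> K" "l = k + 1"
  shows "(A k - A l) * (q * r) = (B l - B k) * (p * r) + (C l - C k) * (p * q) + s" "step (A k - A l)"
proof -
  show eq: "(A k - A l) * (q * r) = (B l - B k) * (p * r) + (C l - C k) * (p * q) + s"
    using rel_diff[of k l] assms by (simp add: algebra_simps)
  have "(A k - A l) * q * r - s = p * ((B l - B k) * r + (C l - C k) * q)"
    using eq by (simp add: algebra_simps)
  hence "p dvd (A k - A l) * q * r - s" by simp
  thus "step (A k - A l)" by (simp add: step_def cong_iff_dvd_diff)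
qed

text \<open>
  Here \<open>W = A k - A l\<close> is itself a step.  A passage from \<open>T\<close> to \<open>K\<close> over \<open>\<sigma>\<close> positions that raises \<open>A\<close> by
  \<open>p - \<sigma> W\<close> would differ from \<open>\<sigma>\<close> times the vector from \<open>k\<close> to \<open>l\<close> by a relation with \<open>X = 1\<close> and
  \<open>Y, Z < 0\<close>, which is impossible.  So \<open>forward_bound\<close> is available for every \<open>\<sigma>\<close>; it is used with \<open>\<sigma> = 1\<close>
  if \<open>W > \<beta>\<close>, and otherwise with \<open>\<sigma> W\<close> just below \<open>p/2\<close>.
\<close>

lemma monotone_neighbours_False:
  assumes big: "p + \<beta> + 1 \<le> 2 * num" and kl: "k \<in> K" "l \<in> K" "l = k + 1"
    and up: "0 \<le> B l - B k" "0 \<le> C l - C k"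
  shows False
proof -
  define W where "W = A k - A l"
  have st: "step W" and eq: "W * (q * r) = (B l - B k) * (p * r) + (C l - C k) * (p * q) + s"
    using step_of_neighbours[OF kl] unfolding W_def by auto
  obtain h where h: "p = 2 * h + 1" using odd_p by (auto elim: oddE)
  have W0: "W \<noteq> 0" using step_not_0[OF st] by auto
  have "W \<ge> 0"
  proof (rule ccontr)
    assume "\<not> W \<ge> 0"
    hence "W * (q * r) \<le> (-1) * (q * r)" using pqr_pos by (intro mult_right_mono) auto
    moreover have "4 * 4 \<le> q * r" using q_gt r_gt by (intro mult_mono) auto
    moreover have "0 \<le> (B l - B k) * (p * r)" "0 \<le> (C l - C k) * (p * q)" using up pqr_pos by auto
    ultimately show False using eq sign by auto
  qed
  moreover have "W \<noteq> 1" using step_not_1(1)[OF st] by auto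
  ultimately have W2: "2 \<le> W" using W0 by linarith
  have W_less: "W < \<alpha> + \<beta>" using K_diff(3)[of l k] kl unfolding W_def by simp
  have none: False if tl: "k' \<in> T" "l' \<in> K" "l' = k' + \<sigma>" "A l' = A k' + p - \<sigma> * W" "0 \<le> \<sigma>" for k' l' \<sigma>
  proof -
    obtain X Y Z where XYZ: "1 * (A l' - A k') - \<sigma> * (A l - A k) = p * X"
      "1 * (B l' - B k') - \<sigma> * (B l - B k) = q * Y" "1 * (C l' - C k') - \<sigma> * (C l - C k) = r * Z" "X + Y + Z = 0"
      by (rule parallel[of k' l' k l 1 \<sigma>]) (use tl kl in auto)
    have "0 \<le> \<sigma> * (B l - B k)" "0 \<le> \<sigma> * (C l - C k)" using that(5) up by auto
    hence "q * Y < 0" "r * Z < 0"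
      using XYZ(2,3) T_B(1)[OF that(1)] T_C(1)[OF that(1)] K_B(2)[OF that(2)] K_C(2)[OF that(2)] by auto
    hence "Y < 0" "Z < 0" using pqr_pos by (simp_all add: mult_less_0_iff)
    moreover have "p * X = p" using XYZ(1) that(4) unfolding W_def by (simp add: algebra_simps)
    hence "X = 1" using pqr_pos by simp
    ultimately show False using XYZ(4) by linarith
  qed
  show False
  proof (cases "W \<le> \<beta>")
    case False
    define X where "X = int (card {k\<in>T. p - 1 \<le> k})"
    have "X \<le> 1" using card_last[of 1] unfolding X_def by simp
    moreover have "2 * num \<le> p - 1 + 2 * X \<or> num \<le> W + X \<or> num \<le> p - W - \<beta> + X
      \<or> 2 * num \<le> p - 1 + 2 * (\<alpha> - W) + 2 * X"
      using none[of _ _ 1] W2 W_less \<alpha>\<beta> by (intro forward_bound[OF st, where \<sigma> = 1 and D = W]) (auto simp: X_def)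
    ultimately show False using big W_less False \<alpha>\<beta> by (smt (verit))
  next
    case True
    define \<sigma> where "\<sigma> = h div W"
    define D where "D = \<sigma> * W"
    have "D = h - h mod W" by (simp add: D_def \<sigma>_def minus_mod_eq_div_mult)
    moreover have "0 \<le> h mod W" "h mod W < W" using W2 by simp_all
    ultimately have D: "D \<le> h" "h - W < D" by linarith+
    have D0: "0 < D" using D True h \<alpha>\<beta> by linarith
    have \<sigma>: "1 \<le> \<sigma>"
    proof (rule ccontr)
      assume "\<not> 1 \<le> \<sigma>"
      hence "D \<le> 0" using W2 unfolding D_def by (intro mult_nonpos_nonneg) auto
      thus False using D0 by linarith
    qed
    define X where "X = int (card {k\<in>T. p - \<sigma> \<le> k})"
    have bound: "2 * num \<le> p - 1 + 2 * X \<or> num \<le> D + X \<or> num \<le> p - D - \<beta> + X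
      \<or> 2 * num \<le> p - 1 + 2 * (\<alpha> - D) + 2 * X"
      using none[of _ _ \<sigma>] D D0 \<sigma> h \<alpha>\<beta> by (intro forward_bound[OF st, where \<sigma> = \<sigma> and D = D]) (auto simp: X_def D_def)
    have X: "2 * X \<le> \<alpha> + 1" unfolding X_def
    proof (rule T_block_half[OF st W2, of _ "p - \<sigma>" \<sigma>])
      have "(\<sigma> - 1) * W = D - W" unfolding D_def by (simp add: algebra_simps)
      thus "(\<sigma> - 1) * W \<le> p - \<alpha>" using D W2 h \<alpha>\<beta> by linarith
    qed (use T_range in auto)
    show False
    proof (cases "\<alpha> \<le> D")
      case True2: True
      show ?thesis using bound X big D True2 True h \<alpha>\<beta> by (smt (verit))
    next
      case small: False
      have "\<sigma> = 1"
      proof (rule ccontr)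
        assume "\<sigma> \<noteq> 1"
        hence "2 * W \<le> \<sigma> * W" using \<sigma> W2 by (intro mult_right_mono) auto
        hence "2 * W \<le> D" unfolding D_def .
        thus False using D small h \<alpha>\<beta> by linarith
      qed
      hence "D = W" "X \<le> 1" using card_last[of 1] unfolding D_def X_def by simp_all
      thus ?thesis using bound big D small h \<alpha>\<beta> by (smt (verit))
    qed
  qed
qed

text \<open>
  The relation between \<open>k\<close> and \<open>l\<close> gives \<open>W < \<beta>\<close>.  A passage from \<open>K\<close> to \<open>T\<close> over \<open>\<sigma> < p/\<beta>\<close> positions
  that lowers \<open>A\<close> by \<open>\<sigma> W\<close> would be exactly \<open>\<sigma>\<close> times the vector from \<open>k\<close> to \<open>l\<close>, but it raises both \<open>B\<close>
  and \<open>C\<close>.  So \<open>backward_bound\<close> holds for small \<open>\<sigma>\<close>.  The distances 2 and 3 give \<open>6 W \<le> p - \<beta> + 3\<close>,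
  while \<open>slow_step\<close> gives \<open>W \<ge> \<beta> - 2\<close>; the one remaining set of parameters falls to \<open>\<sigma> = 4\<close>.
\<close>

lemma opposite_neighbours_False:
  assumes big: "p + \<beta> + 1 \<le> 2 * num" and kl: "k \<in> K" "l \<in> K" "l = k + 1" and W_pos: "0 < A k - A l"
    and mixed: "B k < B l \<and> C l < C k \<or> B l < B k \<and> C k < C l"
  shows False
proof -
  define W where "W = A k - A l"
  have st: "step W" and eq: "W * (q * r) = (B l - B k) * (p * r) + (C l - C k) * (p * q) + s"
    using step_of_neighbours[OF kl] unfolding W_def by auto
  have "W \<noteq> 1" using step_not_1(1)[OF st] by auto
  hence W2: "2 \<le> W" using W_pos unfolding W_def by linarith
  have "W < \<beta>"
    using mixed
  proof
    assume h: "B k < B l \<and> C l < C k"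
    have "p * (B l - B k) \<le> p * (a\<^sub>1 - 1)" using K_diff(1)[OF kl(1,2)] pqr_pos by (intro mult_left_mono) auto
    hence "p * (B l - B k) \<le> \<alpha> * q + 1 - p" using a1 by (simp add: algebra_simps)
    hence "p * (B l - B k) * r \<le> (\<alpha> * q + 1 - p) * r" using pqr_pos by (intro mult_right_mono) auto
    moreover have "(C l - C k) * (p * q) \<le> (-1) * (p * q)" using h pqr_pos by (intro mult_right_mono) auto
    ultimately have "W * (q * r) \<le> \<alpha> * (q * r) - (p - 1) * r - p * q + s" using eq by (simp add: algebra_simps)
    also have "\<dots> < \<alpha> * (q * r)"
    proof -
      have "1 * 1 < p * q" using p_ge q_gt by (intro mult_strict_mono) auto
      moreover have "0 \<le> (p - 1) * r" using p_ge r_gt by simp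
      ultimately show ?thesis using sign by auto
    qed
    finally have "W < \<alpha>" using pqr_pos by simp
    thus ?thesis using \<alpha>\<beta> by linarith
  next
    assume h: "B l < B k \<and> C k < C l"
    have "p * (C l - C k) \<le> p * (b\<^sub>1 - 1)" using K_diff(2)[OF kl(1,2)] pqr_pos by (intro mult_left_mono) auto
    hence "p * (C l - C k) \<le> \<beta> * r + 1 - p" using b1 by (simp add: algebra_simps)
    hence "p * (C l - C k) * q \<le> (\<beta> * r + 1 - p) * q" using pqr_pos by (intro mult_right_mono) auto
    moreover have "(B l - B k) * (p * r) \<le> (-1) * (p * r)" using h pqr_pos by (intro mult_right_mono) auto
    ultimately have "W * (q * r) \<le> \<beta> * (q * r) - (p - 1) * q - p * r + s" using eq by (simp add: algebra_simps)
    also have "\<dots> < \<beta> * (q * r)"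
    proof -
      have "1 * 1 < p * r" using p_ge r_gt by (intro mult_strict_mono) auto
      moreover have "0 \<le> (p - 1) * q" using p_ge q_gt by simp
      ultimately show ?thesis using sign by auto
    qed
    finally show "W < \<beta>" using pqr_pos by simp
  qed
  have none: False if tl: "k' \<in> T" "l' \<in> K" "k' = l' + \<sigma>" "A l' = A k' + \<sigma> * W"
    and \<sigma>: "0 \<le> \<sigma>" "\<sigma> * \<beta> < p" "\<sigma> < q" "\<sigma> < r" for k' l' \<sigma>
  proof -
    obtain X Y Z where XYZ: "1 * (A k' - A l') - \<sigma> * (A l - A k) = p * X"
      "1 * (B k' - B l') - \<sigma> * (B l - B k) = q * Y" "1 * (C k' - C l') - \<sigma> * (C l - C k) = r * Z" "X + Y + Z = 0"
      by (rule parallel[of l' k' k l 1 \<sigma>]) (use tl kl in auto)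
    have "p * X = 0" using XYZ(1) that(4) unfolding W_def by (simp add: algebra_simps)
    hence YZ: "Z = - Y" using XYZ(4) pqr_pos by simp
    have pos: "0 < B k' - B l'" "0 < C k' - C l'"
      using T_B(1)[OF that(1)] T_C(1)[OF that(1)] K_B(2)[OF that(2)] K_C(2)[OF that(2)] by auto
    have "\<sigma> * \<alpha> \<le> \<sigma> * \<beta>" using \<sigma> \<alpha>\<beta> by (intro mult_left_mono) auto
    hence "\<sigma> * \<alpha> < p" using \<sigma> by linarith
    hence small: "\<sigma> * a\<^sub>1 < q" "\<sigma> * b\<^sub>1 < r" using a1_small b1_small \<sigma> by blast+
    have "\<sigma> * (B l - B k) \<le> \<sigma> * a\<^sub>1" "\<sigma> * (C l - C k) \<le> \<sigma> * b\<^sub>1"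
      using K_diff(1,2)[OF kl(1,2)] \<sigma> by (intro mult_left_mono; simp)+
    hence "q * Y > q * (-1)" "r * Z > r * (-1)" using XYZ(2,3) pos small by auto
    hence "Y > -1" "Z > -1" using pqr_pos by (simp_all only: mult_less_cancel_left_pos)
    hence "Y = 0" "Z = 0" using YZ by linarith+
    hence "B k' - B l' = \<sigma> * (B l - B k)" "C k' - C l' = \<sigma> * (C l - C k)" using XYZ by auto
    hence "0 < B l - B k" "0 < C l - C k" using pos \<sigma>(1) by (metis zero_less_mult_pos less_le mult_zero_left)+
    thus False using mixed by linarith
  qed
  have bound: "2 * num \<le> p - 1 + 2 * X \<or> num \<le> p - \<sigma> * W + X \<or> num \<le> \<sigma> * W - \<beta> + X
      \<or> 2 * num \<le> p - 1 + 2 * (\<alpha> + \<sigma> * W - p) + 2 * X"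
    if "X = int (card {k\<in>T. k < \<sigma>})" "1 \<le> \<sigma>" "\<sigma> * W < p" "\<sigma> * \<beta> < p" "\<sigma> < q" "\<sigma> < r" for \<sigma> X
  proof (rule backward_bound[OF st, where \<sigma> = \<sigma> and D = "\<sigma> * W"])
    have "0 < \<sigma> * W" using that W2 by (intro mult_pos_pos) auto
    thus "0 < \<sigma> * W" .
  qed (use that none[of _ _ \<sigma>] in auto)
  have b2: "4 * W \<le> p - \<beta> + 3"
    using bound[OF refl, of 2] card_first[of 2] W2 \<open>W < \<beta>\<close> \<alpha>\<beta> big q_gt r_gt by (smt (verit))
  have b3: "6 * W \<le> p - \<beta> + 3" if "\<alpha> \<le> 2 * W"
  proof -
    define X where "X = int (card {k\<in>T. k < 3})"
    have "W * (X - 1) \<le> \<alpha> - 1" unfolding X_def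
      by (rule T_block[OF st, of _ 0 3]) (use W2 T_range \<open>W < \<beta>\<close> \<alpha>\<beta> in auto)
    hence X2: "X \<le> 2"
    proof -
      have False if "X \<ge> 3"
      proof -
        have "W * 2 \<le> W * (X - 1)" using W2 that by (intro mult_left_mono) auto
        thus False using \<open>W * (X - 1) \<le> \<alpha> - 1\<close> \<open>\<alpha> \<le> 2 * W\<close> by linarith
      qed
      thus ?thesis by (cases "X \<ge> 3") auto
    qed
    have "2 * num \<le> p - 1 + 2 * X \<or> num \<le> p - 3 * W + X \<or> num \<le> 3 * W - \<beta> + X
      \<or> 2 * num \<le> p - 1 + 2 * (\<alpha> + 3 * W - p) + 2 * X"
      by (rule bound) (use X_def W2 \<open>W < \<beta>\<close> \<alpha>\<beta> q_gt r_gt in auto)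
    thus ?thesis using X2 W2 \<open>W < \<beta>\<close> \<alpha>\<beta> big b2 by (smt (verit))
  qed
  have W_ge: "\<beta> - 2 \<le> W"
  proof (cases "2 * W \<le> p + 1 - 2 * \<alpha>")
    case True
    thus ?thesis using slow_step[OF big st W2] \<open>W < \<beta>\<close> by simp
  next
    case False
    hence "6 * W \<le> p - \<beta> + 3" using b3 \<alpha>\<beta> by linarith
    thus ?thesis using False \<alpha>\<beta> by linarith
  qed
  have six: "6 * W \<le> p - \<beta> + 3" using b3 W_ge W2 \<open>W < \<beta>\<close> \<alpha>\<beta> by linarith
  have "\<beta> \<le> 7" using six W_ge \<alpha>\<beta> by linarith
  hence "\<beta> \<in> set [3..7]" "\<alpha> \<in> set [1..\<beta>]" "p \<in> set [3 * \<beta> + 1..4 * \<alpha> + \<beta> - 1]" "W \<in> set [max 2 (\<beta> - 2)..\<beta> - 1]"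
    using W2 W_ge \<open>W < \<beta>\<close> \<alpha>\<beta> by auto
  hence ex: "p = 19" "\<alpha> = 4" "\<beta> = 4" "W = 3"
    using exceptional_parameters odd_p six step_\<alpha>\<beta>[OF st] by blast+
  have "2 * num \<le> p - 1 + 2 * int (card {k\<in>T. k < 4}) \<or> num \<le> p - 4 * W + int (card {k\<in>T. k < 4}) \<or> num \<le> 4 * W - \<beta> + int (card {k\<in>T. k < 4})
      \<or> 2 * num \<le> p - 1 + 2 * (\<alpha> + 4 * W - p) + 2 * int (card {k\<in>T. k < 4})"
    using ex q_gt r_gt by (intro bound[OF refl]) auto
  moreover have "W * (int (card {k\<in>T. k < 4}) - 1) \<le> \<alpha> - 1"
    by (rule T_block[OF st, of _ 0 4]) (use W2 T_range ex in auto)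
  ultimately show False using ex big by simp
qed

end

section \<open>Configurations without adjacent points of type K\<close>

text \<open>
  A translation by 2 or more pushes at least two elements of the interval out of it.
\<close>

lemma almost_invariant_interval:
  fixes S :: "int set"
  assumes S: "S \<subseteq> {0..<\<alpha>}" "\<And>x. x \<in> S \<Longrightarrow> 0 \<le> x + \<delta> \<and> x + \<delta> < \<alpha>"
    and card: "\<alpha> - 1 \<le> int (card S)" and "2 \<le> \<alpha>"
  shows "\<bar>\<delta>\<bar> \<le> 1"
proof (rule ccontr)
  assume "\<not> \<bar>\<delta>\<bar> \<le> 1"
  hence "S \<subseteq> {0..<max 0 (\<alpha> - 2)} \<or> S \<subseteq> {min \<alpha> 2..<\<alpha>}"
  proof (cases "\<delta> \<ge> 2")
    case True
    hence "S \<subseteq> {0..<max 0 (\<alpha> - 2)}" using S by fastforce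
    thus ?thesis ..
  next
    case False
    hence "S \<subseteq> {min \<alpha> 2..<\<alpha>}" using S \<open>\<not> \<bar>\<delta>\<bar> \<le> 1\<close> by fastforce
    thus ?thesis ..
  qed
  thus False
  proof
    assume "S \<subseteq> {0..<max 0 (\<alpha> - 2)}"
    from card_int_subset_atLeastLessThan[OF this] show False using card assms(4) by simp
  next
    assume "S \<subseteq> {min \<alpha> 2..<\<alpha>}"
    from card_int_subset_atLeastLessThan[OF this] show False using card assms(4) by simp
  qed
qed

context configuration begin

lemma reversed:
  "configuration p q r \<alpha> \<beta> a\<^sub>1 b\<^sub>1 (- s) (c - s * (p - 1)) ((\<lambda>k. p - 1 - k) ` T) ((\<lambda>k. p - 1 - k) ` K)
     (\<lambda>k. A (p - 1 - k)) (\<lambda>k. B (p - 1 - k)) (\<lambda>k. C (p - 1 - k))"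
proof
  have rT: "\<And>k. k \<in> (\<lambda>k. p - 1 - k) ` T \<Longrightarrow> p - 1 - k \<in> T" by auto
  have rK: "\<And>k. k \<in> (\<lambda>k. p - 1 - k) ` K \<Longrightarrow> p - 1 - k \<in> K" by auto
  note T_facts = T_A[OF rT] T_B[OF rT] T_C[OF rT] and K_facts = K_A[OF rK] K_B[OF rK] K_C[OF rK]
  show "(\<lambda>k. p - 1 - k) ` T \<subseteq> {0..<p}" "(\<lambda>k. p - 1 - k) ` K \<subseteq> {0..<p}"
    using T_sub K_sub by (auto simp: subset_iff)
  show "- s = 1 \<or> - s = -1" using sign by auto
  show "0 \<le> A (p - 1 - k)" "A (p - 1 - k) < \<alpha>" "0 \<le> B (p - 1 - k)" "2 * B (p - 1 - k) < q"
    "0 \<le> C (p - 1 - k)" "2 * C (p - 1 - k) < r" if "k \<in> (\<lambda>k. p - 1 - k) ` T" for k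
    using T_facts[OF that] by blast+
  show "\<alpha> + \<beta> \<le> A (p - 1 - k)" "2 * A (p - 1 - k) < p - 1 + 2 * \<alpha> + 2 * \<beta>" "- a\<^sub>1 \<le> B (p - 1 - k)"
    "B (p - 1 - k) < 0" "- b\<^sub>1 \<le> C (p - 1 - k)" "C (p - 1 - k) < 0" if "k \<in> (\<lambda>k. p - 1 - k) ` K" for k
    using K_facts[OF that] by blast+
  fix k assume "k \<in> (\<lambda>k. p - 1 - k) ` T \<union> (\<lambda>k. p - 1 - k) ` K"
  hence "p - 1 - k \<in> T \<union> K" by auto
  from rel[OF this] show "A (p - 1 - k) * (q * r) + B (p - 1 - k) * (p * r) + C (p - 1 - k) * (p * q)
      = c - s * (p - 1) - - s * k" by (simp add: algebra_simps)
qed (fact odd_p q_gt r_gt cop \<alpha>\<beta>_base regime a1 b1 inv nondeg)+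

lemma card_reversed: "card ((\<lambda>k. p - 1 - k) ` S) = card (S :: int set)"
  by (intro card_image) (auto simp: inj_on_def)

text \<open>
  If \<open>A\<close> drops by at least \<open>p\<close> from \<open>l'\<close> to \<open>k'\<close>, the excess over \<open>p\<close> is a small step,
  and \<open>slow_step\<close> contradicts its size.
\<close>

lemma no_long_descent:
  assumes big: "p + \<beta> + 1 \<le> 2 * num"
    and 2: "k' \<in> T" "l' \<in> K" "k' = l' + 1" and far: "p \<le> A l' - A k'"
  shows False
proof -
  obtain W where W: "step W" using step_exists by blast
  define d where "d = A l' - A k' - p"
  have "p dvd A k' - A l' + (k' - l') * W" using residue[OF W] 2 by blast
  hence "p dvd (A k' - A l' + (k' - l') * W) + p" by simp
  moreover have "(A k' - A l' + (k' - l') * W) + p = W - d" using 2 unfolding d_def by simp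
  ultimately have "p dvd W - d" by metis
  hence st: "step d" using step_cong[OF W] by blast
  have "d \<noteq> 0" "d \<noteq> 1" using step_not_0[OF st] step_not_1(1)[OF st] by auto
  hence d2: "2 \<le> d" using far unfolding d_def by linarith
  have "2 * d < 2 * \<alpha> + 2 * \<beta> - p - 1" using K_A(2)[OF 2(2)] T_A(1)[OF 2(1)] unfolding d_def by simp
  moreover from this have "\<beta> - 2 \<le> d" using d2 \<alpha>\<beta> by (intro slow_step[OF big st]) (smt (verit))+
  ultimately show False using \<alpha>\<beta> p_ge by (smt (verit))
qed

text \<open>
  By \<open>opposite_passages\<close> one of the two passages has a difference of at least \<open>p\<close> in \<open>A\<close>; reading the
  window backwards exchanges their roles.
\<close>

lemma no_alternation:
  assumes big: "p + \<beta> + 1 \<le> 2 * num"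
    and 1: "k \<in> T" "l \<in> K" "l = k + 1" and 2: "k' \<in> T" "l' \<in> K" "k' = l' + 1"
  shows False
proof -
  have far: "2 * p \<le> (A l - A k) + (A l' - A k')" using opposite_passages[of k l 1 k' l'] 1 2 by simp
  show False
  proof (cases "p \<le> A l' - A k'")
    case True thus ?thesis using no_long_descent[OF big 2] by simp
  next
    case False
    interpret rev: configuration p q r \<alpha> \<beta> a\<^sub>1 b\<^sub>1 "- s" "c - s * (p - 1)" "(\<lambda>k. p - 1 - k) ` T" "(\<lambda>k. p - 1 - k) ` K"
     "\<lambda>k. A (p - 1 - k)" "\<lambda>k. B (p - 1 - k)" "\<lambda>k. C (p - 1 - k)" by (rule reversed)
    show ?thesis
    proof (rule rev.no_long_descent[of "p - 1 - k" "p - 1 - l"])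
      show "p \<le> A (p - 1 - (p - 1 - l)) - A (p - 1 - (p - 1 - k))" using far False by simp
      show "p + \<beta> + 1 \<le> 2 * (int (card ((\<lambda>k. p - 1 - k) ` T)) + int (card ((\<lambda>k. p - 1 - k) ` K)))"
        using big by (simp add: card_reversed)
    qed (use 1 2 in blast | use 1(3) 2(3) in simp)+
  qed
qed

end

text \<open>
  Once adjacent positions of type \<open>K\<close> are excluded and the direction of reading is chosen suitably, every
  counterexample has this form.
\<close>

locale tight_configuration = configuration +
  assumes big: "p + \<beta> + 1 \<le> 2 * num"
    and no_KK: "\<And>k. k \<in> K \<Longrightarrow> k + 1 \<notin> K"
    and no_KT: "\<And>k. k \<in> K \<Longrightarrow> k + 1 \<notin> T"
begin

text \<open>
  The occupied positions and their successors lie in a set of \<open>p + 1\<close> elements, and they overlap only in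
  successors of positions in \<open>T\<close>, of which there are at most \<open>\<alpha>\<close>.  So \<open>2 P \<le> p + 1 + \<alpha>\<close>, and the assumed
  lower bound forces equality everywhere.
\<close>

lemma saturated:
  shows \<alpha>_eq: "\<alpha> = \<beta>" and card_T: "int (card T) = \<alpha>" and num_eq: "2 * num = p + \<beta> + 1"
    and T_succ: "\<And>k. k \<in> T \<Longrightarrow> k + 1 \<in> T \<union> K"
    and cover: "\<And>j. 0 \<le> j \<Longrightarrow> j \<le> p \<Longrightarrow> j \<in> T \<union> K \<or> j - 1 \<in> T \<union> K"
proof -
  let ?Q = "T \<union> K" let ?Q1 = "(\<lambda>k. k + 1) ` (T \<union> K)" let ?T = "{k\<in>T. k + 1 \<in> T \<union> K}"
  have fin: "finite ?Q" "finite ?Q1" using finT finK by auto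
  have cQ: "int (card ?Q) = num" using finT finK disjoint by (simp add: card_Un_disjoint)
  have cQ1: "card ?Q1 = card ?Q" by (intro card_image) (auto simp: inj_on_def)
  have sub: "?Q \<union> ?Q1 \<subseteq> {0..<p + 1}" using T_range K_range by force
  have "int (card (?Q \<union> ?Q1)) \<le> p + 1" using card_int_subset_atLeastLessThan[OF sub] pqr_pos by simp
  have meet: "?Q \<inter> ?Q1 \<subseteq> (\<lambda>k. k + 1) ` ?T" using no_KK no_KT by auto
  have "card (?Q \<inter> ?Q1) \<le> card ((\<lambda>k. k + 1) ` ?T)" using meet finT by (intro card_mono) auto
  also have "\<dots> = card ?T" by (intro card_image) (auto simp: inj_on_def)
  finally have cm: "card (?Q \<inter> ?Q1) \<le> card ?T" .
  have cT: "card ?T \<le> card T" using finT by (intro card_mono) auto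
  have "A ` T \<subseteq> {0..<\<alpha>}" using T_A by auto
  hence cTa: "int (card T) \<le> \<alpha>"
    using card_int_subset_atLeastLessThan[of "A ` T" 0 \<alpha>] card_image_A[of T] \<alpha>\<beta> by simp
  have sum: "card ?Q + card ?Q1 = card (?Q \<union> ?Q1) + card (?Q \<inter> ?Q1)"
    using card_Un_Int[OF fin] .
  have squeeze: "\<alpha> = \<beta> \<and> t = \<alpha> \<and> n = p + \<beta> + 1 \<and> t' = t \<and> u = p + 1"
    if "n = u + m" "m \<le> t'" "t' \<le> t" "t \<le> \<alpha>" "u \<le> p + 1" "p + \<beta> + 1 \<le> n" for n u m t' t :: int
    using that \<alpha>\<beta>(2) by linarith
  have "2 * num = int (card (?Q \<union> ?Q1)) + int (card (?Q \<inter> ?Q1))"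
    using sum cQ cQ1 by (metis mult_2 of_nat_add)
  from squeeze[OF this, of "int (card ?T)" "int (card T)"]
  have all: "\<alpha> = \<beta> \<and> int (card T) = \<alpha> \<and> 2 * num = p + \<beta> + 1 \<and> card ?T = card T \<and> int (card (?Q \<union> ?Q1)) = p + 1"
    using cm cT cTa \<open>int (card (?Q \<union> ?Q1)) \<le> p + 1\<close> big by simp
  show "\<alpha> = \<beta>" "int (card T) = \<alpha>" "2 * num = p + \<beta> + 1" using all by auto
  have "?T = T" using all finT by (intro card_subset_eq) auto
  thus "\<And>k. k \<in> T \<Longrightarrow> k + 1 \<in> T \<union> K" by blast
  have "?Q \<union> ?Q1 = {0..<p + 1}"
  proof (rule card_subset_eq)
    have "int (card (?Q \<union> ?Q1)) = p + 1" using all by blast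
    thus "card (?Q \<union> ?Q1) = card {0..<p + 1}" by simp
  qed (use sub in auto)
  hence "j \<in> ?Q \<union> ?Q1" if "0 \<le> j" "j \<le> p" for j using that by auto
  thus "\<And>j. 0 \<le> j \<Longrightarrow> j \<le> p \<Longrightarrow> j \<in> T \<union> K \<or> j - 1 \<in> T \<union> K" by force
qed

lemma A_T: "A ` T = {0..<\<alpha>}"
proof (rule card_subset_eq)
  show "A ` T \<subseteq> {0..<\<alpha>}" using T_A by auto
  show "card (A ` T) = card {0..<\<alpha>}" using card_T card_image_A[of T] by simp
qed simp

text \<open>
  Otherwise \<open>A k - p\<close> would be one of the values in \<open>{0..<\<alpha>}\<close>, all of which are taken on \<open>T\<close>,
  and two positions would share a residue.
\<close>

lemma K_A_less: "k \<in> K \<Longrightarrow> A k < p"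
proof (rule ccontr)
  assume k: "k \<in> K" "\<not> A k < p"
  have "2 * A k - 2 * p < 2 * \<alpha>" using K_A(2)[OF k(1)] \<alpha>\<beta> by linarith
  hence "A k - p < \<alpha>" by simp
  hence "A k - p \<in> A ` T" using k A_T by auto
  then obtain l where l: "l \<in> T" "A k - p = A l" by blast
  hence "A k - A l = p" by simp
  hence "p dvd A k - A l" by simp
  hence "k = l" using inj_residue k l by blast
  thus False using k l disjoint by blast
qed

lemma zero_in: "0 \<in> T \<union> K" and last_in: "p - 1 \<in> K"
proof -
  show "0 \<in> T \<union> K" using cover[of 0] T_range K_range pqr_pos by force
  have "p - 1 \<in> T \<union> K" using cover[of p] T_range[of p] K_range[of p] pqr_pos by auto
  moreover have "p - 1 \<notin> T" using T_succ[of "p - 1"] T_range[of p] K_range[of p] by auto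
  ultimately show "p - 1 \<in> K" by blast
qed

lemma K_succ:
  assumes "k \<in> K" "k \<noteq> p - 1"
  shows "k + 1 \<notin> T \<union> K" "k + 2 \<in> T \<union> K"
proof -
  show n: "k + 1 \<notin> T \<union> K" using no_KK no_KT assms by blast
  have "k + 2 \<le> p" using K_range[OF assms(1)] assms(2) by linarith
  moreover have "k + 2 - 1 = k + 1" by simp
  hence "k + 2 - 1 \<notin> T \<union> K" using n by metis
  moreover have "0 \<le> k + 2" using K_range[OF assms(1)] by simp
  ultimately show "k + 2 \<in> T \<union> K" using cover by blast
qed

text \<open>
  Otherwise \<open>T\<close> occupies a block of positions before \<open>K\<close> in which each position but the first follows
  another one of \<open>T\<close>.  Then \<open>A\<close> changes along this block by a constant, which must be \<open>1\<close> or \<open>-1\<close>, contrary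
  to \<open>q r \<noteq> \<plusminus>1\<close> modulo \<open>p\<close>.
\<close>

lemma K_T_at_2_exists: "\<exists>k\<in>K. k + 2 \<in> T"
proof (rule ccontr)
  assume "\<not> ?thesis"
  hence KK: "k + 2 \<in> K" if "k \<in> K" "k \<noteq> p - 1" for k using K_succ[OF that] that by blast
  have before: "j < k" if k: "k \<in> K" and j: "j \<in> T" for j k
  proof (rule ccontr)
    assume "\<not> j < k"
    let ?S = "{k\<in>K. k \<le> j}"
    have S: "finite ?S" "?S \<noteq> {}" using finK k \<open>\<not> j < k\<close> by auto
    define m where "m = Max ?S"
    have m: "m \<in> K" "m \<le> j" using Max_in[OF S] unfolding m_def by auto
    have "m \<noteq> j" using m j disjoint by blast
    moreover have "m \<noteq> p - 1" using m T_range[OF j] \<open>m \<noteq> j\<close> by linarith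
    hence "m + 2 \<in> K" using KK m by blast
    hence "\<not> m + 2 \<le> j" using Max_ge[OF S(1), of "m + 2"] unfolding m_def[symmetric] by auto
    ultimately have "j = m + 1" using m by linarith
    thus False using no_KT m j by blast
  qed
  have pred: "k - 1 \<in> T" if k: "k \<in> T" "k \<noteq> 0" for k
  proof (rule ccontr)
    assume "k - 1 \<notin> T"
    moreover have "k - 1 \<notin> K" using no_KT[of "k - 1"] k by auto
    ultimately have n: "k - 1 \<notin> T \<union> K" by blast
    hence "k \<noteq> 1" using zero_in by auto
    hence "k - 2 \<in> T \<union> K" using cover[of "k - 1"] n T_range[OF k(1)] k(2) by simp
    moreover have "k - 2 \<notin> K" using before[of "k - 2" k] k by auto
    ultimately have "k - 2 + 1 \<in> T \<union> K" using T_succ[of "k - 2"] by blast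
    thus False using n by simp
  qed
  obtain W where W: "step W" using step_exists by blast
  have "T - {0} \<noteq> {}"
  proof
    assume "T - {0} = {}"
    hence "card T \<le> 1" using card_mono[of "{0}" T] by auto
    thus False using card_T \<alpha>_ge by simp
  qed
  then obtain k0 where k0: "k0 \<in> T" "k0 \<noteq> 0" by blast
  define \<delta> where "\<delta> = A (k0 - 1) - A k0"
  have res: "p dvd A k - A (k - 1) + W" if "k \<in> T" "k \<noteq> 0" for k
    using residue[OF W, of "k - 1" k] pred[OF that] that by simp
  have const: "A (k - 1) = A k + \<delta>" if k: "k \<in> T" "k \<noteq> 0" for k
  proof -
    have "p dvd (A k - A (k - 1) + W) - (A k0 - A (k0 - 1) + W)" using res[OF k] res[OF k0] by (rule dvd_diff)
    hence "p dvd A k - A (k - 1) + \<delta>" unfolding \<delta>_def by (simp add: algebra_simps)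
    moreover have "\<bar>A k - A (k - 1) + \<delta>\<bar> < p"
      using T_A[OF k(1)] T_A[OF k0(1)] T_A[OF pred[OF k]] T_A[OF pred[OF k0]] \<alpha>\<beta> unfolding \<delta>_def by linarith
    ultimately have "A k - A (k - 1) + \<delta> = 0" using dvd_imp_le_int[of "A k - A (k - 1) + \<delta>" p] by linarith
    thus ?thesis by linarith
  qed
  have "\<bar>\<delta>\<bar> \<le> 1"
  proof (rule almost_invariant_interval[of "A ` (T - {0})" \<alpha>])
    show "A ` (T - {0}) \<subseteq> {0..<\<alpha>}" using A_T by auto
    show "0 \<le> x + \<delta> \<and> x + \<delta> < \<alpha>" if x: "x \<in> A ` (T - {0})" for x
    proof -
      obtain k where k: "k \<in> T" "k \<noteq> 0" "x = A k" using x by blast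
      show ?thesis using const[OF k(1,2)] T_A[OF pred[OF k(1,2)]] k(3) by simp
    qed
    have "card (A ` (T - {0})) = card (T - {0})" by (rule card_image_A) auto
    moreover have "card T \<le> card (T - {0}) + 1"
      using card_Diff1_le[of T 0] by (cases "0 \<in> T") (auto simp: card_Diff_singleton)
    ultimately show "\<alpha> - 1 \<le> int (card (A ` (T - {0})))" using card_T \<alpha>_ge by linarith
  qed (rule \<alpha>_ge)
  moreover have "\<delta> \<noteq> 0"
  proof
    assume "\<delta> = 0"
    hence "A (k0 - 1) = A k0" unfolding \<delta>_def by simp
    moreover have "k0 - 1 \<in> T \<union> K" "k0 \<in> T \<union> K" using k0 pred[OF k0] by auto
    ultimately have "k0 - 1 = k0" using inj_A by (meson inj_onD)
    thus False by simp
  qed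
  ultimately have "\<delta> = 1 \<or> \<delta> = -1" by linarith
  moreover have "p dvd W - \<delta>" using res[OF k0] unfolding \<delta>_def by (simp add: algebra_simps)
  ultimately show False using step_not_1[OF W] by auto
qed

lemma T_K_exists: "\<exists>k\<in>T. k + 1 \<in> K"
proof -
  have "T \<noteq> {}" using card_T \<alpha>_ge by auto
  hence "Max T \<in> T" "\<And>k. k \<in> T \<Longrightarrow> k \<le> Max T" using finT by auto
  hence "Max T + 1 \<in> K" using T_succ[of "Max T"] by force
  thus ?thesis using \<open>Max T \<in> T\<close> by blast
qed

end

section \<open>The zigzag pattern\<close>

context tight_configuration begin

text \<open>
  Twice the passage from \<open>x\<close> to \<open>x + 1\<close> is as long as the passage from \<open>u\<close> to \<open>u + 2\<close>, and signs and sizes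
  force the relation \<open>X = 2\<close>, \<open>Y = Z = -1\<close> between them.  This fixes the differences of \<open>A\<close> in all passages
  of these two kinds.  As a passage from \<open>T\<close> to \<open>K\<close> over two positions is excluded by
  \<open>opposite_passages\<close>, \<open>forward_bound\<close> with \<open>\<sigma> = 2\<close> makes \<open>W\<close> so large that no two positions of \<open>T\<close> are
  adjacent.
\<close>

lemma zigzag:
  assumes TK: "x \<in> T" "x + 1 \<in> K" and KT: "u \<in> K" "u + 2 \<in> T"
  defines "W \<equiv> p - (A (x + 1) - A x)"
  shows zz_step: "step W"
    and zz_A: "A u - A (u + 2) = 2 * W"
    and zz_B: "2 * (B x - B (x + 1)) + (B (u + 2) - B u) = q"
    and zz_C: "2 * (C x - C (x + 1)) + (C (u + 2) - C u) = r"
    and zz_up: "\<And>k. k \<in> T \<Longrightarrow> k + 1 \<in> K \<Longrightarrow> A (k + 1) = A k + p - W"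
    and zz_down: "\<And>k. k \<in> K \<Longrightarrow> k + 2 \<in> T \<Longrightarrow> A (k + 2) = A k - 2 * W"
    and zz_large: "p + \<beta> \<le> 4 * W + 1" and zz_bounds: "\<alpha> \<le> W" "W + \<beta> < p" "2 * W < p"
    and zz_succ: "\<And>k. k \<in> T \<Longrightarrow> k + 1 \<in> K"
proof -
  obtain X Y Z where XYZ: "2 * (A (x + 1) - A x) - 1 * (A (u + 2) - A u) = p * X"
    "2 * (B (x + 1) - B x) - 1 * (B (u + 2) - B u) = q * Y"
    "2 * (C (x + 1) - C x) - 1 * (C (u + 2) - C u) = r * Z" "X + Y + Z = 0"
    by (rule parallel[of x "x + 1" u "u + 2" 2 1]) (use assms in auto)
  have "q * Y < 0" "r * Z < 0"
    using XYZ(2,3) T_B(1)[OF TK(1)] T_B(1)[OF KT(2)] K_B(2)[OF TK(2)] K_B(2)[OF KT(1)]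
      T_C(1)[OF TK(1)] T_C(1)[OF KT(2)] K_C(2)[OF TK(2)] K_C(2)[OF KT(1)] by (smt (verit))+
  hence YZ: "Y < 0" "Z < 0" using pqr_pos by (simp_all add: mult_less_0_iff)
  have up_pos: "\<beta> + 1 \<le> A l - A k" if "k \<in> T" "l \<in> K" for k l
    using T_A(2)[OF that(1)] K_A(1)[OF that(2)] by linarith
  have up_less: "A l - A k < p" if "k \<in> T" "l \<in> K" for k l
    using T_A(1)[OF that(1)] K_A_less[OF that(2)] by linarith
  have E1: "\<beta> + 1 \<le> A (x + 1) - A x" "A (x + 1) - A x < p" and E2: "\<beta> + 1 \<le> A u - A (u + 2)" "A u - A (u + 2) < p"
    using up_pos[of x "x + 1"] up_less[of x "x + 1"] up_pos[of "u + 2" u] up_less[of "u + 2" u] assms by auto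
  have "p * X < p * 3" using XYZ(1) E1 E2 by simp
  hence "X < 3" using pqr_pos by (simp only: mult_less_cancel_left_pos)
  hence vals: "X = 2" "Y = -1" "Z = -1" using YZ XYZ(4) by linarith+
  show zA: "A u - A (u + 2) = 2 * W" using XYZ(1) vals unfolding W_def by simp
  show "2 * (B x - B (x + 1)) + (B (u + 2) - B u) = q" using XYZ(2) vals by simp
  show "2 * (C x - C (x + 1)) + (C (u + 2) - C u) = r" using XYZ(3) vals by simp
  obtain W' where W': "step W'" using step_exists by blast
  have "p dvd A (x + 1) - A x + (x + 1 - x) * W'" using residue[OF W'] assms by blast
  moreover have "W' - W = (A (x + 1) - A x + (x + 1 - x) * W') - p" unfolding W_def by simp
  ultimately have "p dvd W' - W" by (metis dvd_diff dvd_refl)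
  thus st: "step W" using step_cong[OF W'] by blast
  show "A (k + 1) = A k + p - W" if k: "k \<in> T" "k + 1 \<in> K" for k
  proof -
    have "p dvd A (k + 1) - A k + (k + 1 - k) * W" using residue[OF st] k by blast
    hence "p dvd (A (k + 1) - A k + (k + 1 - k) * W) - p" by simp
    moreover have "\<bar>A (k + 1) - A k + (k + 1 - k) * W - p\<bar> < p"
      using up_pos[OF k] up_less[OF k] E1 \<alpha>\<beta> unfolding W_def by auto
    ultimately have "A (k + 1) - A k + (k + 1 - k) * W - p = 0"
      using dvd_imp_le_int[of "A (k + 1) - A k + (k + 1 - k) * W - p" p] by linarith
    thus ?thesis by simp
  qed
  show "A (k + 2) = A k - 2 * W" if k: "k \<in> K" "k + 2 \<in> T" for k
  proof -
    have "p dvd A (k + 2) - A k + (k + 2 - k) * W" using residue[OF st] k by blast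
    moreover have "\<bar>A (k + 2) - A k + (k + 2 - k) * W\<bar> < p"
      using up_pos[OF k(2,1)] up_less[OF k(2,1)] E2 zA \<alpha>\<beta> by auto
    ultimately have "A (k + 2) - A k + (k + 2 - k) * W = 0"
      using dvd_imp_le_int[of "A (k + 2) - A k + (k + 2 - k) * W" p] by linarith
    thus ?thesis by simp
  qed
  define X where "X = int (card {k\<in>T. p - 2 \<le> k})"
  have "{k\<in>T. p - 2 \<le> k} \<subseteq> {p - 2..<p - 1}"
  proof
    fix k assume k: "k \<in> {k\<in>T. p - 2 \<le> k}"
    have "k \<noteq> p - 1" using k last_in disjoint by blast
    thus "k \<in> {p - 2..<p - 1}" using k T_range[of k] by auto
  qed
  from card_int_subset_atLeastLessThan[OF this] have X: "X \<le> 1" unfolding X_def by simp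
  have bound: "2 * num \<le> p - 1 + 2 * X \<or> num \<le> 2 * W + X \<or> num \<le> p - 2 * W - \<beta> + X
    \<or> 2 * num \<le> p - 1 + 2 * (\<alpha> - 2 * W) + 2 * X"
  proof (rule forward_bound[OF st, where \<sigma> = 2 and D = "2 * W"])
    fix k l assume kl: "k \<in> T" "l \<in> K" "l = k + 2" "A l = A k + p - 2 * W"
    have "2 * p \<le> (A l - A k) + (A u - A (u + 2))"
      by (rule opposite_passages[where \<sigma> = 2]) (use kl KT in auto)
    thus False using kl zA pqr_pos by simp
  qed (use zA E2 X_def \<alpha>\<beta> in auto)
  have W2: "\<beta> + 1 \<le> 2 * W" "2 * W < p" using zA E2 by auto
  show "p + \<beta> \<le> 4 * W + 1" using bound X num_eq W2 \<alpha>\<beta> \<alpha>_eq by (smt (verit))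
  hence aW: "\<alpha> \<le> W" using \<alpha>\<beta> \<alpha>_eq by (smt (verit))
  thus "\<alpha> \<le> W" "2 * W < p" using W2 by auto
  show bW: "W + \<beta> < p" using E1 unfolding W_def by simp
  show "k + 1 \<in> K" if k: "k \<in> T" for k
  proof (rule ccontr)
    assume "k + 1 \<notin> K"
    hence k1: "k + 1 \<in> T" using T_succ[OF k] by blast
    have "p dvd A (k + 1) - A k + (k + 1 - k) * W" using residue[OF st] k k1 by blast
    moreover have "\<bar>A (k + 1) - A k + (k + 1 - k) * W\<bar> < p" "A (k + 1) - A k + (k + 1 - k) * W \<noteq> 0"
      using T_A[OF k] T_A[OF k1] aW bW \<alpha>\<beta> \<alpha>_eq by auto
    ultimately show False using dvd_imp_le_int[of "A (k + 1) - A k + (k + 1 - k) * W" p] by linarith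
  qed
qed

lemma T_pred:
  assumes zz: "x \<in> T" "x + 1 \<in> K" "u \<in> K" "u + 2 \<in> T" and k: "k \<in> T" "k \<noteq> 0"
  shows "k - 2 \<in> K"
proof -
  have "k - 1 \<notin> K" using no_KT[of "k - 1"] k by auto
  moreover have "k - 1 \<notin> T"
  proof
    assume "k - 1 \<in> T"
    hence "k - 1 + 1 \<in> K" using zz_succ[OF zz] by blast
    thus False using k disjoint by auto
  qed
  ultimately have n: "k - 1 \<notin> T \<union> K" by blast
  hence "k \<noteq> 1" using zero_in by auto
  hence "k - 2 \<in> T \<union> K" using cover[of "k - 1"] n T_range[OF k(1)] k(2) by simp
  moreover have "k - 2 \<notin> T"
  proof
    assume "k - 2 \<in> T"
    hence "k - 2 + 1 \<in> K" using zz_succ[OF zz] by blast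
    thus False using n by simp
  qed
  ultimately show ?thesis by blast
qed

text \<open>
  The values of \<open>A\<close> on \<open>T - F\<close> are all but at most one element of \<open>{0..<\<alpha>}\<close>, and adding \<open>\<delta>\<close> keeps them in
  this interval; \<open>\<delta> = 0\<close> would contradict injectivity of \<open>A\<close>.
\<close>

lemma T_translation:
  assumes F: "F \<subseteq> T" "card F \<le> 1" and n: "n > 0"
    and trans: "\<And>k. k \<in> T - F \<Longrightarrow> k + n \<in> T \<and> A (k + n) = A k + \<delta>"
  shows "\<delta> = 1 \<or> \<delta> = -1"
proof -
  have card: "int (card (T - F)) \<ge> \<alpha> - 1"
    using card_T F finT card_Diff_subset[of F T] finite_subset[OF F(1)] card_mono[of T F] by auto
  have "\<bar>\<delta>\<bar> \<le> 1"
  proof (rule almost_invariant_interval[of "A ` (T - F)" \<alpha>])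
    show "A ` (T - F) \<subseteq> {0..<\<alpha>}" using A_T by auto
    show "0 \<le> x + \<delta> \<and> x + \<delta> < \<alpha>" if x: "x \<in> A ` (T - F)" for x
    proof -
      obtain k where k: "k \<in> T - F" "x = A k" using x by blast
      have "k + n \<in> T" "A (k + n) = A k + \<delta>" using trans[OF k(1)] by auto
      thus ?thesis using T_A[of "k + n"] k(2) by simp
    qed
    have "card (A ` (T - F)) = card (T - F)" by (rule card_image_A) auto
    thus "\<alpha> - 1 \<le> int (card (A ` (T - F)))" using card by simp
  qed (rule \<alpha>_ge)
  moreover have "\<delta> \<noteq> 0"
  proof
    assume "\<delta> = 0"
    have "T - F \<noteq> {}"
    proof
      assume "T - F = {}"
      hence "int (card (T - F)) = 0" by (simp only: card.empty of_nat_0)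
      thus False using card \<alpha>_ge by simp
    qed
    then obtain k where k: "k \<in> T - F" by blast
    have "A (k + n) = A k" "k + n \<in> T \<union> K" "k \<in> T \<union> K" using trans[OF k] k \<open>\<delta> = 0\<close> by auto
    hence "k + n = k" using inj_A by (meson inj_onD)
    thus False using n by simp
  qed
  ultimately show ?thesis by linarith
qed

text \<open>
  Otherwise each position of \<open>K\<close> but the last is followed by one of \<open>T\<close> two positions later, so \<open>T\<close> recurs
  with period 3 and \<open>p = 3 \<alpha> + 1\<close>.  Along a period \<open>A\<close> changes by \<open>p - 3 W = \<plusminus>1\<close>, which is incompatible
  with \<open>W \<equiv> \<plusminus>\<alpha>\<^sup>2\<close> modulo \<open>p\<close>.
\<close>

lemma K_K_at_2_exists: "\<exists>k\<in>K. k + 2 \<in> K"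
proof (rule ccontr)
  assume none: "\<not> ?thesis"
  obtain x where x: "x \<in> T" "x + 1 \<in> K" using T_K_exists by blast
  obtain u where u: "u \<in> K" "u + 2 \<in> T" using K_T_at_2_exists by blast
  define W where "W = p - (A (x + 1) - A x)"
  note zz = zigzag[OF x u, folded W_def]
  have KT: "k + 2 \<in> T" if "k \<in> K" "k \<noteq> p - 1" for k using K_succ(2)[OF that] none that by blast
  have "(\<lambda>k. k + 2) ` (K - {p - 1}) \<subseteq> T" using KT by blast
  hence "card ((\<lambda>k. k + 2) ` (K - {p - 1})) \<le> card T" using finT card_mono by blast
  moreover have "card ((\<lambda>k. k + 2) ` (K - {p - 1})) = card (K - {p - 1})" by (intro card_image) (auto simp: inj_on_def)
  moreover have "card (K - {p - 1}) = card K - 1" "card K \<ge> 1"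
    using last_in finK by (auto simp: card_Diff_singleton card_gt_0_iff Suc_le_eq)
  ultimately have "int (card K) \<le> \<alpha> + 1" using card_T by linarith
  hence "p \<le> 3 * \<alpha> + 1" using num_eq card_T \<alpha>_eq by simp
  hence p: "p = 3 * \<alpha> + 1" using \<alpha>\<beta> \<alpha>_eq by linarith
  have W3: "p - 3 * W = 1 \<or> p - 3 * W = -1"
  proof (rule T_translation[of "T \<inter> {p - 2}" 3])
    show "card (T \<inter> {p - 2}) \<le> 1" using card_mono[of "{p - 2}" "T \<inter> {p - 2}"] by simp
    fix k assume k: "k \<in> T - T \<inter> {p - 2}"
    hence k1: "k + 1 \<in> K" "k + 1 \<noteq> p - 1" using zz(11) by auto
    have k3: "k + 1 + 2 \<in> T" using KT[OF k1] .
    hence "A (k + 1 + 2) = A (k + 1) - 2 * W" using zz(6)[OF k1(1)] by blast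
    moreover have "A (k + 1) = A k + p - W" using zz(5) k k1 by blast
    ultimately have "A (k + 1 + 2) = A k + (p - 3 * W)" by simp
    moreover have "k + 1 + 2 = k + 3" by simp
    ultimately show "k + 3 \<in> T \<and> A (k + 3) = A k + (p - 3 * W)" using k3 by metis
  qed auto
  have "p dvd 9 * W - 9 * (\<alpha> * \<alpha>) \<or> p dvd 9 * W + 9 * (\<alpha> * \<alpha>)"
    using step_\<alpha>\<beta>[OF zz(1)] \<alpha>_eq dvd_mult[of p _ 9] by (metis distrib_left right_diff_distrib)
  moreover have sq: "9 * (\<alpha> * \<alpha>) = p * (p - 2) + 1" unfolding p by (simp add: algebra_simps)
  ultimately have "p dvd (9 * W - 1) + p * (2 - p) \<or> p dvd (9 * W + 1) + p * (p - 2)"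
    unfolding sq by (simp add: algebra_simps)
  hence "p dvd 9 * W - 1 \<or> p dvd 9 * W + 1" by (simp only: dvd_add_left_iff dvd_triv_left)
  moreover have "9 * W = p * 3 - 3 \<or> 9 * W = p * 3 + 3" using W3 by auto
  ultimately have "\<exists>m\<in>{2,4,-2,-4}. p dvd p * 3 + m" by (auto simp: add.commute)
  hence "\<exists>m\<in>{2,4,-2,-4::int}. p dvd m" by (simp add: dvd_add_right_iff)
  thus False using p_ge zdvd_imp_le[of p 2] zdvd_imp_le[of p 4] by auto
qed

end

section \<open>Excluding tight configurations\<close>

context tight_configuration begin

text \<open>
  Compared with the passage from \<open>u\<close> to \<open>u + 2\<close>, the relation has \<open>Y, Z \<in> {0, -1}\<close>.  The size of \<open>W\<close>
  excludes equal values, so exactly one of \<open>B\<close> and \<open>C\<close> behaves as in the passage from \<open>u\<close>, and the other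
  one changes as in twice the passage from \<open>x\<close>.
\<close>

lemma K_K_at_2_cases:
  assumes zz: "x \<in> T" "x + 1 \<in> K" "u \<in> K" "u + 2 \<in> T" and y: "y \<in> K" "y + 2 \<in> K"
  defines "W \<equiv> p - (A (x + 1) - A x)"
  shows "A (y + 2) - A y = p - 2 * W"
    and "B (y + 2) - B y = 2 * (B (x + 1) - B x) \<and> 0 < C (y + 2) - C y
      \<or> C (y + 2) - C y = 2 * (C (x + 1) - C x) \<and> 0 < B (y + 2) - B y"
proof -
  note z = zigzag[OF zz, folded W_def]
  obtain X Y Z where XYZ: "1 * (A (y + 2) - A y) - 1 * (A (u + 2) - A u) = p * X"
    "1 * (B (y + 2) - B y) - 1 * (B (u + 2) - B u) = q * Y"
    "1 * (C (y + 2) - C y) - 1 * (C (u + 2) - C u) = r * Z" "X + Y + Z = 0"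
    by (rule parallel[of y "y + 2" u "u + 2" 1 1]) (use y zz in auto)
  have ex: "0 < b" "2 * b < v + 2 * e" if "0 \<le> d" "2 * d < v" "- e \<le> h" "h < 0" "b = d - h" for b d e h v :: int
    using that by auto
  have range: "n = 0 \<or> n = -1"
    if "f - b = v * n" "- e < f" "f < e" "3 * e < v" "0 < b" "2 * b < v + 2 * e" for f b v n e :: int
  proof -
    have v: "v > 0" and "v * n < v" "- (2 * v) < v * n" using that by (smt (verit))+
    hence "v * n < v * 1" "v * (-2) < v * n" by simp_all
    hence "n < 1" "-2 < n" using v by (simp_all only: mult_less_cancel_left_pos)
    thus ?thesis by auto
  qed
  have bu: "0 < B (u + 2) - B u" "2 * (B (u + 2) - B u) < q + 2 * a\<^sub>1"
    using ex[of "B (u + 2)" q a\<^sub>1 "B u" "B (u + 2) - B u"] T_B[OF zz(4)] K_B[OF zz(3)] by auto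
  have cu: "0 < C (u + 2) - C u" "2 * (C (u + 2) - C u) < r + 2 * b\<^sub>1"
    using ex[of "C (u + 2)" r b\<^sub>1 "C u" "C (u + 2) - C u"] T_C[OF zz(4)] K_C[OF zz(3)] by auto
  have Y: "Y = 0 \<or> Y = -1"
    using range[of "B (y + 2) - B y" "B (u + 2) - B u" q Y a\<^sub>1] XYZ(2) K_diff(1)[OF y] K_diff(1)[OF y(2,1)] a1_3 bu by auto
  have Z: "Z = 0 \<or> Z = -1"
    using range[of "C (y + 2) - C y" "C (u + 2) - C u" r Z b\<^sub>1] XYZ(3) K_diff(2)[OF y] K_diff(2)[OF y(2,1)] b1_3 cu by auto
  have A1: "A (y + 2) - A y = p * X - 2 * W" using XYZ(1) z(2) by simp
  have A2: "A (y + 2) - A y < 2 * \<alpha>" "A y - A (y + 2) < 2 * \<alpha>" using K_diff(3)[OF y] K_diff(3)[OF y(2,1)] \<alpha>_eq by auto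
  have "X \<noteq> 0"
  proof
    assume "X = 0" thus False using A1 A2 z(8) by simp
  qed
  moreover have "X \<noteq> 2"
  proof
    assume "X = 2" thus False using A1 A2 z(9) \<alpha>_eq by simp
  qed
  ultimately have "X = 1 \<and> (Y = -1 \<and> Z = 0 \<or> Y = 0 \<and> Z = -1)" using Y Z XYZ(4) by auto
  thus "A (y + 2) - A y = p - 2 * W" and "B (y + 2) - B y = 2 * (B (x + 1) - B x) \<and> 0 < C (y + 2) - C y
      \<or> C (y + 2) - C y = 2 * (C (x + 1) - C x) \<and> 0 < B (y + 2) - B y"
    using A1 XYZ(2,3) z(3,4) bu cu by auto
qed

text \<open>
  The descent of \<open>B\<close> from \<open>y\<close> to \<open>y + 2\<close> is so steep that three positions of \<open>K\<close> spaced by 2 do not fit.  Hence the pattern is forced to be \<open>T\<close>, \<open>K\<close>, \<open>K\<close> at offsets 0, 1, 3 and to repeat with period 5.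
  Then \<open>T_translation\<close> expresses \<open>p\<close> and \<open>W\<close> by \<open>\<alpha>\<close>, and \<open>W \<equiv> \<plusminus>\<alpha>\<^sup>2\<close> modulo \<open>p\<close> leaves only \<open>p = 7\<close>.
\<close>

lemma K_K_at_2_False:
  assumes zz: "x \<in> T" "x + 1 \<in> K" "u \<in> K" "u + 2 \<in> T" and y: "y \<in> K" "y + 2 \<in> K"
    and f: "B (y + 2) - B y = 2 * (B (x + 1) - B x)" and g: "0 < C (y + 2) - C y"
  shows False
proof -
  define W where "W = p - (A (x + 1) - A x)"
  define e where "e = B x - B (x + 1)"
  note z = zigzag[OF zz, folded W_def] and cases = K_K_at_2_cases(1)[OF zz, folded W_def]
  have e: "0 < e" "B (y + 2) - B y = - (2 * e)" using T_B(1)[OF zz(1)] K_B(2)[OF zz(2)] f unfolding e_def by auto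
  have W': "A (y + 2) - A y = p - 2 * W" using cases y by blast
  have pe: "p * (2 * e) \<le> \<alpha> * q + 1 - p"
  proof -
    have "p * (2 * e) \<le> p * (a\<^sub>1 - 1)" using K_diff(1)[OF y(2,1)] e(2) pqr_pos by (intro mult_left_mono) auto
    thus ?thesis using a1 by (simp add: algebra_simps)
  qed
  have R: "(p - 2 * W) * (q * r) = p * (2 * e) * r - (C (y + 2) - C y) * (p * q) - 2 * s"
    using rel_diff[of y "y + 2"] y unfolding W' e(2) by (simp add: algebra_simps)
  have gpq: "2 < (C (y + 2) - C y) * (p * q)"
  proof -
    have "1 * (7 * 4) \<le> (C (y + 2) - C y) * (p * q)" using g p_ge q_gt by (intro mult_mono) auto
    thus ?thesis by simp
  qed
  have "(p - 2 * W) * (q * r) < \<alpha> * (q * r)"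
  proof -
    have "p * (2 * e) * r \<le> (\<alpha> * q + 1 - p) * r" using pe pqr_pos by (intro mult_right_mono) auto
    also have "\<dots> = \<alpha> * (q * r) - (p - 1) * r" by (simp add: algebra_simps)
    also have "\<dots> \<le> \<alpha> * (q * r)" using p_ge r_gt by simp
    finally show ?thesis using R gpq sign by auto
  qed
  hence W'_less: "p - 2 * W < \<alpha>" using pqr_pos by simp
  \<comment> \<open>Every point of \<open>T\<close> except possibly the one at position 0 is reached from \<open>K\<close> two positions earlier.\<close>
  have small: "A k < p - 2 * W" if "k \<in> T" "k \<noteq> 0" for k
  proof -
    have K: "k - 2 \<in> K" using T_pred[OF zz that] .
    moreover have "k - 2 + 2 \<in> T" using that by simp
    ultimately have "A (k - 2 + 2) = A (k - 2) - 2 * W" using z(6) by blast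
    thus ?thesis using K_A_less[OF K] by simp
  qed
  \<comment> \<open>As all of \<open>{0..<\<alpha>}\<close> is attained, the largest value sits at position 0, which determines \<open>W\<close>.\<close>
  have "\<alpha> - 1 \<in> A ` T" "\<alpha> - 2 \<in> A ` T" using A_T \<alpha>_ge by auto
  then obtain k1 k2 where k12: "k1 \<in> T" "A k1 = \<alpha> - 1" "k2 \<in> T" "A k2 = \<alpha> - 2" by (metis imageE)
  have "k1 = 0" using small[OF k12(1)] k12(2) W'_less by auto
  hence zero: "0 \<in> T" "A 0 = \<alpha> - 1" using k12 by auto
  have "k2 \<noteq> 0" using k12 zero by auto
  hence 2: "2 * W = p - \<alpha> + 1" using small[OF k12(3)] k12(4) W'_less by auto
  have steep: "(\<alpha> - 1) * q < p * (2 * e)"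
  proof -
    have "p * (2 * e) * r = (\<alpha> - 1) * (q * r) + (C (y + 2) - C y) * (p * q) + 2 * s" using R 2 by simp
    hence "(\<alpha> - 1) * q * r < p * (2 * e) * r" using gpq sign by auto
    thus ?thesis using pqr_pos by simp
  qed
  have same: "B (k + 2) - B k = - (2 * e)" if k: "k \<in> K" "k + 2 \<in> K" for k
  proof -
    obtain X Y Z where XYZ: "1 * (A (k + 2) - A k) - 1 * (A (y + 2) - A y) = p * X"
      "1 * (B (k + 2) - B k) - 1 * (B (y + 2) - B y) = q * Y"
      "1 * (C (k + 2) - C k) - 1 * (C (y + 2) - C y) = r * Z" "X + Y + Z = 0"
      by (rule parallel[of k "k + 2" y "y + 2" 1 1]) (use y k in auto)
    have "\<bar>q * Y\<bar> < q" using XYZ(2) K_diff(1)[OF k] K_diff(1)[OF k(2,1)] K_diff(1)[OF y] K_diff(1)[OF y(2,1)] a1_3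
      by auto
    hence "q * Y = 0" using dvd_imp_le_int[of "q * Y" q] pqr_pos by auto
    thus ?thesis using XYZ(2) e(2) pqr_pos by simp
  qed
  have KKK: False if k: "k \<in> K" "k + 2 \<in> K" "k + 2 + 2 \<in> K" for k
  proof -
    have "B (k + 2 + 2) - B k = - (4 * e)" using same[OF k(1,2)] same[OF k(2,3)] by simp
    hence "4 * e \<le> a\<^sub>1 - 1" using K_diff(1)[OF k(3,1)] by simp
    hence "p * (4 * e) \<le> p * (a\<^sub>1 - 1)" using pqr_pos by (intro mult_left_mono) auto
    hence "2 * (p * (2 * e)) \<le> \<alpha> * q + 1 - p" using a1 by (simp add: algebra_simps)
    hence "2 * ((\<alpha> - 1) * q) < \<alpha> * q" using steep p_ge by simp
    hence "(\<alpha> - 2) * q < 0" by (simp add: algebra_simps)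
    thus False using \<alpha>_ge pqr_pos by (simp add: mult_less_0_iff)
  qed
  have TT: False if k: "k \<in> T" "k + 3 \<in> T" for k
  proof -
    obtain X Y Z where XYZ: "1 * (A (k + 3) - A k) - 3 * (A (x + 1) - A x) = p * X"
      "1 * (B (k + 3) - B k) - 3 * (B (x + 1) - B x) = q * Y"
      "1 * (C (k + 3) - C k) - 3 * (C (x + 1) - C x) = r * Z" "X + Y + Z = 0"
      by (rule parallel[of k "k + 3" x "x + 1" 1 3]) (use zz k in auto)
    have "B (k + 3) - B k + 3 * e < q"
    proof -
      have "6 * e < q" using K_diff(1)[OF y(2,1)] e a1_3 by simp
      thus ?thesis using T_B[OF k(1)] T_B[OF k(2)] by simp
    qed
    hence "q * Y < q * 1" using XYZ(2) unfolding e_def by simp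
    hence "Y < 1" using pqr_pos by (simp only: mult_less_cancel_left_pos)
    moreover have "2 * (C x - C (x + 1)) < r" using z(4) T_C(1)[OF zz(4)] K_C(2)[OF zz(3)] by auto
    hence "r * Z < 2 * r" using XYZ(3) T_C[OF k(1)] T_C[OF k(2)] by (smt (verit))
    hence "r * Z < r * 2" by (simp only: mult.commute)
    hence "Z < 2" using pqr_pos by (simp only: mult_less_cancel_left_pos)
    ultimately have "-1 \<le> X" using XYZ(4) by auto
    hence "p * -1 \<le> p * X" using pqr_pos by (intro mult_left_mono) auto
    hence "2 * p - 3 * W \<le> A (k + 3) - A k" using XYZ(1) unfolding W_def by simp
    thus False using 2 T_A[OF k(1)] T_A[OF k(2)] \<alpha>\<beta> p_ge by auto
  qed
  \<comment> \<open>The period breaks off only at the end of the window, for at most one point of \<open>T\<close>.\<close>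
  have p2: "p - 4 \<in> T \<Longrightarrow> p - 2 \<notin> T"
  proof
    assume "p - 4 \<in> T" "p - 2 \<in> T"
    moreover from this(1) have "p - 4 + 1 \<in> K" using z(11) by blast
    ultimately show False using no_KT[of "p - 4 + 1"] by simp
  qed
  have "p - 3 * W + (p - 2 * W) = 1 \<or> p - 3 * W + (p - 2 * W) = -1"
  proof (rule T_translation[of "T \<inter> {p - 2, p - 4}" 5])
    have "card (T \<inter> {p - 2, p - 4}) \<le> card {p - 2} \<or> card (T \<inter> {p - 2, p - 4}) \<le> card {p - 4}"
      using p2 card_mono[of "{p - 2}" "T \<inter> {p - 2, p - 4}"] card_mono[of "{p - 4}" "T \<inter> {p - 2, p - 4}"] by auto
    thus "card (T \<inter> {p - 2, p - 4}) \<le> 1" by simp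
    fix k assume k: "k \<in> T - T \<inter> {p - 2, p - 4}"
    hence k1: "k + 1 \<in> K" "k + 1 \<noteq> p - 1" using z(11) by auto
    have "k + 1 + 2 = k + 3" by simp
    hence "k + 1 + 2 \<notin> T" using TT[of k] k by (metis DiffD1)
    hence k3: "k + 1 + 2 \<in> K" "k + 1 + 2 \<noteq> p - 1" using K_succ(2)[OF k1] k by auto
    have "k + 1 + 2 + 2 \<notin> K" using KKK[of "k + 1"] k1 k3 by blast
    hence k5: "k + 1 + 2 + 2 \<in> T" using K_succ(2)[OF k3] by blast
    have "A (k + 1 + 2 + 2) = A k + (p - 3 * W + (p - 2 * W))"
      using z(5)[of k] k k1(1) cases[OF k1(1) k3(1)] z(6)[OF k3(1) k5] by simp
    moreover have "k + 1 + 2 + 2 = k + 5" by simp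
    ultimately show "k + 5 \<in> T \<and> A (k + 5) = A k + (p - 3 * W + (p - 2 * W))" using k5 by metis
  qed auto
  hence p5: "5 * \<alpha> = p + 3 \<or> 5 * \<alpha> = p + 7" using 2 by auto
  \<comment> \<open>With \<open>2 W = p - \<alpha> + 1\<close>, the factor 50 makes everything a polynomial in \<open>5 \<alpha>\<close>.\<close>
  have "p dvd 50 * W - 2 * (5 * \<alpha>) * (5 * \<alpha>) \<or> p dvd 50 * W + 2 * (5 * \<alpha>) * (5 * \<alpha>)"
    using step_\<alpha>\<beta>[OF z(1)] \<alpha>_eq dvd_mult[of p "W - \<alpha> * \<alpha>" 50] dvd_mult[of p "W + \<alpha> * \<alpha>" 50]
    by (auto simp: algebra_simps)
  moreover have "50 * W = 25 * p - 5 * (5 * \<alpha>) + 25" using 2 by simp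
  ultimately have d: "p dvd (25 * p - 5 * (5 * \<alpha>) + 25) - 2 * (5 * \<alpha>) * (5 * \<alpha>) \<or> p dvd (25 * p - 5 * (5 * \<alpha>) + 25) + 2 * (5 * \<alpha>) * (5 * \<alpha>)"
    by simp
  have p7: "p = 7"
  proof (cases "5 * \<alpha> = p + 3")
    case True
    have "p dvd p * (20 - 2 * p - 12) + - 8 \<or> p dvd p * (20 + 2 * p + 12) + 28"
      using d unfolding True by (simp add: algebra_simps)
    hence "p dvd 2 ^ 3 \<or> p dvd 2 ^ 2 * 7" by (simp only: dvd_add_right_iff dvd_triv_left) simp
    hence "p dvd 1 \<or> p dvd 7" using odd_p
      by (metis coprime_dvd_mult_right_iff coprime_power_right_iff coprime_right_2_iff_odd mult.right_neutral)
    thus ?thesis using p_ge zdvd_imp_le[of p 1] zdvd_imp_le[of p 7] by auto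
  next
    case False
    hence F: "5 * \<alpha> = p + 7" using p5 by blast
    have "p dvd p * (20 - 2 * p - 28) + - 108 \<or> p dvd p * (20 + 2 * p + 28) + 88"
      using d unfolding F by (simp add: algebra_simps)
    hence "p dvd 2 ^ 2 * 27 \<or> p dvd 2 ^ 3 * 11" by (simp only: dvd_add_right_iff dvd_triv_left) simp
    hence "p dvd 27 \<or> p dvd 11" using odd_p
      by (metis coprime_dvd_mult_right_iff coprime_power_right_iff coprime_right_2_iff_odd mult.right_neutral)
    hence dd: "p dvd 27 \<or> p dvd 11" .
    hence "p \<le> 27" using zdvd_imp_le[of p 27] zdvd_imp_le[of p 11] by auto
    hence "\<alpha> \<in> {2..6}" using F \<alpha>_ge by auto
    hence "\<alpha> \<in> {2,3,4,5,6}" by auto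
    hence "p \<in> {3, 8, 13, 18, 23}" using F by auto
    thus ?thesis using dd p_ge by auto
  qed
  hence \<alpha>2: "\<alpha> = 2" using p5 by auto
  have y2: "A (y + 2) - A y = 1" using W' 2 \<alpha>2 by simp
  have l: "6 \<in> K" using last_in p7 by simp
  \<comment> \<open>For \<open>p = 7\<close> the window runs from a point of \<open>T\<close> to one of \<open>K\<close>, in three times the stride from \<open>y\<close> to \<open>y + 2\<close>.\<close>
  obtain X Y Z where XYZ: "1 * (A 6 - A 0) - 3 * (A (y + 2) - A y) = p * X"
      "1 * (B 6 - B 0) - 3 * (B (y + 2) - B y) = q * Y"
      "1 * (C 6 - C 0) - 3 * (C (y + 2) - C y) = r * Z" "X + Y + Z = 0"
    by (rule parallel[of 0 6 y "y + 2" 1 3]) (use zero l y in auto)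
  have "X = 0" using XYZ(1) y2 K_A(1)[OF l] K_A_less[OF l] zero(2) \<alpha>2 \<alpha>_eq p7 by auto
  have b: "0 \<le> B 0" "2 * B 0 < q" "- a\<^sub>1 \<le> B 6" "B 6 < 0" using T_B[OF zero(1)] K_B[OF l] by auto
  have "B 6 - B 0 + 6 * e = q * Y" using XYZ(2) e(2) by simp
  moreover have "q < 14 * e" "14 * e < 2 * q" using steep pe unfolding p7 \<alpha>2 by auto
  ultimately have "\<bar>q * Y\<bar> < q" using b a1_3 by auto
  hence "q * Y = 0" using dvd_imp_le_int[of "q * Y" q] pqr_pos by auto
  hence "Z = 0" using \<open>X = 0\<close> XYZ(4) pqr_pos by auto
  thus False using XYZ(3) g T_C(1)[OF zero(1)] K_C(2)[OF l] by auto
qed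

end

text \<open>
  The equality \<open>\<alpha> = \<beta>\<close> makes tight configurations symmetric in \<open>q\<close> and \<open>r\<close>.
\<close>

lemma (in tight_configuration) swapped:
  "tight_configuration p r q \<beta> \<alpha> b\<^sub>1 a\<^sub>1 s c T K A C B"
proof unfold_locales
  show "[\<beta> * \<alpha> * r * q = 1] (mod p) \<or> [\<beta> * \<alpha> * r * q = -1] (mod p)"
    using inv by (simp add: mult.commute mult.left_commute)
  show "\<not> [r * q = 1] (mod p)" "\<not> [r * q = -1] (mod p)" using nondeg by (simp_all add: mult.commute)
  show "coprime r q" using cop by (simp add: coprime_commute)
  show "1 \<le> \<beta>" "\<beta> \<le> \<alpha>" "2 * \<alpha> < p" "3 * \<alpha> < p" "p < 4 * \<beta> + \<alpha>" "p + \<alpha> + 1 \<le> 2 * num" using \<alpha>\<beta> \<alpha>_eq big by auto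
  show "\<And>k. k \<in> T \<union> K \<Longrightarrow> A k * (r * q) + C k * (p * q) + B k * (p * r) = c - s * k"
    using rel by (simp add: algebra_simps)
  show "\<And>k. k \<in> K \<Longrightarrow> \<beta> + \<alpha> \<le> A k" "\<And>k. k \<in> K \<Longrightarrow> 2 * A k < p - 1 + 2 * \<beta> + 2 * \<alpha>"
    using K_A by (simp_all add: add.commute add.left_commute)
  show "\<And>k. k \<in> T \<Longrightarrow> A k < \<beta>" using T_A(2) \<alpha>_eq by simp
qed (fact odd_p q_gt r_gt cop sign a1 b1 T_sub K_sub T_A T_B T_C K_B K_C no_KK no_KT)+

lemma (in tight_configuration) tight_configuration_False: False
proof -
  obtain x where x: "x \<in> T" "x + 1 \<in> K" using T_K_exists by blast
  obtain u where u: "u \<in> K" "u + 2 \<in> T" using K_T_at_2_exists by blast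
  obtain y where y: "y \<in> K" "y + 2 \<in> K" using K_K_at_2_exists by blast
  interpret sw: tight_configuration p r q \<beta> \<alpha> b\<^sub>1 a\<^sub>1 s c T K A C B by (rule swapped)
  show False using K_K_at_2_cases(2)[OF x u y] K_K_at_2_False[OF x u y] sw.K_K_at_2_False[OF x u y] by blast
qed

lemma (in configuration) isolated_K_False:
  assumes "p + \<beta> + 1 \<le> 2 * num" "\<And>k. k \<in> K \<Longrightarrow> k + 1 \<notin> K" "\<And>k. k \<in> K \<Longrightarrow> k + 1 \<notin> T"
  shows False
proof -
  interpret tight_configuration p q r \<alpha> \<beta> a\<^sub>1 b\<^sub>1 s c T K A B C
    by unfold_locales (fact assms)+
  show False by (rule tight_configuration_False)
qed

context configuration begin

text \<open>
  If neither \<open>B\<close> nor \<open>C\<close> increased, a positive multiple of \<open>q r\<close> would be at most \<open>1\<close>.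
\<close>

lemma descending_neighbours_False:
  assumes big: "p + \<beta> + 1 \<le> 2 * num" and kl: "k \<in> K" "l \<in> K" "l = k + 1" and W_pos: "0 < A k - A l"
  shows False
proof (cases "B l - B k \<le> 0 \<and> C l - C k \<le> 0")
  case True
  have "(B l - B k) * (p * r) \<le> 0" "(C l - C k) * (p * q) \<le> 0"
    using True pqr_pos by (auto intro!: mult_nonpos_nonneg)
  hence "(A k - A l) * (q * r) \<le> 1" using step_of_neighbours(1)[OF kl] sign by auto
  moreover have "1 * (4 * 4) \<le> (A k - A l) * (q * r)" using W_pos q_gt r_gt by (intro mult_mono) auto
  ultimately show False by simp
next
  case False
  thus ?thesis
    using monotone_neighbours_False[OF big kl] opposite_neighbours_False[OF big kl W_pos] by linarith
qed

text \<open>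
  Reading the window backwards if necessary, adjacent positions \<open>k\<close>, \<open>k + 1\<close> of \<open>K\<close> have \<open>A\<close> descending;
  without such positions, \<open>no_alternation\<close> allows one to assume that \<open>T\<close> never follows \<open>K\<close> immediately.
\<close>

lemma configuration_num_bound: "2 * num \<le> p + \<beta>"
proof (rule ccontr)
  assume "\<not> ?thesis"
  hence big: "p + \<beta> + 1 \<le> 2 * num" by simp
  interpret rev: configuration p q r \<alpha> \<beta> a\<^sub>1 b\<^sub>1 "- s" "c - s * (p - 1)" "(\<lambda>k. p - 1 - k) ` T" "(\<lambda>k. p - 1 - k) ` K"
     "\<lambda>k. A (p - 1 - k)" "\<lambda>k. B (p - 1 - k)" "\<lambda>k. C (p - 1 - k)" by (rule reversed)
  have rbig: "p + \<beta> + 1 \<le> 2 * (int (card ((\<lambda>k. p - 1 - k) ` T)) + int (card ((\<lambda>k. p - 1 - k) ` K)))"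
    using big by (simp only: card_reversed)
  have mirror: "k \<in> (\<lambda>k. p - 1 - k) ` S \<longleftrightarrow> p - 1 - k \<in> S" for k S by force
  have no_KK: "k + 1 \<notin> K" if k: "k \<in> K" for k
  proof
    assume l: "k + 1 \<in> K"
    show False
    proof (cases "A k - A (k + 1)" "0::int" rule: linorder_cases)
      case greater
      thus ?thesis using descending_neighbours_False[OF big k l] by simp
    next
      case equal
      thus ?thesis using step_not_0[OF step_of_neighbours(2)[OF k l refl]] by simp
    next
      case less
      show ?thesis
      proof (rule rev.descending_neighbours_False[OF rbig])
        show "p - 1 - (k + 1) \<in> (\<lambda>k. p - 1 - k) ` K" "p - 1 - k \<in> (\<lambda>k. p - 1 - k) ` K"
          using k l by (blast intro: imageI)+
        have "p - 1 - (p - 1 - (k + 1)) = k + 1" "p - 1 - (p - 1 - k) = k" by simp_all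
        thus "0 < A (p - 1 - (p - 1 - (k + 1))) - A (p - 1 - (p - 1 - k))"
          using less by (metis minus_diff_eq neg_0_less_iff_less)
      qed simp
    qed
  qed
  show False
  proof (cases "\<exists>k\<in>K. k + 1 \<in> T")
    case False
    thus ?thesis using isolated_K_False[OF big no_KK] by blast
  next
    case True
    then obtain v where v: "v \<in> K" "v + 1 \<in> T" by blast
    show ?thesis
    proof (rule rev.isolated_K_False[OF rbig])
      fix k assume "k \<in> (\<lambda>k. p - 1 - k) ` K"
      hence k: "p - 1 - k \<in> K" by (simp only: mirror)
      have eq: "p - 1 - (k + 1) + 1 = p - 1 - k" by simp
      have "p - 1 - (k + 1) \<notin> K" using no_KK[of "p - 1 - (k + 1)"] k eq by metis
      thus "k + 1 \<notin> (\<lambda>k. p - 1 - k) ` K" by (simp only: mirror not_False_eq_True)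
      have "p - 1 - (k + 1) \<notin> T"
        using no_alternation[OF big, of "p - 1 - (k + 1)" "p - 1 - k" "v + 1" v, OF _ k eq[symmetric] v(2,1) refl]
        by blast
      thus "k + 1 \<notin> (\<lambda>k. p - 1 - k) ` T" by (simp only: mirror not_False_eq_True)
    qed
  qed
qed

end

section \<open>The bound for all parameters\<close>

context arrangement begin

text \<open>
  Modulo \<open>p\<close> the values of \<open>A\<close> avoid the classes from \<open>\<alpha>\<close> to \<open>\<alpha> + \<beta> - 1\<close>, because those of \<open>K\<close> stay below
  \<open>p + \<alpha>\<close>.
\<close>

lemma num_bound_large: "num \<le> p - \<beta>"
proof -
  let ?f = "\<lambda>k. A k mod p"
  have inj: "inj_on ?f (T \<union> K)"
  proof (rule inj_onI)
    fix k l assume kl: "k \<in> T \<union> K" "l \<in> T \<union> K" "A k mod p = A l mod p"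
    hence "p dvd A l - A k" by (metis mod_eq_dvd_iff)
    thus "k = l" using inj_residue kl by metis
  qed
  have "?f ` (T \<union> K) \<subseteq> {0..<\<alpha>} \<union> {\<alpha> + \<beta>..<p}"
  proof (intro image_subsetI)
    fix k assume "k \<in> T \<union> K"
    thus "?f k \<in> {0..<\<alpha>} \<union> {\<alpha> + \<beta>..<p}"
    proof
      assume "k \<in> T"
      thus ?thesis using T_A[of k] \<alpha>\<beta>_base by (auto simp: mod_pos_pos_trivial)
    next
      assume k: "k \<in> K"
      show ?thesis
      proof (cases "A k < p")
        case True
        thus ?thesis using K_A[OF k] \<alpha>\<beta>_base by (auto simp: mod_pos_pos_trivial)
      next
        case False
        have "2 * (A k - p) < 2 * \<alpha>" using K_A(2)[OF k] \<alpha>\<beta>_base by auto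
        hence 1: "0 \<le> A k - p" "A k - p < \<alpha>" using False by auto
        hence "(A k - p) mod p = A k - p" using \<alpha>\<beta>_base by (intro mod_pos_pos_trivial) auto
        thus ?thesis using 1 by simp
      qed
    qed
  qed
  hence "card (?f ` (T \<union> K)) \<le> card ({0..<\<alpha>} \<union> {\<alpha> + \<beta>..<p})" by (intro card_mono) auto
  also have "\<dots> \<le> card {0..<\<alpha>} + card {\<alpha> + \<beta>..<p}" by (rule card_Un_le)
  finally have "int (card (?f ` (T \<union> K))) \<le> p - \<beta>" using \<alpha>\<beta>_base by simp
  thus ?thesis using card_image[OF inj] finT finK disjoint by (simp add: card_Un_disjoint)
qed

text \<open>
  The values of \<open>A\<close> on \<open>T\<close> lie in an interval of length \<open>\<alpha>\<close>, those on \<open>K\<close> in one of length \<open>\<alpha> + \<beta>\<close>.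
\<close>

lemma num_bound_spread: "num \<le> 2 * \<alpha> + \<beta>"
proof -
  have "A ` T \<subseteq> {0..<\<alpha>}" using T_A by auto
  hence T: "int (card T) \<le> \<alpha>"
    using card_int_subset_atLeastLessThan[of "A ` T" 0 \<alpha>] card_image_A[of T] \<alpha>\<beta>_base by simp
  have "int (card K) \<le> \<alpha> + \<beta>"
  proof (cases "K = {}")
    case False
    define u where "u = Min (A ` K)"
    have u: "u \<in> A ` K" "\<And>k. k \<in> K \<Longrightarrow> u \<le> A k" using False finK unfolding u_def by auto
    then obtain k where k: "k \<in> K" "u = A k" by blast
    have "A ` K \<subseteq> {u..<u + (\<alpha> + \<beta>)}" using u(2) K_diff(3)[OF k(1)] k(2) by force
    thus ?thesis
      using card_int_subset_atLeastLessThan[of "A ` K" u "u + (\<alpha> + \<beta>)"] card_image_A[of K] \<alpha>\<beta>_base by simp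
  qed (use \<alpha>\<beta>_base in simp)
  thus ?thesis using T by simp
qed

lemma num_bound:
  assumes "3 * \<beta> < p \<Longrightarrow> \<not> [q * r = 1] (mod p) \<and> \<not> [q * r = -1] (mod p)"
  shows "2 * num \<le> p + \<beta>"
proof -
  consider "p \<le> 3 * \<beta>" | "4 * \<alpha> + \<beta> \<le> p" | "3 * \<beta> < p" "p < 4 * \<alpha> + \<beta>" by linarith
  thus ?thesis
  proof cases
    case 1
    thus ?thesis using num_bound_large by simp
  next
    case 2
    thus ?thesis using num_bound_spread by simp
  next
    case 3
    interpret configuration p q r \<alpha> \<beta> a\<^sub>1 b\<^sub>1 s c T K A B C
      by unfold_locales (use 3 assms in blast)+
    show ?thesis by (rule configuration_num_bound)
  qed
qed

end

section \<open>From coefficients to arrangements\<close>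

text \<open>
  The index \<open>n\<close> lies in the lower half of the coefficients, and \<open>e\<^sub>1\<close>, \<open>e\<^sub>2\<close> are the signs in
  \<open>\<alpha> q = p a \<plusminus> 1\<close> and \<open>\<beta> r = p b \<plusminus> 1\<close>.
\<close>

locale coefficient_window = moduli +
  fixes \<alpha> \<beta> a b e\<^sub>1 e\<^sub>2 n :: int
  assumes odd_p: "odd p" and q_gt: "q > 4" and r_gt: "r > 4"
    and cop: "coprime p q" "coprime p r" "coprime q r"
    and \<alpha>\<beta>: "1 \<le> \<alpha>" "\<alpha> \<le> \<beta>" "2 * \<beta> < p"
    and a: "\<alpha> * q = p * a + e\<^sub>1" and b: "\<beta> * r = p * b + e\<^sub>2"
    and e: "e\<^sub>1 = 1 \<or> e\<^sub>1 = -1" "e\<^sub>2 = 1 \<or> e\<^sub>2 = -1"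
    and inv: "[\<alpha> * \<beta> * q * r = 1] (mod p) \<or> [\<alpha> * \<beta> * q * r = -1] (mod p)"
    and nondeg: "3 * \<beta> < p \<Longrightarrow> \<not> [q * r = 1] (mod p) \<and> \<not> [q * r = -1] (mod p)"
    and n: "2 * n \<le> (p - 1) * (q - 1) * (r - 1)"
begin

text \<open>
  Shifting the window by \<open>q\<close> or \<open>r\<close> when the corresponding sign is negative replaces the shifts \<open>q\<close> and
  \<open>r\<close> by \<open>e\<^sub>2 q\<close> and \<open>e\<^sub>1 r\<close>, at the cost of the sign \<open>e\<^sub>1 e\<^sub>2\<close>; this unifies the four sign patterns.
\<close>

definition \<nu> :: int where
  "\<nu> = n - (if e\<^sub>2 = 1 then 0 else q) - (if e\<^sub>1 = 1 then 0 else r)"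

definition weight :: "int \<Rightarrow> int" where
  "weight m = N m - N (m - e\<^sub>2 * q) - N (m - e\<^sub>1 * r) + N (m - e\<^sub>2 * q - e\<^sub>1 * r)"

lemma summand_eq_weight:
  "N (n - k) - N (n - k - q) - N (n - k - r) + N (n - k - q - r) = e\<^sub>1 * e\<^sub>2 * weight (\<nu> - k)"
  using e unfolding weight_def \<nu>_def by (elim disjE) (simp_all add: algebra_simps)

definition T_points :: "int \<Rightarrow> (int \<times> int \<times> int) set" where
  "T_points = fibre ({0..<\<alpha>} \<times> {0..} \<times> {0..})"
definition K_points :: "int \<Rightarrow> (int \<times> int \<times> int) set" where
  "K_points = fibre ({\<alpha> + \<beta>..} \<times> {- a..<0} \<times> {- b..<0})"
definition M_points :: "int \<Rightarrow> (int \<times> int \<times> int) set" where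
  "M_points = fibre {(A, B, C). \<alpha> \<le> A \<and> A < \<alpha> + \<beta> \<and> - a \<le> B \<and> - b \<le> C \<and> (0 \<le> C \<or> \<beta> \<le> A \<and> 0 \<le> B)}"

lemma ab_small: "0 \<le> a" "2 * a < q" "0 \<le> b" "2 * b < r"
proof -
  have *: "0 \<le> x \<and> 2 * x < u" if x: "\<gamma> * u = p * x + e" and h: "e = 1 \<or> e = -1" "u > 4" "1 \<le> \<gamma>" "2 * \<gamma> < p" for \<gamma> u x e :: int
  proof
    have "1 * u \<le> \<gamma> * u" using h by (intro mult_right_mono) auto
    hence "0 < p * x" using x h by auto
    thus "0 \<le> x" using moduli_pos by (simp add: zero_less_mult_iff)
    have "2 * \<gamma> * u \<le> (p - 1) * u" using h by (intro mult_right_mono) auto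
    hence "2 * (\<gamma> * u) \<le> p * u - u" by (simp add: algebra_simps)
    hence "2 * (p * x) < p * u" using x h(1,2) by (smt (verit))
    hence "p * (2 * x) < p * u" by simp
    thus "2 * x < u" using moduli_pos by (simp only: mult_less_cancel_left_pos)
  qed
  show "0 \<le> a" "2 * a < q" using *[OF a e(1) q_gt] \<alpha>\<beta> by auto
  show "0 \<le> b" "2 * b < r" using *[OF b e(2) r_gt] \<alpha>\<beta> by auto
qed

lemma val_translations: "val (\<beta>, 0, - b) = e\<^sub>2 * q" "val (\<alpha>, - a, 0) = e\<^sub>1 * r" "val (\<alpha> + \<beta>, - a, - b) = e\<^sub>2 * q + e\<^sub>1 * r"
proof -
  have "val (\<beta>, 0, - b) = (\<beta> * r - p * b) * q" "val (\<alpha>, - a, 0) = (\<alpha> * q - p * a) * r"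
    by (simp_all add: algebra_simps)
  thus 1: "val (\<beta>, 0, - b) = e\<^sub>2 * q" "val (\<alpha>, - a, 0) = e\<^sub>1 * r" using a b by simp_all
  have "val (\<alpha> + \<beta>, - a, - b) = val (\<beta>, 0, - b) + val (\<alpha>, - a, 0)" by (simp add: algebra_simps)
  thus "val (\<alpha> + \<beta>, - a, - b) = e\<^sub>2 * q + e\<^sub>1 * r" unfolding 1 .
qed

text \<open>
  The four counts in the weight are the numbers of points of value \<open>m\<close> in the octants with apex \<open>0\<close>,
  \<open>(\<beta>, 0, -b)\<close>, \<open>(\<alpha>, -a, 0)\<close> and \<open>(\<alpha> + \<beta>, -a, -b)\<close>.  The inequalities hold for each point separately.
\<close>

lemma weight_bounds:
  "weight m \<le> int (card (T_points m)) + int (card (K_points m))" "- int (card (M_points m)) \<le> weight m"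
proof -
  let ?R0 = "fibre (orthant 0 0 0) m" and ?R1 = "fibre (orthant \<beta> 0 (- b)) m"
    and ?R2 = "fibre (orthant \<alpha> (- a) 0) m" and ?R3 = "fibre (orthant (\<alpha> + \<beta>) (- a) (- b)) m"
  let ?U = "?R0 \<union> ?R1 \<union> ?R2 \<union> ?R3"
  have fin: "finite ?U" by (simp add: finite_fibre_orthant)
  have count: "int (card S) = (\<Sum>t\<in>?U. of_bool (t \<in> S))" if "S \<subseteq> ?U" for S
    using that fin by (simp add: sum.If_cases of_bool_def Int_absorb1 flip: Int_def)
  have N0: "N m = int (card ?R0)" using card_fibre_orthant[of 0 0 0 m] by simp
  have N1: "N (m - e\<^sub>2 * q) = int (card ?R1)"
    using card_fibre_orthant[of \<beta> 0 "- b" m] unfolding val_translations by simp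
  have N2: "N (m - e\<^sub>1 * r) = int (card ?R2)"
    using card_fibre_orthant[of \<alpha> "- a" 0 m] unfolding val_translations by simp
  have N3: "N (m - e\<^sub>2 * q - e\<^sub>1 * r) = int (card ?R3)"
    using card_fibre_orthant[of "\<alpha> + \<beta>" "- a" "- b" m] unfolding val_translations by (simp add: diff_diff_add)
  have R: "?R0 \<subseteq> ?U" "?R1 \<subseteq> ?U" "?R2 \<subseteq> ?U" "?R3 \<subseteq> ?U" by blast+
  have w: "weight m = (\<Sum>t\<in>?U. of_bool (t \<in> ?R0) - of_bool (t \<in> ?R1) - of_bool (t \<in> ?R2) + of_bool (t \<in> ?R3))"
    unfolding weight_def N0 N1 N2 N3 sum.distrib sum_subtractf
      count[OF R(1)] count[OF R(2)] count[OF R(3)] count[OF R(4)] by (rule refl)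
  have sub: "T_points m \<subseteq> ?U" "K_points m \<subseteq> ?U" "M_points m \<subseteq> ?U"
    using \<alpha>\<beta> ab_small unfolding T_points_def K_points_def M_points_def fibre_def orthant_def by auto
  have up: "of_bool (t \<in> ?R0) - of_bool (t \<in> ?R1) - of_bool (t \<in> ?R2) + of_bool (t \<in> ?R3)
      \<le> (of_bool (t \<in> T_points m) + of_bool (t \<in> K_points m) :: int)" 
    and low: "- (of_bool (t \<in> M_points m) :: int)
      \<le> of_bool (t \<in> ?R0) - of_bool (t \<in> ?R1) - of_bool (t \<in> ?R2) + of_bool (t \<in> ?R3)" if "t \<in> ?U" for t
  proof -
    obtain A B C where ABC: "t = (A, B, C)" by (cases t)
    have "val (A, B, C) = m" using that unfolding ABC fibre_def by blast
    hence mem: "(A, B, C) \<in> fibre S m \<longleftrightarrow> (A, B, C) \<in> S" for S unfolding fibre_def by blast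
    show "of_bool (t \<in> ?R0) - of_bool (t \<in> ?R1) - of_bool (t \<in> ?R2) + of_bool (t \<in> ?R3)
      \<le> (of_bool (t \<in> T_points m) + of_bool (t \<in> K_points m) :: int)" "- (of_bool (t \<in> M_points m) :: int)
      \<le> of_bool (t \<in> ?R0) - of_bool (t \<in> ?R1) - of_bool (t \<in> ?R2) + of_bool (t \<in> ?R3)"
      using \<alpha>\<beta> ab_small unfolding ABC T_points_def K_points_def M_points_def mem orthant_def
      by (auto simp: of_bool_def split: if_splits)
  qed
  show "weight m \<le> int (card (T_points m)) + int (card (K_points m))"
    unfolding w count[OF sub(1)] count[OF sub(2)] sum.distrib[symmetric] by (intro sum_mono up)
  show "- int (card (M_points m)) \<le> weight m"
    unfolding w count[OF sub(3)] sum_negf[symmetric] by (intro sum_mono low)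
qed

lemma same_val:
  assumes "val (A, B, C) = val (A', B', C')" "- a \<le> B" "2 * B < q" "- a \<le> B'" "2 * B' < q"
  shows "B' = B" "\<bar>A' - A\<bar> < p \<or> \<bar>C' - C\<bar> < r \<Longrightarrow> A' = A \<and> C' = C"
proof -
  have "(A' - A) * (q * r) + (B' - B) * (p * r) + (C' - C) * (p * q) = 0" using assms(1) by (simp add: algebra_simps)
  then obtain X Y Z where XYZ: "A' - A = p * X" "B' - B = q * Y" "C' - C = r * Z" "X + Y + Z = 0"
    using relation_lattice[OF cop moduli_pos] by blast
  have small: "x = 0" if "\<bar>u * x\<bar> < u" for u x :: int
    using that dvd_imp_le_int[of "u * x" u] by (cases "u = 0") auto
  have "\<bar>q * Y\<bar> < q" unfolding XYZ(2)[symmetric] using assms ab_small by auto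
  hence Y: "Y = 0" by (rule small)
  thus "B' = B" using XYZ by simp
  show "A' = A \<and> C' = C" if "\<bar>A' - A\<bar> < p \<or> \<bar>C' - C\<bar> < r"
  proof -
    have "X = 0 \<or> Z = 0" using that unfolding XYZ using small by blast
    thus ?thesis using XYZ Y by auto
  qed
qed

text \<open>
  The index \<open>n\<close> is at most half the degree, which is less than \<open>p q r\<close>.
\<close>

lemma half:
  assumes "u * (p * v) \<le> n" "v * w = q * r" "v > 0"
  shows "2 * u < w"
proof -
  have "(p - 1) * (q - 1) * (r - 1) \<le> p * q * r"
    using moduli_pos by (intro mult_mono) auto
  moreover have "(p - 1) * (q - 1) * (r - 1) \<noteq> p * q * r"
  proof -
    have "(p - 1) * ((q - 1) * (r - 1)) < p * ((q - 1) * (r - 1))"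
      using q_gt r_gt by (intro mult_strict_right_mono mult_pos_pos) auto
    hence "(p - 1) * (q - 1) * (r - 1) < p * ((q - 1) * (r - 1))" by (simp only: mult.assoc)
    also have "\<dots> \<le> p * (q * r)" using moduli_pos by (intro mult_left_mono mult_mono) auto
    finally show ?thesis by simp
  qed
  ultimately have "2 * (u * (p * v)) < p * q * r" using assms(1) n by linarith
  hence "(p * v) * (2 * u) < (p * v) * w" using assms(2) by (simp add: mult_ac)
  thus ?thesis using moduli_pos assms(3) by (simp only: mult_less_cancel_left_pos mult_pos_pos)
qed

lemma T_points_bounds:
  assumes "(A, B, C) \<in> T_points m" "m \<le> \<nu>"
  shows "val (A, B, C) = m" "0 \<le> A" "A < \<alpha>" "0 \<le> B" "2 * B < q" "0 \<le> C" "2 * C < r"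
proof -
  show v: "val (A, B, C) = m" and r: "0 \<le> A" "A < \<alpha>" "0 \<le> B" "0 \<le> C"
    using assms(1) unfolding T_points_def fibre_def by auto
  have "0 \<le> A * (q * r)" "0 \<le> B * (p * r)" "0 \<le> C * (p * q)" using r moduli_pos by auto
  moreover have "m \<le> n" using assms(2) moduli_pos unfolding \<nu>_def by (auto split: if_splits)
  ultimately have "B * (p * r) \<le> n" "C * (p * q) \<le> n" using v by auto
  thus "2 * B < q" "2 * C < r" using half[of B r q] half[of C q r] moduli_pos by (auto simp: mult.commute)
qed

text \<open>
  The upper bound on \<open>A\<close> holds because \<open>B\<close> and \<open>C\<close> lower the value by at most \<open>a p r + b p q\<close>, which is
  \<open>(\<alpha> + \<beta>) q r - e\<^sub>1 r - e\<^sub>2 q\<close>; \<open>\<nu>\<close> is chosen such that \<open>\<nu> - e\<^sub>1 r - e\<^sub>2 q \<le> n\<close>.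
\<close>

lemma K_points_bounds:
  assumes "(A, B, C) \<in> K_points m" "m \<le> \<nu>"
  shows "val (A, B, C) = m" "\<alpha> + \<beta> \<le> A" "2 * A < p - 1 + 2 * \<alpha> + 2 * \<beta>" "- a \<le> B" "B < 0" "- b \<le> C" "C < 0"
proof -
  show v: "val (A, B, C) = m" and r: "\<alpha> + \<beta> \<le> A" "- a \<le> B" "B < 0" "- b \<le> C" "C < 0"
    using assms(1) unfolding K_points_def fibre_def by auto
  have "- a * (p * r) \<le> B * (p * r)" "- b * (p * q) \<le> C * (p * q)"
    by (rule mult_right_mono; use r moduli_pos in simp)+
  moreover have "a * (p * r) + b * (p * q) = (p * a) * r + (p * b) * q" by (simp add: algebra_simps)
  moreover have "p * a = \<alpha> * q - e\<^sub>1" "p * b = \<beta> * r - e\<^sub>2" using a b by auto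
  ultimately have "A * (q * r) \<le> m + (\<alpha> * q - e\<^sub>1) * r + (\<beta> * r - e\<^sub>2) * q" using v by auto
  moreover have "m - e\<^sub>1 * r - e\<^sub>2 * q \<le> n" using assms(2) moduli_pos e unfolding \<nu>_def by (auto split: if_splits)
  ultimately have "A * (q * r) \<le> n + (\<alpha> + \<beta>) * (q * r)" by (simp add: algebra_simps)
  hence "2 * (A * (q * r)) \<le> (p - 1) * (q - 1) * (r - 1) + 2 * ((\<alpha> + \<beta>) * (q * r))" using n by linarith
  also have "(p - 1) * (q - 1) * (r - 1) < (p - 1) * (q * r)"
  proof -
    have "(q - 1) * (r - 1) < q * (r - 1)" using r_gt by (intro mult_strict_right_mono) auto
    also have "\<dots> \<le> q * r" using moduli_pos by (intro mult_left_mono) auto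
    finally have "(q - 1) * (r - 1) < q * r" .
    moreover have "p - 1 > 0" using \<alpha>\<beta> by linarith
    ultimately have "(p - 1) * ((q - 1) * (r - 1)) < (p - 1) * (q * r)" by (simp only: mult_less_cancel_left_pos)
    thus ?thesis by (simp only: mult.assoc)
  qed
  finally have "(q * r) * (2 * A) < (q * r) * (p - 1 + 2 * \<alpha> + 2 * \<beta>)" by (simp add: algebra_simps)
  moreover have "q * r > 0" using moduli_pos by simp
  ultimately show "2 * A < p - 1 + 2 * \<alpha> + 2 * \<beta>" by (simp only: mult_less_cancel_left_pos)
qed

lemma M_points_bounds:
  assumes "(A, B, C) \<in> M_points m" "m \<le> \<nu>"
  shows "val (A, B, C) = m" "\<alpha> \<le> A" "A < \<alpha> + \<beta>" "- a \<le> B" "2 * B < q"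
proof -
  show v: "val (A, B, C) = m" and r: "\<alpha> \<le> A" "A < \<alpha> + \<beta>" "- a \<le> B"
    using assms(1) unfolding M_points_def fibre_def by auto
  have c: "- b \<le> C" "0 \<le> C \<or> \<beta> \<le> A" using assms(1) unfolding M_points_def fibre_def by auto
  have "B * (p * r) \<le> n"
  proof (cases "0 \<le> C")
    case True
    hence "0 \<le> A * (q * r)" "0 \<le> C * (p * q)" using r \<alpha>\<beta> moduli_pos by auto
    moreover have "m \<le> n" using assms(2) moduli_pos unfolding \<nu>_def by (auto split: if_splits)
    ultimately show ?thesis using v by auto
  next
    case False
    have "\<beta> * (q * r) \<le> A * (q * r)" "- b * (p * q) \<le> C * (p * q)"
      by (rule mult_right_mono; use c False moduli_pos in simp)+
    moreover have "\<beta> * (q * r) - b * (p * q) = (\<beta> * r - p * b) * q" by (simp add: algebra_simps)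
    hence "\<beta> * (q * r) - b * (p * q) = e\<^sub>2 * q" using b by simp
    moreover have "m - e\<^sub>2 * q \<le> n" using assms(2) moduli_pos e unfolding \<nu>_def by (auto split: if_splits)
    ultimately show ?thesis using v by auto
  qed
  thus "2 * B < q" using half[of B r q] moduli_pos by (auto simp: mult.commute)
qed

text \<open>
  In all cases \<open>-a \<le> B < q/2\<close>, so points of equal value share \<open>B\<close>.  Then \<open>A\<close>, or for type \<open>K\<close> the
  coordinate \<open>C\<close>, varies too little for a nonzero relation.
\<close>

lemma unique:
  assumes m: "m \<le> \<nu>"
  shows "t \<in> T_points m \<union> K_points m \<Longrightarrow> t' \<in> T_points m \<union> K_points m \<Longrightarrow> t = t'" "T_points m \<inter> K_points m = {}"
    "t \<in> M_points m \<Longrightarrow> t' \<in> M_points m \<Longrightarrow> t = t'"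
proof -
  obtain A B C A' B' C' where t: "t = (A, B, C)" "t' = (A', B', C')" by (cases t, cases t')
  show "T_points m \<inter> K_points m = {}" unfolding T_points_def K_points_def fibre_def by auto
  show "t = t'" if "t \<in> M_points m" "t' \<in> M_points m"
  proof -
    note 1 = M_points_bounds[OF that(1)[unfolded t] m] and 2 = M_points_bounds[OF that(2)[unfolded t] m]
    have "val (A, B, C) = val (A', B', C')" by (simp only: 1(1) 2(1))
    note same = same_val[OF this 1(4,5) 2(4,5)]
    have "\<bar>A' - A\<bar> < p" using 1(2,3) 2(2,3) \<alpha>\<beta> by auto
    thus ?thesis using same unfolding t by auto
  qed
  assume u: "t \<in> T_points m \<union> K_points m" "t' \<in> T_points m \<union> K_points m"
  have B: "val s = m \<and> - a \<le> fst (snd s) \<and> 2 * fst (snd s) < q" if "s \<in> T_points m \<union> K_points m" for s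
    using that T_points_bounds[OF _ m, of "fst s" "fst (snd s)" "snd (snd s)"] K_points_bounds[OF _ m, of "fst s" "fst (snd s)" "snd (snd s)"] ab_small moduli_pos by auto
  have BB: "B' = B" using B[OF u(1)] B[OF u(2)] unfolding t by (intro same_val(1)[of A B C A' B' C']) simp_all
  have "\<bar>A' - A\<bar> < p \<or> \<bar>C' - C\<bar> < r"
  proof (cases "B \<ge> 0")
    case True
    hence "t \<in> T_points m" "t' \<in> T_points m" using u BB K_points_bounds(5)[OF _ m] unfolding t by (auto simp: not_less[symmetric])
    hence "\<bar>A' - A\<bar> < p" using T_points_bounds(2,3)[OF _ m, of A B C] T_points_bounds(2,3)[OF _ m, of A' B' C'] \<alpha>\<beta> unfolding t by auto
    thus ?thesis ..
  next
    case False
    hence "t \<in> K_points m" "t' \<in> K_points m" using u BB T_points_bounds(4)[OF _ m] unfolding t by auto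
    hence "\<bar>C' - C\<bar> < r" using K_points_bounds(6,7)[OF _ m, of A B C] K_points_bounds(6,7)[OF _ m, of A' B' C'] ab_small moduli_pos unfolding t by auto
    thus ?thesis ..
  qed
  thus "t = t'" using same_val(2)[of A B C A' B' C'] B[OF u(1)] B[OF u(2)] BB unfolding t by simp
qed

lemma card_le_1:
  assumes "\<And>t t'. t \<in> S \<Longrightarrow> t' \<in> S \<Longrightarrow> t = t'"
  shows "int (card S) \<le> of_bool (S \<noteq> {})"
proof (cases "S = {}")
  case False
  then obtain t where "t \<in> S" by blast
  hence "S = {t}" using assms by blast
  thus ?thesis by simp
qed simp

lemma sum_card_le:
  fixes F :: "int \<Rightarrow> (int \<times> int \<times> int) set"
  assumes "\<And>k t t'. k \<in> {0..<p} \<Longrightarrow> t \<in> F k \<Longrightarrow> t' \<in> F k \<Longrightarrow> t = t'"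
  shows "(\<Sum>k\<in>{0..<p}. int (card (F k))) \<le> int (card {k\<in>{0..<p}. F k \<noteq> {}})"
proof -
  have "(\<Sum>k\<in>{0..<p}. int (card (F k))) \<le> (\<Sum>k\<in>{0..<p}. of_bool (F k \<noteq> {}))"
    using assms by (intro sum_mono card_le_1) blast
  also have "\<dots> = int (card {k\<in>{0..<p}. F k \<noteq> {}})"
    by (simp add: of_bool_def sum.If_cases Int_def)
  finally show ?thesis .
qed

text \<open>
  On the points counted negatively, equal values of \<open>A\<close> would make two positions congruent modulo \<open>p\<close>; so
  there are at most \<open>\<beta>\<close> of them.
\<close>

lemma weight_sum_lower: "- \<beta> \<le> (\<Sum>k\<in>{0..<p}. weight (\<nu> - k))"
proof -
  let ?M = "{k\<in>{0..<p}. M_points (\<nu> - k) \<noteq> {}}"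
  define f where "f k = (SOME t. t \<in> M_points (\<nu> - k))" for k
  have f: "f k \<in> M_points (\<nu> - k)" "k \<in> {0..<p}" if "k \<in> ?M" for k
    using that unfolding f_def by (auto intro: someI)
  have bounds: "val (f k) = \<nu> - k" "\<alpha> \<le> fst (f k)" "fst (f k) < \<alpha> + \<beta>" if "k \<in> ?M" for k
    using M_points_bounds[of "fst (f k)" "fst (snd (f k))" "snd (snd (f k))" "\<nu> - k"] f[OF that] by auto
  have "inj_on (\<lambda>k. fst (f k)) ?M"
  proof (rule inj_onI)
    fix k l assume kl: "k \<in> ?M" "l \<in> ?M" "fst (f k) = fst (f l)"
    obtain A B C A' B' C' where t: "f k = (A, B, C)" "f l = (A', B', C')" by (cases "f k", cases "f l")
    have "l - k = p * ((B - B') * r + (C - C') * q)"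
      using bounds(1)[OF kl(1)] bounds(1)[OF kl(2)] kl(3) unfolding t by (simp add: algebra_simps)
    hence "p dvd l - k" by simp
    moreover have "\<bar>l - k\<bar> < p" using f(2)[OF kl(1)] f(2)[OF kl(2)] by auto
    ultimately show "k = l" using dvd_imp_le_int[of "l - k" p] by linarith
  qed
  hence "card ?M = card ((\<lambda>k. fst (f k)) ` ?M)" by (simp add: card_image)
  moreover have "(\<lambda>k. fst (f k)) ` ?M \<subseteq> {\<alpha>..<\<alpha> + \<beta>}"
    by (intro image_subsetI) (simp only: bounds atLeastLessThan_iff)
  hence "int (card ((\<lambda>k. fst (f k)) ` ?M)) \<le> \<beta>"
    using card_int_subset_atLeastLessThan[of "(\<lambda>k. fst (f k)) ` ?M" \<alpha> "\<alpha> + \<beta>"] \<alpha>\<beta> by simp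
  ultimately have "int (card ?M) \<le> \<beta>" by simp
  moreover have "(\<Sum>k\<in>{0..<p}. int (card (M_points (\<nu> - k)))) \<le> int (card ?M)"
  proof (rule sum_card_le)
    fix k t t' assume "k \<in> {0..<p}" "t \<in> M_points (\<nu> - k)" "t' \<in> M_points (\<nu> - k)"
    thus "t = t'" using unique(3)[of "\<nu> - k" t t'] by simp
  qed
  moreover have "(\<Sum>k\<in>{0..<p}. - int (card (M_points (\<nu> - k)))) \<le> (\<Sum>k\<in>{0..<p}. weight (\<nu> - k))"
    by (intro sum_mono weight_bounds(2))
  ultimately show ?thesis by (simp add: sum_negf)
qed

lemma weight_sum_upper: "2 * (\<Sum>k\<in>{0..<p}. weight (\<nu> - k)) \<le> p + \<beta>"
proof -
  define T where "T = {k\<in>{0..<p}. T_points (\<nu> - k) \<noteq> {}}"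
  define K where "K = {k\<in>{0..<p}. K_points (\<nu> - k) \<noteq> {}}"
  define f where "f k = (SOME t. t \<in> T_points (\<nu> - k) \<union> K_points (\<nu> - k))" for k
  have le: "\<nu> - k \<le> \<nu>" if "k \<in> T \<union> K" for k using that unfolding T_def K_def by auto
  have f: "f k \<in> T_points (\<nu> - k) \<union> K_points (\<nu> - k)" if "k \<in> T \<union> K" for k
  proof -
    have "\<exists>t. t \<in> T_points (\<nu> - k) \<union> K_points (\<nu> - k)" using that unfolding T_def K_def by blast
    thus ?thesis unfolding f_def by (rule someI_ex)
  qed
  have fT: "f k \<in> T_points (\<nu> - k)" if k: "k \<in> T" for k
  proof -
    obtain t where "t \<in> T_points (\<nu> - k)" using k unfolding T_def by blast
    moreover from this have "f k = t" using unique(1)[OF le] f k by blast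
    ultimately show ?thesis by simp
  qed
  have fK: "f k \<in> K_points (\<nu> - k)" if k: "k \<in> K" for k
  proof -
    obtain t where "t \<in> K_points (\<nu> - k)" using k unfolding K_def by blast
    moreover from this have "f k = t" using unique(1)[OF le] f k by blast
    ultimately show ?thesis by simp
  qed
  define A where "A k = fst (f k)" for k
  define B where "B k = fst (snd (f k))" for k
  define C where "C k = snd (snd (f k))" for k
  have ABC: "f k = (A k, B k, C k)" for k unfolding A_def B_def C_def by simp
  have TB: "val (A k, B k, C k) = \<nu> - k" "0 \<le> A k" "A k < \<alpha>" "0 \<le> B k" "2 * B k < q" "0 \<le> C k" "2 * C k < r"
    if "k \<in> T" for k using T_points_bounds[OF fT[OF that, unfolded ABC] le] that by blast+
  have KB: "val (A k, B k, C k) = \<nu> - k" "\<alpha> + \<beta> \<le> A k" "2 * A k < p - 1 + 2 * \<alpha> + 2 * \<beta>" "- a \<le> B k" "B k < 0" "- b \<le> C k" "C k < 0"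
    if "k \<in> K" for k using K_points_bounds[OF fK[OF that, unfolded ABC] le] that by blast+
  interpret arrangement p q r \<alpha> \<beta> a b 1 \<nu> T K A B C
  proof
    show "T \<subseteq> {0..<p}" "K \<subseteq> {0..<p}" unfolding T_def K_def by auto
    show "p * a \<le> \<alpha> * q + 1" "p * b \<le> \<beta> * r + 1" using a b e by auto
    show "A k * (q * r) + B k * (p * r) + C k * (p * q) = \<nu> - 1 * k" if "k \<in> T \<union> K" for k
      using that TB(1)[of k] KB(1)[of k] by auto
  qed (fact odd_p q_gt r_gt cop \<alpha>\<beta> inv TB KB | simp)+
  have bound: "2 * num \<le> p + \<beta>" by (rule num_bound[OF nondeg])
  have "(\<Sum>k\<in>{0..<p}. weight (\<nu> - k)) \<le> (\<Sum>k\<in>{0..<p}. int (card (T_points (\<nu> - k))) + int (card (K_points (\<nu> - k))))"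
    by (intro sum_mono weight_bounds(1))
  also have "\<dots> = (\<Sum>k\<in>{0..<p}. int (card (T_points (\<nu> - k)))) + (\<Sum>k\<in>{0..<p}. int (card (K_points (\<nu> - k))))"
    by (rule sum.distrib)
  also have "\<dots> \<le> int (card T) + int (card K)"
    unfolding T_def K_def
  proof (intro add_mono sum_card_le)
    fix k t t' assume k: "k \<in> {0..<p}"
    hence le: "\<nu> - k \<le> \<nu>" by simp
    show "t \<in> T_points (\<nu> - k) \<Longrightarrow> t' \<in> T_points (\<nu> - k) \<Longrightarrow> t = t'" "t \<in> K_points (\<nu> - k) \<Longrightarrow> t' \<in> K_points (\<nu> - k) \<Longrightarrow> t = t'"
      using unique(1)[OF le] by blast+
  qed
  finally have "2 * (\<Sum>k\<in>{0..<p}. weight (\<nu> - k)) \<le> 2 * num" by (intro mult_left_mono) simp_all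
  thus ?thesis using bound by (rule order_trans)
qed

lemma abs_sum_bound:
  "2 * \<bar>\<Sum>k\<in>{0..<p}. N (n - k) - N (n - k - q) - N (n - k - r) + N (n - k - q - r)\<bar> \<le> p + \<beta>"
proof -
  have "(\<Sum>k\<in>{0..<p}. N (n - k) - N (n - k - q) - N (n - k - r) + N (n - k - q - r))
    = e\<^sub>1 * e\<^sub>2 * (\<Sum>k\<in>{0..<p}. weight (\<nu> - k))"
    by (simp only: summand_eq_weight sum_distrib_left)
  moreover have "\<bar>e\<^sub>1 * e\<^sub>2\<bar> = 1" using e by auto
  ultimately have "\<bar>\<Sum>k\<in>{0..<p}. N (n - k) - N (n - k - q) - N (n - k - r) + N (n - k - q - r)\<bar>
    = \<bar>\<Sum>k\<in>{0..<p}. weight (\<nu> - k)\<bar>" by (simp only: abs_mult mult_1)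
  thus ?thesis using weight_sum_lower weight_sum_upper \<alpha>\<beta> by linarith
qed

end

section \<open>The height of the cyclotomic polynomial\<close>

text \<open>
  The distance from the inverse of \<open>u\<close> modulo \<open>p\<close> to the nearest multiple of \<open>p\<close>; \<open>alpha\<close> is the smaller and
  \<open>beta_star\<close> the larger of its values at \<open>q\<close> and \<open>r\<close>.
\<close>

definition abs_inverse :: "int \<Rightarrow> int \<Rightarrow> int" where
  "abs_inverse p u = min (modular_inverse p u) (p - modular_inverse p u)"

lemma modular_inverse_range:
  fixes p u :: int
  assumes "coprime u p" "p > 1"
  shows "0 < modular_inverse p u" "modular_inverse p u < p" "p dvd u * modular_inverse p u - 1"
proof -
  show d: "p dvd u * modular_inverse p u - 1"
    using cong_modular_inverse1[OF assms(1)] by (simp add: cong_iff_dvd_diff)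
  show "modular_inverse p u < p" using assms(2) by (simp add: modular_inverse_int_less)
  have "modular_inverse p u \<noteq> 0" using d assms(2) zdvd_imp_le[of p 1] by auto
  thus "0 < modular_inverse p u" using modular_inverse_int_nonneg[of p u] assms(2) by simp
qed

lemma abs_inverse:
  assumes "coprime u p" "p > 1" "odd p"
  shows "1 \<le> abs_inverse p u" "2 * abs_inverse p u < p"
    and "\<exists>x e. abs_inverse p u * u = p * x + e \<and> (e = 1 \<and> abs_inverse p u = modular_inverse p u
      \<or> e = -1 \<and> abs_inverse p u = p - modular_inverse p u)"
proof -
  let ?v = "modular_inverse p u"
  note v = modular_inverse_range[OF assms(1,2)]
  show "1 \<le> abs_inverse p u" using v unfolding abs_inverse_def by auto
  have "2 * ?v \<noteq> p" using assms(3) by (metis dvd_triv_left)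
  thus "2 * abs_inverse p u < p" unfolding abs_inverse_def by (auto simp: min_def)
  obtain x where x: "u * ?v - 1 = p * x" using v(3) by blast
  show "\<exists>x e. abs_inverse p u * u = p * x + e \<and> (e = 1 \<and> abs_inverse p u = modular_inverse p u
      \<or> e = -1 \<and> abs_inverse p u = p - modular_inverse p u)"
  proof (cases "?v \<le> p - ?v")
    case True
    hence "abs_inverse p u = ?v" unfolding abs_inverse_def by simp
    moreover have "?v * u = p * x + 1" using x by (simp add: algebra_simps)
    ultimately show ?thesis by metis
  next
    case False
    hence "abs_inverse p u = p - ?v" unfolding abs_inverse_def by simp
    moreover have "(p - ?v) * u = p * (u - x) + -1" using x by (simp add: algebra_simps)
    ultimately show ?thesis by metis
  qed
qed

text \<open>
  If \<open>q r \<equiv> \<plusminus>1\<close>, the inverse of \<open>q\<close> is congruent to \<open>r\<close> or \<open>-r\<close>, so \<open>abs_inverse p q\<close> would be the distance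
  from \<open>r\<close> to the nearest multiple of \<open>p\<close>.
\<close>

lemma not_cong_pm1:
  fixes p q r :: int
  assumes "coprime q p" "p > 1" and small: "3 * abs_inverse p q < p"
    and far: "p \<le> 3 * (r mod p)" "p \<le> 3 * (p - r mod p)"
  shows "\<not> [q * r = 1] (mod p)" "\<not> [q * r = -1] (mod p)"
proof -
  have less: "0 < r mod p" "r mod p < p" using far(1) assms(2) by auto
  have r: "p dvd q * r - q * (r mod p)"
    by (simp add: right_diff_distrib[symmetric] minus_mod_eq_mult_div)
  show "\<not> [q * r = 1] (mod p)"
  proof
    assume "[q * r = 1] (mod p)"
    hence "p dvd (q * r - 1) - (q * r - q * (r mod p))" using r by (simp only: cong_iff_dvd_diff dvd_diff)
    hence "modular_inverse p q = r mod p"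
      using less by (intro modular_inverse_int_eqI) (simp_all add: cong_iff_dvd_diff)
    thus False using small far unfolding abs_inverse_def by (auto simp: min_def split: if_splits)
  qed
  show "\<not> [q * r = -1] (mod p)"
  proof
    assume "[q * r = -1] (mod p)"
    hence "p dvd q * r - -1" by (simp only: cong_iff_dvd_diff)
    hence "p dvd (q * r - q * (r mod p)) - (q * r - -1) + p * q" by (intro dvd_add[OF dvd_diff[OF r] dvd_triv_left])
    moreover have "(q * r - q * (r mod p)) - (q * r - -1) + p * q = q * (p - r mod p) - 1" by (simp add: algebra_simps)
    ultimately have "modular_inverse p q = p - r mod p"
      using less by (intro modular_inverse_int_eqI) (simp_all only: cong_iff_dvd_diff, auto)
    thus False using small far unfolding abs_inverse_def by (auto simp: min_def split: if_splits)
  qed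
qed

text \<open>
  The reflection of the coefficients reduces to indices in the lower half, where \<open>abs_sum_bound\<close>
  applies.
\<close>

lemma cyclotomic_height_le_abs_inverse:
  fixes p q r :: nat
  assumes primes: "prime p" "prime q" "prime r" and "odd p" and gt: "p < q" "p < r" "q \<noteq> r" "4 < q" "4 < r"
    and le: "abs_inverse p q \<le> abs_inverse p r"
    and far: "int p \<le> 3 * (int r mod p)" "int p \<le> 3 * (p - int r mod p)"
  shows "cyclotomic_height (p * q * r) \<le> (real p + real_of_int (abs_inverse p r)) / 2"
proof -
  have p3: "p > 1" using primes(1) by (rule prime_gt_1_nat)
  have cop_nat: "coprime p q" "coprime p r" "coprime q r"
    using primes gt by (auto intro!: primes_coprime)
  have cop: "coprime (int p) (int q)" "coprime (int p) (int r)" "coprime (int q) (int r)"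
    using cop_nat by simp_all
  have cop': "coprime (int q) (int p)" "coprime (int r) (int p)" using cop by (simp_all add: coprime_commute)
  have op: "odd (int p)" "int p > 1" using \<open>odd p\<close> p3 by auto
  let ?\<alpha> = "abs_inverse p q" and ?\<beta> = "abs_inverse p r"
  obtain a e\<^sub>1 :: int where a: "?\<alpha> * q = p * a + e\<^sub>1" "e\<^sub>1 = 1 \<or> e\<^sub>1 = -1"
    using abs_inverse(3)[OF cop'(1) op(2,1)] by blast
  obtain b e\<^sub>2 :: int where b: "?\<beta> * r = p * b + e\<^sub>2" "e\<^sub>2 = 1 \<or> e\<^sub>2 = -1"
    using abs_inverse(3)[OF cop'(2) op(2,1)] by blast
  let ?n = "p * q * r" let ?c = "cyclotomic_poly ?n"
  have n1: "1 < ?n" using p3 gt by (intro less_1_mult) auto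
  have tot: "int (totient ?n) = (int p - 1) * (int q - 1) * (int r - 1)"
  proof -
    have "coprime (p * q) r" using cop_nat by simp
    hence "totient ?n = (p - 1) * (q - 1) * (r - 1)"
      using cop_nat primes by (simp add: totient_mult_coprime totient_prime)
    moreover have "1 \<le> p" "1 \<le> q" "1 \<le> r" using primes[THEN prime_gt_0_nat] by simp_all
    ultimately show ?thesis by (simp add: of_nat_diff)
  qed
  have inv: "[?\<alpha> * ?\<beta> * q * r = 1] (mod p) \<or> [?\<alpha> * ?\<beta> * q * r = -1] (mod p)"
  proof -
    have "?\<alpha> * ?\<beta> * q * r = (?\<alpha> * q) * (?\<beta> * r)" by (simp add: algebra_simps)
    also have "\<dots> = p * (a * (p * b + e\<^sub>2) + e\<^sub>1 * b) + e\<^sub>1 * e\<^sub>2" unfolding a b by (simp add: algebra_simps)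
    finally have "?\<alpha> * ?\<beta> * q * r - e\<^sub>1 * e\<^sub>2 = p * (a * (p * b + e\<^sub>2) + e\<^sub>1 * b)" by simp
    hence "int p dvd ?\<alpha> * ?\<beta> * q * r - e\<^sub>1 * e\<^sub>2" by (metis dvd_triv_left)
    hence "[?\<alpha> * ?\<beta> * q * r = e\<^sub>1 * e\<^sub>2] (mod p)" by (simp only: cong_iff_dvd_diff)
    thus ?thesis using a(2) b(2) by auto
  qed
  have low: "norm (coeff ?c n) \<le> (real p + real_of_int ?\<beta>) / 2" if hn: "2 * n \<le> totient ?n" for n
  proof -
    have tn: "2 * int n \<le> (int p - 1) * (int q - 1) * (int r - 1)" using hn tot by linarith
    interpret coefficient_window "int p" "int q" "int r" ?\<alpha> ?\<beta> a b e\<^sub>1 e\<^sub>2 "int n"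
    proof
      show "3 * ?\<beta> < int p \<Longrightarrow> \<not> [int q * int r = 1] (mod int p) \<and> \<not> [int q * int r = - 1] (mod int p)"
        using not_cong_pm1[OF cop'(1) op(2) _ far] le by simp
      show "int p > 0" "int q > 0" "int r > 0" "int q > 4" "int r > 4" using gt p3 by simp_all
    qed (fact op cop le abs_inverse(1)[OF cop'(1) op(2,1)] abs_inverse(2)[OF cop'(2) op(2,1)]
        a b inv tn)+
    have "totient ?n < ?n" using n1 by (rule totient_less)
    hence nlt: "n < ?n" using hn by linarith
    have "(\<Sum>k<p. N (int n - int k) - N (int n - int k - int q) - N (int n - int k - int r) + N (int n - int k - int q - int r))
      = (\<Sum>k\<in>int ` {..<p}. N (int n - k) - N (int n - k - int q) - N (int n - k - int r) + N (int n - k - int q - int r))"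
      by (simp add: sum.reindex)
    also have "int ` {..<p} = {0..<int p}" using image_int_atLeastLessThan[of 0 p] by (simp add: lessThan_atLeast0)
    finally have sum_eq: "(\<Sum>k<p. N (int n - int k) - N (int n - int k - int q) - N (int n - int k - int r) + N (int n - int k - int q - int r))
      = (\<Sum>k\<in>{0..<int p}. N (int n - k) - N (int n - k - int q) - N (int n - k - int r) + N (int n - k - int q - int r))"
      (is "_ = ?X") .
    have "p \<noteq> q" "p \<noteq> r" using gt by auto
    hence "coeff ?c n = of_int ?X"
      using coeff_cyclotomic_three_primes[OF primes _ _ gt(3) nlt] unfolding sum_eq by blast
    hence "norm (coeff ?c n) = \<bar>real_of_int ?X\<bar>" by (simp only: norm_of_int)
    moreover have "real_of_int (2 * \<bar>?X\<bar>) \<le> real_of_int (int p + ?\<beta>)"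
      using abs_sum_bound by (simp only: of_int_le_iff)
    hence "2 * \<bar>real_of_int ?X\<bar> \<le> real p + real_of_int ?\<beta>"
      by (simp only: of_int_mult of_int_abs of_int_add of_int_numeral of_int_of_nat_eq)
    ultimately show ?thesis by (simp only: le_divide_eq_numeral1 mult.commute)
  qed
  have "norm (coeff ?c i) \<le> (real p + real_of_int ?\<beta>) / 2" if i: "i \<le> totient ?n" for i
  proof (cases "2 * i \<le> totient ?n")
    case True thus ?thesis by (rule low)
  next
    case False
    have "norm (coeff ?c i) = norm (coeff ?c (totient ?n - i))"
      using n1 norm_coeff_cyclotomic_poly_reflect i by metis
    also have "\<dots> \<le> (real p + real_of_int ?\<beta>) / 2" by (rule low) (use False in simp)
    finally show ?thesis .
  qed
  thus ?thesis unfolding cyclotomic_height_def by (subst Max_le_iff) auto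
qed

lemma alpha_abs_inverse: "alpha p q r = min (abs_inverse p q) (abs_inverse p r)"
  unfolding alpha_def abs_inverse_def Let_def by (simp add: min.assoc min.commute min.left_commute)

text \<open>
  As \<open>alpha p q r * q \<equiv> \<plusminus>1\<close>, the number \<open>beta p q r\<close> is the inverse of \<open>\<plusminus>r\<close>.
\<close>

lemma beta_star_abs_inverse:
  assumes cop: "coprime p q" "coprime p r" and "p > 1" "odd p"
    and le: "abs_inverse p q \<le> abs_inverse p r"
  shows "beta_star p q r = abs_inverse p r"
proof -
  have cop': "coprime (int q) (int p)" "coprime (int r) (int p)" using cop by (simp_all add: coprime_commute)
  have op: "odd (int p)" "int p > 1" using assms by auto
  have \<alpha>: "alpha p q r = abs_inverse p q" using le by (simp add: alpha_abs_inverse)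
  let ?r = "modular_inverse (int p) (int r)"
  note r = modular_inverse_range[OF cop'(2) op(2)]
  obtain a e :: int where a: "abs_inverse p q * q = p * a + e" "e = 1 \<or> e = -1"
    using abs_inverse(3)[OF cop'(1) op(2,1)] by blast
  from a(2) have "beta p q r = ?r \<or> beta p q r = p - ?r"
  proof
    assume e: "e = 1"
    have "abs_inverse p q * q * r * ?r - 1 = p * (a * r * ?r) + (r * ?r - 1)" unfolding a e by (simp add: algebra_simps)
    moreover have "int p dvd p * (a * r * ?r) + (r * ?r - 1)" using r(3) by (intro dvd_add) auto
    ultimately have "[abs_inverse p q * q * r * ?r = 1] (mod p)" by (simp only: cong_iff_dvd_diff)
    hence "beta p q r = ?r" unfolding beta_def \<alpha> using r by (intro modular_inverse_int_eqI) auto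
    thus ?thesis ..
  next
    assume e: "e = -1"
    have "abs_inverse p q * q * r * (p - ?r) - 1 = p * (a * r * (p - ?r) - r) + (r * ?r - 1)"
      unfolding a e by (simp add: algebra_simps)
    moreover have "int p dvd p * (a * r * (p - ?r) - r) + (r * ?r - 1)" using r(3) by (intro dvd_add) auto
    ultimately have "[abs_inverse p q * q * r * (p - ?r) = 1] (mod p)" by (simp only: cong_iff_dvd_diff)
    hence "beta p q r = p - ?r" unfolding beta_def \<alpha> using r by (intro modular_inverse_int_eqI) auto
    thus ?thesis ..
  qed
  thus ?thesis unfolding beta_star_def abs_inverse_def by (auto simp: min.commute)
qed

theorem theorem3p3:
  fixes p q r :: nat
  assumes "prime p" "prime q" "prime r"
    and "odd p" "odd q" "odd r"
    and "p < q" "q < r"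
    and "real (Min {q mod p, p - q mod p, r mod p, p - r mod p}) > (real p - 1) / 3"
  shows "cyclotomic_height (p * q * r) \<le> (real p + real_of_int (beta_star p q r)) / 2"
proof -
  have p3: "p > 1" "p \<noteq> 2" using prime_gt_1_nat[OF assms(1)] assms(4) by auto
  have cop: "coprime p q" "coprime p r" using assms(1-3,7,8) by (auto intro!: primes_coprime)
  have gt: "p < q" "p < r" "4 < q" "4 < r"
  proof -
    have "q \<noteq> 4" "p \<ge> 3" using assms(5) p3 by auto
    thus "p < q" "p < r" "4 < q" "4 < r" using assms(7,8) by auto
  qed
  have "p \<le> 3 * x" if "x \<in> {q mod p, p - q mod p, r mod p, p - r mod p}" for x
  proof -
    have "Min {q mod p, p - q mod p, r mod p, p - r mod p} \<le> x" using that by (intro Min_le) auto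
    hence "real (Min {q mod p, p - q mod p, r mod p, p - r mod p}) \<le> real x" by (simp only: of_nat_le_iff)
    with assms(9) have "(real p - 1) / 3 < real x" by (rule less_le_trans)
    hence "real p < real (3 * x + 1)" by (simp add: field_simps)
    thus ?thesis by (simp only: of_nat_less_iff less_Suc_eq_le Suc_eq_plus1[symmetric])
  qed
  hence nat: "p \<le> 3 * (q mod p)" "p \<le> 3 * (p - q mod p)" "p \<le> 3 * (r mod p)" "p \<le> 3 * (p - r mod p)" by blast+
  have to_int: "int p \<le> 3 * int x" "int p \<le> 3 * (int p - int y)" if "p \<le> 3 * x" "p \<le> 3 * (p - y)" "y \<le> p" for x y
  proof -
    have "int p \<le> int (3 * x)" "int p \<le> int (3 * (p - y))" using that by (simp_all only: of_nat_le_iff)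
    thus "int p \<le> 3 * int x" "int p \<le> 3 * (int p - int y)" using that(3) by (simp_all add: of_nat_diff)
  qed
  have le: "q mod p \<le> p" "r mod p \<le> p" using p3 by (simp_all add: less_imp_le)
  have far: "int p \<le> 3 * (int q mod p)" "int p \<le> 3 * (p - int q mod p)"
    "int p \<le> 3 * (int r mod p)" "int p \<le> 3 * (p - int r mod p)"
    unfolding zmod_int[symmetric] using to_int[OF nat(1,2) le(1)] to_int[OF nat(3,4) le(2)] by blast+
  show ?thesis
  proof (cases "abs_inverse p q \<le> abs_inverse p r")
    case True
    have "beta_star p q r = abs_inverse p r" using beta_star_abs_inverse[OF cop p3(1) assms(4) True] .
    thus ?thesis using cyclotomic_height_le_abs_inverse[OF assms(1-4) gt(1,2) _ gt(3,4) True far(3,4)] assms(8) by simp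
  next
    case False
    hence le: "abs_inverse p r \<le> abs_inverse p q" by simp
    have sym: "alpha p q r = alpha p r q" by (simp add: alpha_abs_inverse min.commute)
    have "beta_star p q r = beta_star p r q"
      unfolding beta_star_def beta_def sym by (simp add: mult.commute mult.left_commute)
    also have "\<dots> = abs_inverse p q" using beta_star_abs_inverse[OF cop(2,1) p3(1) assms(4) le] .
    finally have beta: "beta_star p q r = abs_inverse p q" .
    have swap: "p * q * r = p * r * q" by simp
    have "r \<noteq> q" using assms(8) by simp
    thus ?thesis unfolding beta swap
      using cyclotomic_height_le_abs_inverse[OF assms(1,3,2,4) gt(2,1) _ gt(4,3) le far(1,2)] by blast
  qed
qed

end
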